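(* Let $\mathcal{T}'\in\mathbb{K}^{I_1\times I_2\times I_3}$ have multilinear rank $(R,R,K)$, and let $\mathcal{T}\in\mathbb{K}^{R\times R\times K}$ be an orthogonal compression of $\mathcal{T}'$. Then: (1) $\mathcal{T}'$ has $\mathbb{K}$-rank $R$ if and only if the JGE vectors of $\mathcal{T}$ span $\mathbb{K}^R$. Furthermore, if $\mathcal{T}=[\![\mathbf{A},\mathbf{B},\mathbf{C}]\!]$ has $\mathbb{K}$-rank $R$, then the JGE values of $\mathcal{T}$ are exactly the spans of the columns of $\mathbf{C}$, and the columns of $\mathbf{B}^{-\mathrm{T}}$ are JGE vectors of $\mathcal{T}$. (2) If $\mathcal{T}'$ has border $\mathbb{K}$-rank $R$ and $\mathcal{T}$ is simple, then $\mathcal{T}'$ has $\mathbb{K}$-rank $R$. (3) If $\mathcal{T}'$ has border $\mathbb{K}$-rank $R$ but $\mathbb{K}$-rank strictly greater than $R$, and $\mathcal{T}$ is slice mix invertible, then $\mathcal{T}$ has a JGE value $\mathscr{L}\subset\mathbb{K}^K$ with $\mathrm{am}(\mathscr{L})>\mathrm{gm}(\mathscr{L})\geq 1$.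
   Context: $\mathbb{K}$ denotes $\mathbb{R}$ or $\mathbb{C}$. A rank one tensor is $\mathbf{a}\otimes\mathbf{b}\otimes\mathbf{c}$ with nonzero vectors, $(\mathbf{a}\otimes\mathbf{b}\otimes\mathbf{c})_{ijk}=a_ib_jc_k$. The $\mathbb{K}$-rank of a tensor is the least number of rank one tensors with $\mathbb{K}$-valued factors summing to it; a minimal such sum $\sum_{r=1}^R\mathbf{a}_r\otimes\mathbf{b}_r\otimes\mathbf{c}_r$ is a CPD, written $[\![\mathbf{A},\mathbf{B},\mathbf{C}]\!]$ where $\mathbf{A},\mathbf{B},\mathbf{C}$ have columns $\mathbf{a}_r,\mathbf{b}_r,\mathbf{c}_r$. The border $\mathbb{K}$-rank is the least $R$ such that the tensor is a limit of tensors of $\mathbb{K}$-rank at most $R$. For $\mathcal{M}'\in\mathbb{K}^{I_1\times I_2\times I_3}$, $R_1(\mathcal{M}')=\dim\mathrm{span}\{\mathcal{M}'(:,k,\ell)\}$, $R_2(\mathcal{M}')=\dim\mathrm{span}\{\mathcal{M}'(j,:,\ell)\}$, $R_3(\mathcal{M}')=\dim\mathrm{span}\{\mathcal{M}'(j,k,:)\}$ (spans of mode-$1,2,3$ fibers); $(R_1,R_2,R_3)$ is the multilinear rank. The mode-$i$ product $\mathcal{M}'\cdot_i\mathbf{U}$ applies the matrix $\mathbf{U}$ to every mode-$i$ fiber. An orthogonal compression of $\mathcal{T}'$ with multilinear rank $(R,R,K)$ is $\mathcal{T}'\cdot_1\mathbf{V}_1^{\mathrm{H}}\cdot_2\mathbf{V}_2^{\mathrm{H}}\cdot_3\mathbf{V}_3^{\mathrm{H}}$,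 where $\mathbf{V}_i$ has orthonormal columns forming a basis of the span of the mode-$i$ fibers of $\mathcal{T}'$. For $\mathcal{T}\in\mathbb{K}^{R\times R\times K}$ let $\mathbf{T}_k=\mathcal{T}(:,:,k)$. $\mathcal{T}$ is slice mix invertible if some linear combination of $\mathbf{T}_1,\dots,\mathbf{T}_K$ is invertible. A nonzero $\mathbf{x}\in\mathbb{K}^R$ is a joint generalized eigenvector (JGE vector) of $\mathcal{T}$ if there are $\boldsymbol{\lambda}\in\mathbb{K}^K$ and nonzero $\mathbf{y}\in\mathbb{K}^R$ with $\mathbf{T}_\ell\mathbf{x}=\lambda_\ell\mathbf{y}$ for all $\ell=1,\dots,K$; then $\mathrm{span}(\boldsymbol{\lambda})$ is a JGE value and $(\mathrm{span}(\boldsymbol{\lambda}),\mathbf{x})$ a JGE pair. The characteristic polynomial is $p_{\mathcal{T}}(\boldsymbol{\gamma})=\det(\sum_{k=1}^K\gamma_k\mathbf{T}_k)$. For nonzero $\boldsymbol{\lambda}$, $\mathrm{am}(\mathrm{span}(\boldsymbol{\lambda}))$ is the largest $m$ such that $(\lambda_1\gamma_1+\cdots+\lambda_K\gamma_K)^m$ divides $p_{\mathcal{T}}$, and $\mathrm{gm}(\mathrm{span}(\boldsymbol{\lambda}))$ is the dimension of the span of the JGE vectors $\mathbf{x}$ for which $(\mathrm{span}(\boldsymbol{\lambda}),\mathbf{x})$ is a JGE pair. $\mathcal{T}$ is simple if it is slice mix invertible and $p_{\mathcal{T}}$ factors as a product of $R$ pairwise non-proportional linear forms (i.e. $R$ distinct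 JGE values each of algebraic multiplicity $1$). *)

theory Defs
  imports "Jordan_Normal_Form.VS_Connect" "Jordan_Normal_Form.Jordan_Normal_Form" "Jordan_Normal_Form.Conjugate"
    "HOL.Real_Vector_Spaces"
begin

text \<open>A tensor in K^(I1 x I2 x I3) is a function of three (0-based) indices that
  vanishes outside the index box.\<close>

type_synonym 'a tensor3 = "nat \<Rightarrow> nat \<Rightarrow> nat \<Rightarrow> 'a"

definition tensor3_in :: "nat \<Rightarrow> nat \<Rightarrow> nat \<Rightarrow> 'a::zero tensor3 \<Rightarrow> bool" where
  "tensor3_in I1 I2 I3 T \<longleftrightarrow>
     (\<forall>i j k. \<not> (i < I1 \<and> j < I2 \<and> k < I3) \<longrightarrow> T i j k = 0)"

definition cpd :: "nat \<Rightarrow> nat \<Rightarrow> nat \<Rightarrow> nat \<Rightarrow> 'a::comm_ring_1 mat \<Rightarrow> 'a mat \<Rightarrow> 'a mat \<Rightarrow> 'a tensor3" where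
  "cpd I1 I2 I3 R A B C = (\<lambda>i j k. if i < I1 \<and> j < I2 \<and> k < I3
      then (\<Sum>r<R. A $$ (i, r) * B $$ (j, r) * C $$ (k, r)) else 0)"

definition is_decomp :: "nat \<Rightarrow> nat \<Rightarrow> nat \<Rightarrow> 'a::comm_ring_1 tensor3 \<Rightarrow> nat
     \<Rightarrow> 'a mat \<Rightarrow> 'a mat \<Rightarrow> 'a mat \<Rightarrow> bool" where
  "is_decomp I1 I2 I3 T R A B C \<longleftrightarrow>
     A \<in> carrier_mat I1 R \<and> B \<in> carrier_mat I2 R \<and> C \<in> carrier_mat I3 R \<and>
     (\<forall>r<R. col A r \<noteq> 0\<^sub>v I1 \<and> col B r \<noteq> 0\<^sub>v I2 \<and> col C r \<noteq> 0\<^sub>v I3) \<and>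
     T = cpd I1 I2 I3 R A B C"

definition tensor_rank :: "nat \<Rightarrow> nat \<Rightarrow> nat \<Rightarrow> 'a::comm_ring_1 tensor3 \<Rightarrow> nat" where
  "tensor_rank I1 I2 I3 T = (LEAST R. \<exists>A B C. is_decomp I1 I2 I3 T R A B C)"

text \<open>Border K-rank: least R such that T is a limit of tensors of K-rank at most R
  (entrywise convergence, equivalently in any norm on the finite-dimensional space).\<close>

definition border_rank :: "nat \<Rightarrow> nat \<Rightarrow> nat \<Rightarrow> 'a::{comm_ring_1, real_normed_vector} tensor3 \<Rightarrow> nat" where
  "border_rank I1 I2 I3 T = (LEAST R. \<exists>S :: nat \<Rightarrow> 'a tensor3.
      (\<forall>n. tensor3_in I1 I2 I3 (S n) \<and> tensor_rank I1 I2 I3 (S n) \<le> R) \<and>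
      (\<forall>i j k. (\<lambda>n. S n i j k) \<longlonglongrightarrow> T i j k))"

definition vspan :: "nat \<Rightarrow> 'a::field vec set \<Rightarrow> 'a vec set" where
  "vspan n S = LinearCombinations.module.span class_ring (module_vec TYPE('a) n) S"

definition vdim :: "nat \<Rightarrow> 'a::field vec set \<Rightarrow> nat" where
  "vdim n S = vectorspace.dim class_ring ((module_vec TYPE('a) n)\<lparr>carrier := vspan n S\<rparr>)"

definition fibers1 :: "nat \<Rightarrow> nat \<Rightarrow> nat \<Rightarrow> 'a tensor3 \<Rightarrow> 'a vec set" where
  "fibers1 I1 I2 I3 T = {vec I1 (\<lambda>i. T i j k) | j k. j < I2 \<and> k < I3}"

definition fibers2 :: "nat \<Rightarrow> nat \<Rightarrow> nat \<Rightarrow> 'a tensor3 \<Rightarrow> 'a vec set" where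
  "fibers2 I1 I2 I3 T = {vec I2 (\<lambda>j. T i j k) | i k. i < I1 \<and> k < I3}"

definition fibers3 :: "nat \<Rightarrow> nat \<Rightarrow> nat \<Rightarrow> 'a tensor3 \<Rightarrow> 'a vec set" where
  "fibers3 I1 I2 I3 T = {vec I3 (\<lambda>k. T i j k) | i j. i < I1 \<and> j < I2}"

definition mlrank :: "nat \<Rightarrow> nat \<Rightarrow> nat \<Rightarrow> 'a::field tensor3 \<Rightarrow> nat \<times> nat \<times> nat" where
  "mlrank I1 I2 I3 T = (vdim I1 (fibers1 I1 I2 I3 T), vdim I2 (fibers2 I1 I2 I3 T),
                        vdim I3 (fibers3 I1 I2 I3 T))"

definition adj :: "'a::conjugatable_field mat \<Rightarrow> 'a mat" where
  "adj V = mat (dim_col V) (dim_row V) (\<lambda>(a, i). conjugate (V $$ (i, a)))"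

definition orth_basis_mat :: "nat \<Rightarrow> nat \<Rightarrow> 'a::conjugatable_field vec set \<Rightarrow> 'a mat \<Rightarrow> bool" where
  "orth_basis_mat n r S V \<longleftrightarrow> V \<in> carrier_mat n r \<and> adj V * V = 1\<^sub>m r \<and>
     vspan n (set (cols V)) = vspan n S"

definition compress :: "nat \<Rightarrow> nat \<Rightarrow> nat \<Rightarrow> nat \<Rightarrow> nat \<Rightarrow> nat \<Rightarrow> 'a::conjugatable_field tensor3
     \<Rightarrow> 'a mat \<Rightarrow> 'a mat \<Rightarrow> 'a mat \<Rightarrow> 'a tensor3" where
  "compress I1 I2 I3 R1 R2 R3 T V1 V2 V3 = (\<lambda>a b c. if a < R1 \<and> b < R2 \<and> c < R3 then
      (\<Sum>i<I1. \<Sum>j<I2. \<Sum>k<I3. conjugate (V1 $$ (i, a)) * conjugate (V2 $$ (j, b)) *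
          conjugate (V3 $$ (k, c)) * T i j k) else 0)"

definition orth_compression :: "nat \<Rightarrow> nat \<Rightarrow> nat \<Rightarrow> nat \<Rightarrow> nat \<Rightarrow> nat
     \<Rightarrow> 'a::conjugatable_field tensor3 \<Rightarrow> 'a tensor3 \<Rightarrow> bool" where
  "orth_compression I1 I2 I3 R1 R2 R3 T' T \<longleftrightarrow> (\<exists>V1 V2 V3.
      orth_basis_mat I1 R1 (fibers1 I1 I2 I3 T') V1 \<and>
      orth_basis_mat I2 R2 (fibers2 I1 I2 I3 T') V2 \<and>
      orth_basis_mat I3 R3 (fibers3 I1 I2 I3 T') V3 \<and>
      T = compress I1 I2 I3 R1 R2 R3 T' V1 V2 V3)"

definition slice :: "nat \<Rightarrow> 'a tensor3 \<Rightarrow> nat \<Rightarrow> 'a mat" where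
  "slice R T k = mat R R (\<lambda>(i, j). T i j k)"

definition slice_comb :: "nat \<Rightarrow> nat \<Rightarrow> 'a::comm_ring_1 tensor3 \<Rightarrow> 'a vec \<Rightarrow> 'a mat" where
  "slice_comb R K T \<gamma> = mat R R (\<lambda>(i, j). \<Sum>k<K. \<gamma> $ k * T i j k)"

definition slice_mix_invertible :: "nat \<Rightarrow> nat \<Rightarrow> 'a::comm_ring_1 tensor3 \<Rightarrow> bool" where
  "slice_mix_invertible R K T \<longleftrightarrow> (\<exists>\<gamma> \<in> carrier_vec K. invertible_mat (slice_comb R K T \<gamma>))"

definition jge_pair :: "nat \<Rightarrow> nat \<Rightarrow> 'a::field tensor3 \<Rightarrow> 'a vec set \<Rightarrow> 'a vec \<Rightarrow> bool" where
  "jge_pair R K T L x \<longleftrightarrow> x \<in> carrier_vec R \<and> x \<noteq> 0\<^sub>v R \<and>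
     (\<exists>lam y. lam \<in> carrier_vec K \<and> y \<in> carrier_vec R \<and> y \<noteq> 0\<^sub>v R \<and>
        (\<forall>l<K. slice R T l *\<^sub>v x = lam $ l \<cdot>\<^sub>v y) \<and> L = vspan K {lam})"

definition jge_vector :: "nat \<Rightarrow> nat \<Rightarrow> 'a::field tensor3 \<Rightarrow> 'a vec \<Rightarrow> bool" where
  "jge_vector R K T x \<longleftrightarrow> (\<exists>L. jge_pair R K T L x)"

definition jge_value :: "nat \<Rightarrow> nat \<Rightarrow> 'a::field tensor3 \<Rightarrow> 'a vec set \<Rightarrow> bool" where
  "jge_value R K T L \<longleftrightarrow> (\<exists>x. jge_pair R K T L x)"

definition char_poly_fun :: "nat \<Rightarrow> nat \<Rightarrow> 'a::comm_ring_1 tensor3 \<Rightarrow> 'a vec \<Rightarrow> 'a" where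
  "char_poly_fun R K T \<gamma> = det (slice_comb R K T \<gamma>)"

text \<open>Polynomial functions in K variables (K is infinite, so polynomial functions and
  polynomials in K[gamma_1,...,gamma_K] correspond bijectively).\<close>

definition mpoly_fun :: "nat \<Rightarrow> ('a::comm_ring_1 vec \<Rightarrow> 'a) \<Rightarrow> bool" where
  "mpoly_fun K f \<longleftrightarrow> (\<exists>(S :: (nat \<Rightarrow> nat) set) c. finite S \<and>
     (\<forall>\<gamma> \<in> carrier_vec K. f \<gamma> = (\<Sum>\<alpha>\<in>S. c \<alpha> * (\<Prod>k<K. (\<gamma> $ k) ^ \<alpha> k))))"

definition lin_form :: "nat \<Rightarrow> 'a::comm_ring_1 vec \<Rightarrow> 'a vec \<Rightarrow> 'a" where
  "lin_form K lam \<gamma> = (\<Sum>k<K. lam $ k * \<gamma> $ k)"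

definition lin_pow_dvd_char :: "nat \<Rightarrow> nat \<Rightarrow> 'a::comm_ring_1 tensor3 \<Rightarrow> 'a vec \<Rightarrow> nat \<Rightarrow> bool" where
  "lin_pow_dvd_char R K T lam m \<longleftrightarrow> (\<exists>q. mpoly_fun K q \<and>
     (\<forall>\<gamma> \<in> carrier_vec K. char_poly_fun R K T \<gamma> = lin_form K lam \<gamma> ^ m * q \<gamma>))"

definition jge_am :: "nat \<Rightarrow> nat \<Rightarrow> 'a::field tensor3 \<Rightarrow> 'a vec set \<Rightarrow> nat" where
  "jge_am R K T L = (GREATEST m. \<exists>lam. lam \<in> carrier_vec K \<and> lam \<noteq> 0\<^sub>v K \<and>
      L = vspan K {lam} \<and> lin_pow_dvd_char R K T lam m)"

definition jge_gm :: "nat \<Rightarrow> nat \<Rightarrow> 'a::field tensor3 \<Rightarrow> 'a vec set \<Rightarrow> nat" where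
  "jge_gm R K T L = vdim R {x. jge_pair R K T L x}"

definition simple_tensor :: "nat \<Rightarrow> nat \<Rightarrow> 'a::field tensor3 \<Rightarrow> bool" where
  "simple_tensor R K T \<longleftrightarrow> slice_mix_invertible R K T \<and>
     (\<exists>l :: nat \<Rightarrow> 'a vec. (\<forall>r<R. l r \<in> carrier_vec K) \<and>
        (\<forall>r<R. \<forall>s<R. r \<noteq> s \<longrightarrow> \<not> (\<exists>c. l r = c \<cdot>\<^sub>v l s)) \<and>
        (\<forall>\<gamma> \<in> carrier_vec K. char_poly_fun R K T \<gamma> = (\<Prod>r<R. lin_form K (l r) \<gamma>)))"

end

theory Submission
  imports Defs "Jordan_Normal_Form.DL_Rank"
begin

text \<open>
  Write \<open>T = [A, B, C]\<close> with \<open>R\<close> terms. As the mode-1 and mode-2 fibers of \<open>T\<close> span, \<open>A\<close> and \<open>B\<close> are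
  invertible, and the slices \<open>A diag(C(k, :)) B\<^sup>T\<close> map the columns of \<open>B\<^sup>-\<^sup>T\<close> to multiples of
  the columns of \<open>A\<close>; conversely a basis of JGE vectors diagonalises all slices at once.

  If \<open>T\<close> is a limit of such tensors and a mix of its slices is invertible, then the JGE pairs of the
  approximants, normalised to length one, subconverge to \<open>R\<close> JGE pairs of \<open>T\<close> (the scalar field is
  locally compact), and the characteristic polynomial of \<open>T\<close> is a multiple of the product of the
  \<open>R\<close> limiting linear forms. Hence \<open>am(L)\<close> is at least the number of limiting values equal to \<open>L\<close>.
  JGE vectors of distinct values are independent, so if \<open>gm(L) \<ge> am(L)\<close> for all of these values, there
  are \<open>R\<close> independent JGE vectors and \<open>T\<close> has rank \<open>R\<close>. For a simple tensor \<open>am \<ge> 2\<close> is impossible.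
\<close>

section \<open>Spans, dimensions and inverses\<close>

text \<open>Two devices carry the argument. Rank statements about \<open>Tp\<close> move to
  \<open>T\<close> by mode products: \<open>V_i V_i^H\<close> fixes every mode-\<open>i\<close>
  fiber, so the \<open>V_i\<close> undo the compression. The spanning of the mode-1 and mode-2
  fibers survives in \<open>T\<close> as nondegeneracy of its contractions. In the limit argument
  the approximants may be degenerate. A point \<open>\<gamma>0\<close> with invertible slice mix
  \<open>N\<close> takes over: the characteristic polynomials of the approximants are eventually
  nonzero at \<open>\<gamma>0\<close>, which forces their first two factor matrices to be
  invertible. The same point controls the limit, because a nonzero limit of JGE vectors cannot lie
  in the kernel of \<open>N\<close>. It also removes the auxiliary vector \<open>y\<close> from the
  JGE condition: what remains is a generalised eigenvalue problem
  \<open>T_k x = \<mu>_k N x\<close>, to which the usual independence argument for eigenvectors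
  applies.\<close>

lemma vspan_cols_iff:
  fixes A :: "'a::field mat"
  assumes A: "A \<in> carrier_mat n m"
  shows "v \<in> vspan n (set (cols A)) \<longleftrightarrow> (\<exists>x\<in>carrier_vec m. v = A *\<^sub>v x)"
proof -
  interpret vec_space "TYPE('a)" n .
  show ?thesis
    using col_space_eq[OF A] A unfolding vspan_def col_space_def by auto
qed

lemma vspan_superset:
  fixes S :: "'a::field vec set"
  assumes "S \<subseteq> carrier_vec n"
  shows "S \<subseteq> vspan n S"
proof -
  interpret vec_space "TYPE('a)" n .
  show ?thesis unfolding vspan_def using in_own_span assms by auto
qed

lemma vspan_singleton:
  fixes v :: "'a::field vec"
  assumes v: "v \<in> carrier_vec n"
  shows "vspan n {v} = {c \<cdot>\<^sub>v v | c. True}"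
proof -
  let ?A = "mat_of_cols n [v]"
  have A: "?A \<in> carrier_mat n 1" by (simp add: mat_of_cols_def)
  have c: "set (cols ?A) = {v}" using v by (simp add: cols_mat_of_cols)
  have eq: "?A *\<^sub>v x = (x $ 0) \<cdot>\<^sub>v v" if "x \<in> carrier_vec 1" for x
    using that v by (intro eq_vecI) (auto simp: scalar_prod_def mat_of_cols_def)
  have "u \<in> vspan n {v} \<longleftrightarrow> (\<exists>c. u = c \<cdot>\<^sub>v v)" for u
  proof -
    have "u \<in> vspan n {v} \<longleftrightarrow> (\<exists>x\<in>carrier_vec 1. u = (x $ 0) \<cdot>\<^sub>v v)"
      using vspan_cols_iff[OF A, of u] eq unfolding c by auto
    also have "\<dots> \<longleftrightarrow> (\<exists>c. u = c \<cdot>\<^sub>v v)"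
    proof
      assume "\<exists>c. u = c \<cdot>\<^sub>v v"
      then obtain c where "u = c \<cdot>\<^sub>v v" by auto
      then show "\<exists>x\<in>carrier_vec 1. u = (x $ 0) \<cdot>\<^sub>v v"
        by (intro bexI[of _ "vec 1 (\<lambda>_. c)"]) auto
    qed auto
    finally show ?thesis .
  qed
  then show ?thesis by auto
qed

text \<open>A functional is given by its coefficients \<open>w\<close>. In this form orthogonality
  to the fibers is later carried over to the columns of an orthonormal basis matrix.\<close>

lemma vspan_annihilated:
  fixes S :: "'a::field vec set"
  assumes S: "S \<subseteq> carrier_vec n" and v: "v \<in> vspan n S"
    and w: "\<And>s. s \<in> S \<Longrightarrow> (\<Sum>i<n. s $ i * w i) = 0"
  shows "(\<Sum>i<n. v $ i * w i) = 0"
proof -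
  interpret vec_space "TYPE('a)" n .
  from v obtain a A where va: "v = lincomb a A" and fA: "finite A" and AS: "A \<subseteq> S"
    unfolding vspan_def using in_spanE by blast
  have "(\<Sum>i<n. v $ i * w i) = (\<Sum>i<n. \<Sum>x\<in>A. a x * (x $ i * w i))"
    unfolding va using AS S
    by (intro sum.cong refl) (simp add: lincomb_index sum_distrib_right mult.assoc)
  also have "\<dots> = (\<Sum>x\<in>A. a x * (\<Sum>i<n. x $ i * w i))"
    by (subst sum.swap) (simp add: sum_distrib_left)
  also have "\<dots> = 0" using w AS by (intro sum.neutral) auto
  finally show ?thesis .
qed

text \<open>A maximal independent subset of \<open>S\<close> is a basis of its span. It is taken
  inside \<open>S\<close> itself because the basis vectors will have to be JGE vectors, and
  independence is phrased in coordinates to leave the module structures behind.\<close>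

lemma vdim_basis_obtain:
  fixes S :: "'a::field vec set"
  assumes S: "S \<subseteq> carrier_vec n"
  obtains U where "U \<subseteq> S" "finite U" "card U = vdim n S" "vspan n U = vspan n S"
    "\<And>a. (\<And>i. i < n \<Longrightarrow> (\<Sum>b\<in>U. a b * b $ i) = 0) \<Longrightarrow> \<forall>b\<in>U. a b = 0"
proof -
  interpret vec_space "TYPE('a)" n .
  have "\<exists>U. finite U \<and> maximal U (\<lambda>A. A \<subseteq> S \<and> lin_indpt A)"
  proof (rule maximal_exists[of _ n "{}"])
    show "\<And>A. A \<subseteq> S \<and> lin_indpt A \<Longrightarrow> finite A \<and> card A \<le> n"
      using S li_le_dim dim_is_n fin_dim by (metis cV subset_trans)
    show "{} \<subseteq> S \<and> lin_indpt {}" by (simp add: lin_dep_def)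
  qed
  then obtain U where fU: "finite U" and U: "maximal U (\<lambda>A. A \<subseteq> S \<and> lin_indpt A)" by blast
  have US: "U \<subseteq> S" and li: "lin_indpt U" using U unfolding maximal_def by auto
  have UC: "U \<subseteq> carrier_vec n" using US S by auto
  have sub: "S \<subseteq> span U"
  proof
    fix s assume s: "s \<in> S"
    show "s \<in> span U"
    proof (rule ccontr)
      assume ns: "s \<notin> span U"
      then have sU: "s \<notin> U" using UC in_own_span by auto
      have "lin_indpt (U \<union> {s})"
        using lin_dep_iff_in_span[OF _ li _ sU] UC s S ns by auto
      then have "U \<union> {s} = U" using U US s unfolding maximal_def by auto
      then show False using sU by auto
    qed
  qed
  have sp: "span U = span S"
  proof
    show "span U \<subseteq> span S" using US by (rule span_is_monotone)
    show "span S \<subseteq> span U"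
      using sub UC span_is_subset span_is_submodule cV by metis
  qed
  have "maximal U (\<lambda>T. T \<subseteq> U \<and> lin_indpt T)" using li unfolding maximal_def by auto
  then have "vectorspace.dim class_ring (span_vs U) = card U"
    using dim_span[of U U] UC fU by auto
  then have card: "card U = vdim n S" unfolding vdim_def vspan_def sp[symmetric] by simp
  have ind: "\<forall>b\<in>U. a b = 0" if "\<And>i. i < n \<Longrightarrow> (\<Sum>b\<in>U. a b * b $ i) = 0" for a
  proof (rule ccontr)
    assume "\<not> (\<forall>b\<in>U. a b = 0)"
    then obtain b where b: "b \<in> U" "a b \<noteq> 0" by auto
    have "lincomb a U = 0\<^sub>v n"
      using that UC fU by (intro eq_vecI) (auto simp: lincomb_index lincomb_dim)
    then have "lin_dep U" unfolding lin_dep_def using fU b by auto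
    then show False using li by simp
  qed
  show thesis using that[OF US fU card _ ind] sp unfolding vspan_def by blast
qed

lemma vdim_independent_subset:
  fixes S :: "'a::field vec set"
  assumes S: "S \<subseteq> carrier_vec n" and m: "m \<le> vdim n S"
  obtains B where "B \<subseteq> S" "finite B" "card B = m"
    "\<And>a. (\<And>i. i < n \<Longrightarrow> (\<Sum>b\<in>B. a b * b $ i) = 0) \<Longrightarrow> \<forall>b\<in>B. a b = 0"
proof -
  obtain U where U: "U \<subseteq> S" "finite U" "card U = vdim n S"
    and ind: "\<And>a. (\<And>i. i < n \<Longrightarrow> (\<Sum>b\<in>U. a b * b $ i) = 0) \<Longrightarrow> \<forall>b\<in>U. a b = 0"
    using vdim_basis_obtain[OF S] by metis
  obtain B where B: "B \<subseteq> U" "card B = m" using m U by (metis obtain_subset_with_card_n)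
  have "\<forall>b\<in>B. a b = 0" if h: "\<And>i. i < n \<Longrightarrow> (\<Sum>b\<in>B. a b * b $ i) = 0" for a
  proof -
    have "(\<Sum>b\<in>U. (if b \<in> B then a b else 0) * b $ i) = 0" if "i < n" for i
    proof -
      have "(\<Sum>b\<in>U. (if b \<in> B then a b else 0) * b $ i) = (\<Sum>b\<in>B. a b * b $ i)"
        using B(1) U(2) by (intro sum.mono_neutral_cong_right) auto
      then show ?thesis using h that by simp
    qed
    from ind[OF this] B(1) show ?thesis by (metis subsetD)
  qed
  then show thesis using that B U finite_subset by (metis subset_trans)
qed

text \<open>The prescribed index set \<open>X\<close> will be the set of indices of those limiting
  linear forms that share one JGE value.\<close>

lemma vdim_independent_family:
  fixes S :: "'a::field vec set"
  assumes S: "S \<subseteq> carrier_vec n" and X: "finite X" "card X \<le> vdim n S"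
  shows "\<exists>h. (\<forall>r\<in>X. h r \<in> S) \<and>
    (\<forall>a. (\<forall>i<n. (\<Sum>r\<in>X. h r $ i * a r) = 0) \<longrightarrow> (\<forall>r\<in>X. a r = 0))"
proof -
  from vdim_independent_subset[OF S X(2)]
  obtain B where B: "B \<subseteq> S" "finite B" "card B = card X"
    and ind: "\<And>a. (\<And>i. i < n \<Longrightarrow> (\<Sum>b\<in>B. a b * b $ i) = 0) \<Longrightarrow> \<forall>b\<in>B. a b = 0"
    by blast
  obtain h where h: "bij_betw h X B"
    using B X by (metis finite_same_card_bij)
  have inv: "the_inv_into X h (h r) = r" if "r \<in> X" for r
    using h that by (auto simp: bij_betw_def the_inv_into_f_f)
  have "\<forall>r\<in>X. a r = 0" if z: "\<forall>i<n. (\<Sum>r\<in>X. h r $ i * a r) = 0" for a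
  proof -
    have "(\<Sum>b\<in>B. a (the_inv_into X h b) * b $ i) = 0" if "i < n" for i
      using z that unfolding sum.reindex_bij_betw[OF h, symmetric]
      by (simp add: inv mult.commute)
    then have "\<forall>b\<in>B. a (the_inv_into X h b) = 0" by (rule ind)
    then show ?thesis using h inv by (metis bij_betw_apply)
  qed
  moreover have "\<forall>r\<in>X. h r \<in> S" using h B(1) by (auto simp: bij_betw_def)
  ultimately show ?thesis by blast
qed

lemma vdim_pos:
  fixes S :: "'a::field vec set"
  assumes S: "S \<subseteq> carrier_vec n" and x: "x \<in> S" "x \<noteq> 0\<^sub>v n"
  shows "1 \<le> vdim n S"
proof (rule ccontr)
  interpret vec_space "TYPE('a)" n .
  assume "\<not> 1 \<le> vdim n S"
  then obtain U where "card U = 0" "finite U" "vspan n U = vspan n S"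
    using vdim_basis_obtain[OF S] by (metis less_one not_le)
  then have "vspan n S = {0\<^sub>v n}" using span_empty by (auto simp: vspan_def)
  then show False using vspan_superset[OF S] x by auto
qed

section \<open>Kernels and inverses of matrices given by index functions\<close>

lemma sum_as_mat_mult:
  fixes M :: "nat \<Rightarrow> nat \<Rightarrow> 'a::comm_ring_1"
  assumes "i < n" "v \<in> carrier_vec m"
  shows "(mat n m (\<lambda>(i, j). M i j) *\<^sub>v v) $ i = (\<Sum>j<m. M i j * v $ j)"
  using assms by (auto simp: scalar_prod_def lessThan_atLeast0 intro!: sum.cong)

lemma injective_matrix_det:
  fixes M :: "nat \<Rightarrow> nat \<Rightarrow> 'a::field"
  assumes inj: "\<And>v. (\<And>i. i < n \<Longrightarrow> (\<Sum>j<n. M i j * v j) = 0) \<Longrightarrow> \<forall>j<n. v j = 0"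
  shows "det (mat n n (\<lambda>(i, j). M i j)) \<noteq> 0"
proof
  assume "det (mat n n (\<lambda>(i, j). M i j)) = 0"
  then obtain v where v: "v \<in> carrier_vec n" "v \<noteq> 0\<^sub>v n"
    and z: "mat n n (\<lambda>(i, j). M i j) *\<^sub>v v = 0\<^sub>v n"
    using det_0_iff_vec_prod_zero_field[of "mat n n (\<lambda>(i, j). M i j)" n] by auto
  have "(\<Sum>j<n. M i j * v $ j) = 0" if "i < n" for i
    using sum_as_mat_mult[OF that v(1), of M] z that by simp
  then have "\<forall>j<n. v $ j = 0" by (rule inj)
  then have "v = 0\<^sub>v n" using v(1) by (intro eq_vecI) auto
  then show False using v by simp
qed

lemma det_nonzero_injective:
  fixes M :: "nat \<Rightarrow> nat \<Rightarrow> 'a::field"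
  assumes d: "det (mat n n (\<lambda>(i, j). M i j)) \<noteq> 0"
    and z: "\<And>i. i < n \<Longrightarrow> (\<Sum>j<n. M i j * v j) = 0" and j: "j < n"
  shows "v j = 0"
proof -
  have "mat n n (\<lambda>(i, j). M i j) *\<^sub>v vec n v = 0\<^sub>v n"
  proof (rule eq_vecI)
    fix i assume "i < dim_vec (0\<^sub>v n :: 'a vec)"
    then have i: "i < n" by simp
    show "(mat n n (\<lambda>(i, j). M i j) *\<^sub>v vec n v) $ i = 0\<^sub>v n $ i"
      using sum_as_mat_mult[OF i, of "vec n v" n M] z[OF i] i by simp
  qed auto
  then have "vec n v = 0\<^sub>v n"
    using d det_0_iff_vec_prod_zero_field[of "mat n n (\<lambda>(i, j). M i j)" n] by (metis mat_carrier vec_carrier)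
  then show ?thesis using j by (metis index_vec index_zero_vec(1))
qed

lemma det_nonzero_inverse:
  fixes M :: "nat \<Rightarrow> nat \<Rightarrow> 'a::field"
  assumes d: "det (mat n n (\<lambda>(i, j). M i j)) \<noteq> 0"
  shows "\<exists>N. \<forall>i<n. \<forall>j<n. (\<Sum>k<n. M i k * N k j) = (if i = j then 1 else 0) \<and>
    (\<Sum>k<n. N i k * M k j) = (if i = j then 1 else 0)"
proof -
  let ?M = "mat n n (\<lambda>(i, j). M i j)"
  have M: "?M \<in> carrier_mat n n" by simp
  obtain N where N: "N \<in> carrier_mat n n" and NM: "N * ?M = 1\<^sub>m n" and MN: "?M * N = 1\<^sub>m n"
    using det_non_zero_imp_unit[OF M d, of "()"] unfolding Units_def ring_mat_def by auto
  show ?thesis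
  proof (intro exI[of _ "\<lambda>i j. N $$ (i, j)"] allI impI conjI)
    fix i j assume ij: "i < n" "j < n"
    have "(?M * N) $$ (i, j) = (\<Sum>k<n. M i k * N $$ (k, j))"
      using ij N by (auto simp: scalar_prod_def lessThan_atLeast0 intro!: sum.cong)
    then show "(\<Sum>k<n. M i k * N $$ (k, j)) = (if i = j then 1 else 0)" using MN ij by simp
    have "(N * ?M) $$ (i, j) = (\<Sum>k<n. N $$ (i, k) * M k j)"
      using ij N by (auto simp: scalar_prod_def lessThan_atLeast0 intro!: sum.cong)
    then show "(\<Sum>k<n. N $$ (i, k) * M k j) = (if i = j then 1 else 0)" using NM ij by simp
  qed
qed

text \<open>Zero rows make the matrix square. Row \<open>r\<close> is then zero, so the entry
  \<open>(r, r)\<close> of a product with an inverse would be 0 instead of 1.\<close>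

lemma wide_matrix_kernel:
  fixes M :: "nat \<Rightarrow> nat \<Rightarrow> 'a::field"
  assumes "r < n"
  obtains v where "\<exists>j<n. v j \<noteq> 0" "\<And>i. i < r \<Longrightarrow> (\<Sum>j<n. M i j * v j) = 0"
proof -
  define M' where "M' i j = (if i < r then M i j else 0)" for i j
  have "\<exists>v. (\<forall>i<n. (\<Sum>j<n. M' i j * v j) = 0) \<and> \<not> (\<forall>j<n. v j = 0)"
  proof (rule ccontr)
    assume "\<not> ?thesis"
    then have "det (mat n n (\<lambda>(i, j). M' i j)) \<noteq> 0" by (intro injective_matrix_det) blast
    then obtain N where

      N: "\<forall>i<n. \<forall>j<n. (\<Sum>k<n. M' i k * N k j) = (if i = j then 1 else 0)"
      using det_nonzero_inverse[of n M'] by blast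
    from N[rule_format, of r r] assms show False by (simp add: M'_def)
  qed
  then obtain v where v: "\<forall>i<n. (\<Sum>j<n. M' i j * v j) = 0" "\<not> (\<forall>j<n. v j = 0)" by blast
  have "(\<Sum>j<n. M i j * v j) = 0" if "i < r" for i
    using v(1)[rule_format, of i] that assms by (simp add: M'_def)
  then show thesis using that v(2) by blast
qed

lemma vspan_full_if_independent:
  fixes z :: "nat \<Rightarrow> 'a::field vec"
  assumes S: "S \<subseteq> carrier_vec n" and z: "\<And>r. r < n \<Longrightarrow> z r \<in> S"
    and ind: "\<And>a. (\<And>i. i < n \<Longrightarrow> (\<Sum>r<n. z r $ i * a r) = 0) \<Longrightarrow> \<forall>r<n. a r = 0"
  shows "vspan n S = carrier_vec n"
proof
  interpret vec_space "TYPE('a)" n .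
  let ?Z = "mat n n (\<lambda>(i, r). z r $ i)"
  show "vspan n S \<subseteq> carrier_vec n" unfolding vspan_def using S span_closed by auto
  have cols: "set (cols ?Z) \<subseteq> S"
  proof
    fix c assume "c \<in> set (cols ?Z)"
    then obtain r where r: "r < n" "c = col ?Z r" by (auto simp: cols_def)
    then have "c = z r" using z[OF r(1)] S by (intro eq_vecI) auto
    then show "c \<in> S" using z r by simp
  qed
  have "det ?Z \<noteq> 0" by (intro injective_matrix_det ind)
  then obtain N where N:
    "\<forall>i<n. \<forall>j<n. (\<Sum>k<n. z k $ i * N k j) = (if i = j then 1 else 0)"
    using det_nonzero_inverse[of n "\<lambda>i r. z r $ i"] by blast
  show "carrier_vec n \<subseteq> vspan n S"
  proof
    fix v :: "'a vec" assume v: "v \<in> carrier_vec n"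
    let ?x = "vec n (\<lambda>k. \<Sum>j<n. N k j * v $ j)"
    have "v = ?Z *\<^sub>v ?x"
    proof (rule eq_vecI)
      fix i assume "i < dim_vec (?Z *\<^sub>v ?x)"
      then have i: "i < n" by simp
      have "(?Z *\<^sub>v ?x) $ i = (\<Sum>k<n. z k $ i * (\<Sum>j<n. N k j * v $ j))"
        using sum_as_mat_mult[OF i, of ?x n "\<lambda>i r. z r $ i"] by simp
      also have "\<dots> = (\<Sum>j<n. (\<Sum>k<n. z k $ i * N k j) * v $ j)"
        unfolding sum_distrib_left sum_distrib_right by (subst sum.swap) (simp add: mult.assoc)
      also have "\<dots> = (\<Sum>j<n. if i = j then v $ j else 0)"
        by (intro sum.cong) (auto simp: N i)
      also have "\<dots> = v $ i" using i by simp
      finally show "v $ i = (?Z *\<^sub>v ?x) $ i" by simp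
    qed (use v in auto)
    then have "v \<in> vspan n (set (cols ?Z))" using vspan_cols_iff[of ?Z n n v] by auto
    then show "v \<in> vspan n S" unfolding vspan_def using span_is_monotone[OF cols] by auto
  qed
qed

lemma vspan_full_obtain_independent:
  fixes S :: "'a::field vec set"
  assumes S: "S \<subseteq> carrier_vec n" and full: "vspan n S = carrier_vec n"
  obtains z where "\<And>r. r < n \<Longrightarrow> z r \<in> S"
    "\<And>a. (\<And>i. i < n \<Longrightarrow> (\<Sum>r<n. z r $ i * a r) = 0) \<Longrightarrow> \<forall>r<n. a r = 0"
proof -
  interpret vec_space "TYPE('a)" n .
  have "vdim n S = dim" unfolding vdim_def full by (simp add: cV[symmetric] del: cV)
  then have "card {..<n} \<le> vdim n S" using dim_is_n by simp
  from vdim_independent_family[OF S finite_lessThan this]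
  obtain z where z: "\<forall>r\<in>{..<n}. z r \<in> S"
    and ind: "\<forall>a. (\<forall>i<n. (\<Sum>r<n. z r $ i * a r) = 0) \<longrightarrow> (\<forall>r\<in>{..<n}. a r = 0)"
    by blast
  show thesis by (rule that[of z]) (use z ind in auto)
qed

section \<open>Compactness of the scalar field\<close>

text \<open>A fixed point satisfies \<open>x * x = (norm x) * (norm x)\<close>, so it is plus or
  minus its norm.\<close>

lemma conjugate_fixed_is_real:
  fixes x :: "'a::{conjugatable_field, real_normed_field}"
  assumes conj_std: "\<And>x::'a. conjugate x * x = of_real ((norm x)\<^sup>2)"
    and fixed: "conjugate x = x"
  shows "\<exists>a. x = of_real a"
proof -
  have "x * x = of_real (norm x) * of_real (norm x)"
    using conj_std[of x] fixed by (simp add: power2_eq_square)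
  then have "x = of_real (norm x) \<or> x = - of_real (norm x)" by (simp add: square_eq_iff)
  then show ?thesis by (metis of_real_minus)
qed

text \<open>The hypothesis forces the field to be a copy of the reals (with \<open>w = 0\<close>) or of the
  complex numbers (with \<open>w\<close> an imaginary unit); this is the source of compactness.\<close>

lemma real_or_complex_coordinates:
  assumes conj_std: "\<And>x::'a::{conjugatable_field, real_normed_field}.
    conjugate x * x = of_real ((norm x)\<^sup>2)"
  shows "\<exists>w::'a::{conjugatable_field, real_normed_field}.
    \<forall>x. \<exists>a b. x = of_real a + of_real b * w \<and> \<bar>a\<bar> \<le> norm x \<and> \<bar>b\<bar> \<le> 2 * norm x"
proof -
  note real = conjugate_fixed_is_real[OF conj_std]
  have norm_conj: "norm (conjugate x) = norm x" for x :: 'a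
  proof (cases "x = 0")
    case False
    have "norm (conjugate x) * norm x = norm x * norm x"
      using arg_cong[OF conj_std[of x], of norm] by (simp add: norm_mult power2_eq_square)
    then show ?thesis using False by simp
  qed simp
  have conj_real: "conjugate (of_real a) = (of_real a :: 'a)" for a
  proof (cases "a = 0")
    case False
    have "conjugate (of_real a) * of_real a = (of_real a * of_real a :: 'a)"
      using conj_std[of "of_real a"] by (simp add: power2_eq_square)
    then show ?thesis using False by simp
  qed simp
  \<comment> \<open>Half of \<open>x + conjugate x\<close> is the real part \<open>a\<close>; the
    remainder is skew under conjugation.\<close>
  have split: "\<exists>a y. x = of_real a + y \<and> conjugate y = - y \<and> \<bar>a\<bar> \<le> norm x" for x :: 'a
  proof -
    have "conjugate (x + conjugate x) = x + conjugate x"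
      by (simp add: conjugate_dist_add add.commute)
    from real[OF this] obtain t where t: "x + conjugate x = of_real t" by auto
    define a where "a = t / 2"
    have a: "x + conjugate x = 2 * of_real a" using t by (simp add: a_def)
    have "conjugate (x - of_real a) = conjugate x - of_real a"
      using conjugate_dist_add[of x "- of_real a"] by (simp add: conjugate_neg conj_real)
    also have "\<dots> = - (x - of_real a)" using a by (simp add: algebra_simps)
    finally have y: "conjugate (x - of_real a) = - (x - of_real a)" .
    have "2 * \<bar>a\<bar> = norm (x + conjugate x)" unfolding a by (simp add: norm_mult)
    also have "\<dots> \<le> norm x + norm (conjugate x)" by (rule norm_triangle_ineq)
    finally have "\<bar>a\<bar> \<le> norm x" by (simp add: norm_conj)
    then show ?thesis using y by (intro exI[of _ a] exI[of _ "x - of_real a"]) auto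
  qed
  obtain w :: 'a where w: "\<And>y. conjugate y = - y \<Longrightarrow> \<exists>b. y = of_real b * w \<and> \<bar>b\<bar> = norm y"
  proof (cases "\<exists>u::'a. u \<noteq> 0 \<and> conjugate u = - u")
    case True
    then obtain u :: 'a where u: "u \<noteq> 0" "conjugate u = - u" by auto
    \<comment> \<open>The product of two skew elements is fixed by conjugation, hence real. So the
      skew elements form a real line spanned by any nonzero one of them; norm one makes the
      coordinate as large as the element.\<close>
    define w where "w = u / of_real (norm u)"
    have nw: "norm w = 1" using u by (simp add: w_def norm_divide)
    have uu: "u * u = - (of_real (norm u) * of_real (norm u))"
      using conj_std[of u] u by (simp add: power2_eq_square minus_equation_iff[of "u * u"])
    have "\<exists>b. y = of_real b * w \<and> \<bar>b\<bar> = norm y" if y: "conjugate y = - y" for y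
    proof -
      have "conjugate (y * u) = y * u" using y u by (simp add: conjugate_dist_mul)
      from real[OF this] obtain s where s: "y * u = of_real s" by auto
      define b where "b = - s / norm u"
      have "y * (u * u) = of_real s * u" using s by (simp add: mult.assoc[symmetric])
      then have "y * (of_real (norm u) * of_real (norm u)) = - (of_real s * u)"
        by (simp add: uu minus_equation_iff)
      then have "y = of_real b * w" using u by (simp add: b_def w_def field_simps)
      moreover from this have "\<bar>b\<bar> = norm y" using nw by (simp add: norm_mult)
      ultimately show ?thesis by blast
    qed
    then show thesis by (rule that)
  next
    case False
    then have "\<exists>b. y = of_real b * 0 \<and> \<bar>b\<bar> = norm y" if "conjugate y = - y" for y :: 'a
      using that by (intro exI[of _ 0]) auto
    then show thesis by (rule that)
  qed
  have "\<exists>a b. x = of_real a + of_real b * w \<and> \<bar>a\<bar> \<le> norm x \<and> \<bar>b\<bar> \<le> 2 * norm x" for x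
  proof -
    obtain a y where x: "x = of_real a + y" and y: "conjugate y = - y" and a: "\<bar>a\<bar> \<le> norm x"
      using split by blast
    obtain b where b: "y = of_real b * w" "\<bar>b\<bar> = norm y" using w[OF y] by blast
    have "norm y \<le> norm x + \<bar>a\<bar>" using norm_triangle_ineq4[of x "of_real a"] x by simp
    then show ?thesis using x a b by (intro exI[of _ a] exI[of _ b]) auto
  qed
  then show ?thesis by blast
qed

section \<open>Bolzano-Weierstrass for the scalar field\<close>

lemma real_bounded_convergent_subseq:
  fixes f :: "nat \<Rightarrow> real"
  assumes "\<And>n. \<bar>f n\<bar> \<le> M"
  shows "\<exists>s. strict_mono (s :: nat \<Rightarrow> nat) \<and> convergent (\<lambda>n. f (s n))"
proof -
  obtain s :: "nat \<Rightarrow> nat" where s: "strict_mono s" "monoseq (\<lambda>n. f (s n))"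
    using seq_monosub by blast
  have "Bseq (\<lambda>n. f (s n))" using assms by (intro BseqI'[of _ M]) simp
  then show ?thesis using s Bseq_monoseq_convergent by blast
qed

lemma convergent_strict_mono_subseq:
  assumes "convergent (X :: nat \<Rightarrow> 'a::real_normed_vector)" "strict_mono (s :: nat \<Rightarrow> nat)"
  shows "convergent (\<lambda>n. X (s n))"
  using convergent_subseq_convergent[OF assms] by (simp add: o_def)

lemma bounded_convergent_subseq:
  fixes f :: "nat \<Rightarrow> 'a::{conjugatable_field, real_normed_field}"
  assumes conj_std: "\<And>x::'a. conjugate x * x = of_real ((norm x)\<^sup>2)"
    and bnd: "\<And>n. norm (f n) \<le> M"
  shows "\<exists>s. strict_mono (s :: nat \<Rightarrow> nat) \<and> convergent (\<lambda>n. f (s n))"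
proof -
  obtain w :: 'a where
    "\<And>x. \<exists>a b. x = of_real a + of_real b * w \<and> \<bar>a\<bar> \<le> norm x \<and> \<bar>b\<bar> \<le> 2 * norm x"
    using real_or_complex_coordinates[OF conj_std] by blast
  then have "\<forall>n. \<exists>a b. f n = of_real a + of_real b * w \<and> \<bar>a\<bar> \<le> norm (f n) \<and> \<bar>b\<bar> \<le> 2 * norm (f n)"
    by blast
  then obtain a b where
    ab: "\<And>n. f n = of_real (a n) + of_real (b n) * w \<and> \<bar>a n\<bar> \<le> norm (f n) \<and> \<bar>b n\<bar> \<le> 2 * norm (f n)"
    by metis
  have "\<bar>a n\<bar> \<le> M" for n using ab[of n] bnd[of n] by linarith
  from real_bounded_convergent_subseq[of a, OF this]
  obtain s :: "nat \<Rightarrow> nat" where s: "strict_mono s" "convergent (\<lambda>n. a (s n))" by blast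
  have "\<bar>b (s n)\<bar> \<le> 2 * M" for n using ab[of "s n"] bnd[of "s n"] by linarith
  from real_bounded_convergent_subseq[of "\<lambda>n. b (s n)", OF this]
  obtain t :: "nat \<Rightarrow> nat" where t: "strict_mono t" "convergent (\<lambda>n. b (s (t n)))" by blast
  have "convergent (\<lambda>n. a (s (t n)))" using convergent_strict_mono_subseq[OF s(2) t(1)] .
  then obtain A B where A: "(\<lambda>n. a (s (t n))) \<longlonglongrightarrow> A" and B: "(\<lambda>n. b (s (t n))) \<longlonglongrightarrow> B"
    using t(2) by (auto simp: convergent_def)
  have "(\<lambda>n. of_real (a (s (t n))) + of_real (b (s (t n))) * w) \<longlonglongrightarrow> of_real A + of_real B * w"
    using A B by (intro tendsto_intros)
  then have "convergent (\<lambda>n. f (s (t n)))" using ab by (auto simp: convergent_def)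
  moreover have "strict_mono (\<lambda>n. s (t n))" using s(1) t(1) by (simp add: strict_mono_def)
  ultimately show ?thesis by blast
qed

lemma finite_family_convergent_subseq:
  fixes f :: "'i \<Rightarrow> nat \<Rightarrow> 'a::{conjugatable_field, real_normed_field}"
  assumes conj_std: "\<And>x::'a. conjugate x * x = of_real ((norm x)\<^sup>2)"
    and "finite I" and bnd: "\<And>i n. i \<in> I \<Longrightarrow> norm (f i n) \<le> M"
  shows "\<exists>s. strict_mono (s :: nat \<Rightarrow> nat) \<and> (\<forall>i\<in>I. convergent (\<lambda>n. f i (s n)))"
  using \<open>finite I\<close> bnd
proof (induction I)
  case empty
  show ?case by (intro exI[of _ id]) (auto simp: strict_mono_def)
next
  case (insert i I)
  then obtain s :: "nat \<Rightarrow> nat" where s: "strict_mono s" "\<forall>i\<in>I. convergent (\<lambda>n. f i (s n))" by auto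
  have "norm (f i (s n)) \<le> M" for n using insert.prems by simp
  from bounded_convergent_subseq[OF conj_std, of "\<lambda>n. f i (s n)", OF this]
  obtain t :: "nat \<Rightarrow> nat" where t: "strict_mono t" "convergent (\<lambda>n. f i (s (t n)))" by blast
  have "\<forall>j\<in>I. convergent (\<lambda>n. f j (s (t n)))" using s t convergent_strict_mono_subseq by blast
  moreover have "strict_mono (\<lambda>n. s (t n))" using s(1) t(1) by (simp add: strict_mono_def)
  ultimately show ?case using t by (intro exI[of _ "\<lambda>n. s (t n)"]) auto
qed

section \<open>Tensor rank and compression\<close>

text \<open>Unlike \<^const>\<open>is_decomp\<close>, zero factors are allowed here, so that sums of rank one terms can
  be padded and transported along mode products.\<close>

definition has_cpd :: "nat \<Rightarrow> nat \<Rightarrow> nat \<Rightarrow> 'a::comm_ring_1 tensor3 \<Rightarrow> nat \<Rightarrow> bool" where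
  "has_cpd I1 I2 I3 T r \<longleftrightarrow> (\<exists>A B C :: nat \<Rightarrow> nat \<Rightarrow> 'a. \<forall>i<I1. \<forall>j<I2. \<forall>k<I3.
     T i j k = (\<Sum>s<r. A i s * B j s * C k s))"

lemma has_cpd_finite_index:
  assumes "finite X" and T: "\<And>i j k. i < I1 \<Longrightarrow> j < I2 \<Longrightarrow> k < I3 \<Longrightarrow>
    T i j k = (\<Sum>x\<in>X. A i x * B j x * C k x)"
  shows "has_cpd I1 I2 I3 T (card X)"
proof -
  obtain h where h: "bij_betw h {..<card X} X"
    using assms(1) by (metis card_lessThan finite_lessThan finite_same_card_bij)
  have "T i j k = (\<Sum>s<card X. A i (h s) * B j (h s) * C k (h s))"
    if "i < I1" "j < I2" "k < I3" for i j k
    using T[OF that] sum.reindex_bij_betw[OF h, of "\<lambda>x. A i x * B j x * C k x"] by simp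
  then show ?thesis unfolding has_cpd_def
    by (intro exI[of _ "\<lambda>i s. A i (h s)"] exI[of _ "\<lambda>i s. B i (h s)"] exI[of _ "\<lambda>i s. C i (h s)"]) simp
qed

lemma is_decomp_imp_has_cpd:
  assumes "is_decomp I1 I2 I3 T r A B C"
  shows "has_cpd I1 I2 I3 T r"
  unfolding has_cpd_def
  using assms by (intro exI[of _ "\<lambda>i s. A $$ (i, s)"] exI[of _ "\<lambda>i s. B $$ (i, s)"]
      exI[of _ "\<lambda>i s. C $$ (i, s)"]) (auto simp: is_decomp_def cpd_def)

lemma has_cpd_imp_is_decomp:
  fixes T :: "'a::comm_ring_1 tensor3"
  assumes T: "tensor3_in I1 I2 I3 T" and "has_cpd I1 I2 I3 T r"
  shows "\<exists>r'\<le>r. \<exists>A B C. is_decomp I1 I2 I3 T r' A B C"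
proof -
  obtain A B C :: "nat \<Rightarrow> nat \<Rightarrow> 'a" where cpd: "\<And>i j k. i < I1 \<Longrightarrow> j < I2 \<Longrightarrow> k < I3 \<Longrightarrow>
     T i j k = (\<Sum>s<r. A i s * B j s * C k s)"
    using assms(2) unfolding has_cpd_def by blast
  \<comment> \<open>Only terms with three nonzero factors are rank one tensors. The others
    contribute zero and are dropped, which is why the length may shrink.\<close>
  define G where "G = {s. s < r \<and> (\<exists>i<I1. A i s \<noteq> 0) \<and> (\<exists>j<I2. B j s \<noteq> 0) \<and> (\<exists>k<I3. C k s \<noteq> 0)}"
  have fG: "finite G" and Gr: "card G \<le> r"
    using card_mono[of "{..<r}" G] by (auto simp: G_def)
  obtain h where h: "bij_betw h {..<card G} G"
    using fG by (metis card_lessThan finite_lessThan finite_same_card_bij)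
  let ?M = "\<lambda>n F. mat n (card G) (\<lambda>(i, s). F i (h s))"
  have nz: "col (?M n F) s \<noteq> 0\<^sub>v n" if "s < card G" "\<exists>i<n. F i (h s) \<noteq> 0" for n s
    and F :: "nat \<Rightarrow> nat \<Rightarrow> 'a"
  proof
    assume "col (?M n F) s = 0\<^sub>v n"
    then have "\<forall>i<n. F i (h s) = 0"
      using that(1) by (metis (no_types, lifting) case_prod_conv dim_col_mat(1) dim_row_mat(1)
          index_col index_mat(1) index_zero_vec(1))
    then show False using that(2) by blast
  qed
  have hG: "h s \<in> G" if "s < card G" for s using h that by (auto simp: bij_betw_def)
  have "T = cpd I1 I2 I3 (card G) (?M I1 A) (?M I2 B) (?M I3 C)"
  proof (intro ext)
    fix i j k
    show "T i j k = cpd I1 I2 I3 (card G) (?M I1 A) (?M I2 B) (?M I3 C) i j k"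
    proof (cases "i < I1 \<and> j < I2 \<and> k < I3")
      case True
      have "T i j k = (\<Sum>s\<in>G. A i s * B j s * C k s)"
        unfolding cpd[OF True[THEN conjunct1] True[THEN conjunct2, THEN conjunct1]
            True[THEN conjunct2, THEN conjunct2]]
        using True by (intro sum.mono_neutral_right) (auto simp: G_def)
      also have "\<dots> = (\<Sum>s<card G. A i (h s) * B j (h s) * C k (h s))"
        using sum.reindex_bij_betw[OF h, of "\<lambda>x. A i x * B j x * C k x"] by simp
      finally show ?thesis using True by (simp add: cpd_def)
    qed (use T in \<open>auto simp: tensor3_in_def cpd_def\<close>)
  qed
  then have "is_decomp I1 I2 I3 T (card G) (?M I1 A) (?M I2 B) (?M I3 C)"
    unfolding is_decomp_def using nz hG by (auto simp: G_def)
  then show ?thesis using Gr by blast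
qed

text \<open>One term per mode-3 fiber: \<open>e_i\<close>, \<open>e_j\<close> and the fiber
  \<open>T(i, j, :)\<close>. This guarantees that the \<open>LEAST\<close> in
  \<open>tensor_rank\<close> is attained.\<close>

lemma has_cpd_exists:
  fixes T :: "'a::comm_ring_1 tensor3"
  shows "\<exists>r. has_cpd I1 I2 I3 T r"
proof
  let ?X = "{..<I1} \<times> {..<I2}"
  show "has_cpd I1 I2 I3 T (card ?X)"
  proof (rule has_cpd_finite_index[where A = "\<lambda>i x. if i = fst x then 1 else 0"
        and B = "\<lambda>j x. if j = snd x then 1 else 0" and C = "\<lambda>k x. T (fst x) (snd x) k"])
    fix i j k assume ij: "i < I1" "j < I2"
    have "(\<Sum>x\<in>?X. (if i = fst x then 1 else 0) * (if j = snd x then 1 else 0) * T (fst x) (snd x) k)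
        = (\<Sum>x\<in>{(i, j)}. (if i = fst x then 1 else 0) * (if j = snd x then 1 else 0) * T (fst x) (snd x) k)"
      using ij by (intro sum.mono_neutral_right) auto
    then show "T i j k = (\<Sum>x\<in>?X. (if i = fst x then 1 else 0) * (if j = snd x then 1 else 0)
        * T (fst x) (snd x) k)" by simp
  qed simp
qed

lemma has_cpd_mono:
  assumes "has_cpd I1 I2 I3 T r" "r \<le> r'"
  shows "has_cpd I1 I2 I3 T r'"
proof -
  obtain A B C where cpd: "\<forall>i<I1. \<forall>j<I2. \<forall>k<I3. T i j k = (\<Sum>s<r. A i s * B j s * C k s)"
    using assms(1) unfolding has_cpd_def by blast
  have "has_cpd I1 I2 I3 T (card {..<r'})"
  proof (rule has_cpd_finite_index[where A = "\<lambda>i s. if s < r then A i s else 0" and B = B and C = C])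
    fix i j k assume "i < I1" "j < I2" "k < I3"
    then have "T i j k = (\<Sum>s<r. A i s * B j s * C k s)" using cpd by blast
    also have "\<dots> = (\<Sum>s<r'. (if s < r then A i s else 0) * B j s * C k s)"
      using assms(2) by (intro sum.mono_neutral_cong_left) auto
    finally show "T i j k = (\<Sum>s<r'. (if s < r then A i s else 0) * B j s * C k s)" .
  qed simp
  then show ?thesis by simp
qed

lemma tensor_rank_decomp:
  fixes T :: "'a::comm_ring_1 tensor3"
  assumes "tensor3_in I1 I2 I3 T"
  shows "\<exists>A B C. is_decomp I1 I2 I3 T (tensor_rank I1 I2 I3 T) A B C"
proof -
  have "\<exists>r. \<exists>A B C. is_decomp I1 I2 I3 T r A B C"
    using has_cpd_exists[of I1 I2 I3 T] has_cpd_imp_is_decomp[OF assms] by blast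
  then show ?thesis unfolding tensor_rank_def by (rule LeastI_ex)
qed

text \<open>All later statements about the tensor rank go through this equivalence instead of its
  \<open>LEAST\<close>.\<close>

lemma tensor_rank_le_iff:
  fixes T :: "'a::comm_ring_1 tensor3"
  assumes "tensor3_in I1 I2 I3 T"
  shows "tensor_rank I1 I2 I3 T \<le> r \<longleftrightarrow> has_cpd I1 I2 I3 T r"
proof
  assume "tensor_rank I1 I2 I3 T \<le> r"
  then show "has_cpd I1 I2 I3 T r"
    using tensor_rank_decomp[OF assms] is_decomp_imp_has_cpd has_cpd_mono by blast
next
  assume "has_cpd I1 I2 I3 T r"
  then obtain r' where r': "r' \<le> r" "\<exists>A B C. is_decomp I1 I2 I3 T r' A B C"
    using has_cpd_imp_is_decomp[OF assms] by blast
  then have "tensor_rank I1 I2 I3 T \<le> r'" unfolding tensor_rank_def by (intro Least_le)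
  then show "tensor_rank I1 I2 I3 T \<le> r" using r' by simp
qed

section \<open>Mode products and their effect on decompositions\<close>

definition mode_products :: "nat \<Rightarrow> nat \<Rightarrow> nat \<Rightarrow> (nat \<Rightarrow> nat \<Rightarrow> 'a) \<Rightarrow> (nat \<Rightarrow> nat \<Rightarrow> 'a)
    \<Rightarrow> (nat \<Rightarrow> nat \<Rightarrow> 'a) \<Rightarrow> 'a::comm_ring_1 tensor3 \<Rightarrow> 'a tensor3" where
  "mode_products I1 I2 I3 U V W S a b c =
     (\<Sum>i<I1. \<Sum>j<I2. \<Sum>k<I3. U a i * V b j * W c k * S i j k)"

lemma triple_sum_rank_one:
  fixes f g h :: "nat \<Rightarrow> 'a::comm_ring_1"
  shows "(\<Sum>i<I1. \<Sum>j<I2. \<Sum>k<I3. f i * g j * h k) = (\<Sum>i<I1. f i) * (\<Sum>j<I2. g j) * (\<Sum>k<I3. h k)"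
  by (simp add: sum_distrib_left[symmetric] sum_distrib_right[symmetric])

lemma has_cpd_mode_products:
  fixes S :: "'a::comm_ring_1 tensor3"
  assumes "has_cpd I1 I2 I3 S r"
  shows "has_cpd J1 J2 J3 (mode_products I1 I2 I3 U V W S) r"
proof -
  obtain A B C :: "nat \<Rightarrow> nat \<Rightarrow> 'a" where
    cpd: "\<forall>i<I1. \<forall>j<I2. \<forall>k<I3. S i j k = (\<Sum>s<r. A i s * B j s * C k s)"
    using assms unfolding has_cpd_def by blast
  let ?m = "\<lambda>n M F a s. \<Sum>i<n. M a i * F i s :: 'a"
  have "has_cpd J1 J2 J3 (mode_products I1 I2 I3 U V W S) (card {..<r})"
  proof (rule has_cpd_finite_index[where A = "?m I1 U A" and B = "?m I2 V B" and C = "?m I3 W C"])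
    fix a b c
    have "mode_products I1 I2 I3 U V W S a b c
      = (\<Sum>i<I1. \<Sum>j<I2. \<Sum>k<I3. \<Sum>s<r. (U a i * A i s) * (V b j * B j s) * (W c k * C k s))"
      unfolding mode_products_def using cpd
      by (intro sum.cong refl) (simp add: sum_distrib_left mult_ac)
    also have "\<dots> = (\<Sum>s<r. \<Sum>i<I1. \<Sum>j<I2. \<Sum>k<I3. (U a i * A i s) * (V b j * B j s) * (W c k * C k s))"
      by (simp only: sum.swap[of _ "{..<r}" "{..<I1}"] sum.swap[of _ "{..<r}" "{..<I2}"]
          sum.swap[of _ "{..<r}" "{..<I3}"])
    also have "\<dots> = (\<Sum>s<r. ?m I1 U A a s * ?m I2 V B b s * ?m I3 W C c s)"
      by (simp add: triple_sum_rank_one)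
    finally show "mode_products I1 I2 I3 U V W S a b c
      = (\<Sum>s<r. ?m I1 U A a s * ?m I2 V B b s * ?m I3 W C c s)" .
  qed simp
  then show ?thesis by simp
qed

lemma has_cpd_cong:
  assumes "\<And>i j k. i < I1 \<Longrightarrow> j < I2 \<Longrightarrow> k < I3 \<Longrightarrow> T i j k = S i j k"
  shows "has_cpd I1 I2 I3 T r \<longleftrightarrow> has_cpd I1 I2 I3 S r"
  unfolding has_cpd_def using assms by simp

lemma mode_products_iterated:
  fixes S :: "'a::comm_ring_1 tensor3"
  shows "mode_products I1 I2 I3 U V W S a b c =
    (\<Sum>i<I1. U a i * (\<Sum>j<I2. V b j * (\<Sum>k<I3. W c k * S i j k)))"
  unfolding mode_products_def by (simp add: sum_distrib_left mult_ac)

lemma mode_products_comp: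
  fixes S :: "'a::comm_ring_1 tensor3"
  shows "mode_products J1 J2 J3 U' V' W' (mode_products I1 I2 I3 U V W S) a b c =
    mode_products I1 I2 I3 (\<lambda>a i. \<Sum>p<J1. U' a p * U p i) (\<lambda>b j. \<Sum>q<J2. V' b q * V q j)
      (\<lambda>c k. \<Sum>r<J3. W' c r * W r k) S a b c"
proof -
  have "mode_products J1 J2 J3 U' V' W' (mode_products I1 I2 I3 U V W S) a b c =
     (\<Sum>p<J1. \<Sum>q<J2. \<Sum>r<J3. \<Sum>i<I1. \<Sum>j<I2. \<Sum>k<I3.
        ((U' a p * U p i) * (V' b q * V q j) * (W' c r * W r k)) * S i j k)"
    unfolding mode_products_def by (simp add: sum_distrib_left mult_ac)
  also have "\<dots> = (\<Sum>i<I1. \<Sum>j<I2. \<Sum>k<I3. \<Sum>p<J1. \<Sum>q<J2. \<Sum>r<J3.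
        ((U' a p * U p i) * (V' b q * V q j) * (W' c r * W r k)) * S i j k)"
    by (simp only: sum.swap[of _ "{..<I1}" "{..<J1}"] sum.swap[of _ "{..<I1}" "{..<J2}"]
        sum.swap[of _ "{..<I1}" "{..<J3}"] sum.swap[of _ "{..<I2}" "{..<J1}"]
        sum.swap[of _ "{..<I2}" "{..<J2}"] sum.swap[of _ "{..<I2}" "{..<J3}"]
        sum.swap[of _ "{..<I3}" "{..<J1}"] sum.swap[of _ "{..<I3}" "{..<J2}"]
        sum.swap[of _ "{..<I3}" "{..<J3}"])
  also have "\<dots> = mode_products I1 I2 I3 (\<lambda>a i. \<Sum>p<J1. U' a p * U p i)
      (\<lambda>b j. \<Sum>q<J2. V' b q * V q j) (\<lambda>c k. \<Sum>r<J3. W' c r * W r k) S a b c"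
    unfolding mode_products_def sum_distrib_right[symmetric] triple_sum_rank_one ..
  finally show ?thesis .
qed

lemma mode_products_cong:
  fixes S :: "'a::comm_ring_1 tensor3"
  assumes "\<And>i j k. i < I1 \<Longrightarrow> j < I2 \<Longrightarrow> k < I3 \<Longrightarrow> S i j k = S' i j k"
  shows "mode_products I1 I2 I3 U V W S a b c = mode_products I1 I2 I3 U V W S' a b c"
  unfolding mode_products_def using assms by (intro sum.cong refl) simp

lemma mode_products_zero:
  fixes S :: "'a::comm_ring_1 tensor3"
  assumes "\<And>i j k. i < I1 \<Longrightarrow> j < I2 \<Longrightarrow> k < I3 \<Longrightarrow> S i j k = 0"
  shows "mode_products I1 I2 I3 U V W S a b c = 0"
  unfolding mode_products_def using assms by simp

section \<open>Orthonormal bases of the fiber spans and the compression\<close>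

lemma orth_basis_mat_orthonormal:
  assumes "orth_basis_mat n r S V" "a < r" "b < r"
  shows "(\<Sum>i<n. V $$ (i, a) * conjugate (V $$ (i, b))) = (if a = b then 1 else 0)"
proof -
  have V: "V \<in> carrier_mat n r" and VV: "adj V * V = 1\<^sub>m r"
    using assms(1) by (auto simp: orth_basis_mat_def)
  have "(adj V * V) $$ (b, a) = (\<Sum>i<n. V $$ (i, a) * conjugate (V $$ (i, b)))"
    using V assms(2,3)
    by (auto simp: adj_def scalar_prod_def lessThan_atLeast0 mult.commute intro!: sum.cong)
  then show ?thesis using VV assms(2,3) by auto
qed

text \<open>\<open>V V^H\<close> is the orthogonal projector onto the span of \<open>S\<close>, so
  it fixes the elements of \<open>S\<close>.\<close>

lemma orth_basis_mat_projection:
  fixes V :: "'a::conjugatable_field mat"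
  assumes ob: "orth_basis_mat n r S V" and S: "S \<subseteq> carrier_vec n" and f: "f \<in> S" and i: "i < n"
  shows "(\<Sum>p<n. (\<Sum>a<r. V $$ (i, a) * conjugate (V $$ (p, a))) * f $ p) = f $ i"
proof -
  have V: "V \<in> carrier_mat n r" and sp: "vspan n (set (cols V)) = vspan n S"
    using ob by (auto simp: orth_basis_mat_def)
  have "f \<in> vspan n (set (cols V))" using vspan_superset[OF S] f sp by auto
  then obtain x where x: "x \<in> carrier_vec r" and fx: "f = V *\<^sub>v x"
    using vspan_cols_iff[OF V] by blast
  have fp: "f $ p = (\<Sum>b<r. V $$ (p, b) * x $ b)" if "p < n" for p
    using fx x V that by (auto simp: scalar_prod_def lessThan_atLeast0 intro!: sum.cong)
  have "(\<Sum>p<n. (\<Sum>a<r. V $$ (i, a) * conjugate (V $$ (p, a))) * f $ p)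
      = (\<Sum>p<n. \<Sum>a<r. \<Sum>b<r. V $$ (i, a) * x $ b * (V $$ (p, b) * conjugate (V $$ (p, a))))"
    by (intro sum.cong refl, simp add: fp sum_product) (simp only: mult_ac)
  also have "\<dots> = (\<Sum>a<r. \<Sum>b<r. V $$ (i, a) * x $ b * (\<Sum>p<n. V $$ (p, b) * conjugate (V $$ (p, a))))"
    by (simp only: sum.swap[of _ "{..<r}" "{..<n}"] sum_distrib_left)
  also have "\<dots> = (\<Sum>a<r. \<Sum>b<r. if b = a then V $$ (i, a) * x $ b else 0)"
    by (intro sum.cong refl) (simp add: orth_basis_mat_orthonormal[OF ob])
  also have "\<dots> = f $ i" using fp[OF i] by simp
  finally show ?thesis .
qed

text \<open>The functional with coefficient row \<open>x^T V^H\<close> vanishes on \<open>S\<close>,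
  hence on the span of \<open>S\<close>, hence on the columns of \<open>V\<close>. By orthonormality
  its value at column \<open>a\<close> is \<open>x a\<close>.\<close>

lemma orth_basis_mat_annihilated:
  fixes V :: "'a::conjugatable_field mat"
  assumes ob: "orth_basis_mat n r S V" and S: "S \<subseteq> carrier_vec n"
    and w: "\<And>s. s \<in> S \<Longrightarrow> (\<Sum>i<n. s $ i * (\<Sum>b<r. x b * conjugate (V $$ (i, b)))) = 0"
    and a: "a < r"
  shows "x a = 0"
proof -
  have V: "V \<in> carrier_mat n r" and sp: "vspan n (set (cols V)) = vspan n S"
    using ob by (auto simp: orth_basis_mat_def)
  have cV: "set (cols V) \<subseteq> carrier_vec n" using V cols_dim by blast
  have "col V a \<in> set (cols V)" using V a by (auto simp: cols_def)
  then have "col V a \<in> vspan n S" using vspan_superset[OF cV] sp by auto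
  from vspan_annihilated[OF S this w]
  have "0 = (\<Sum>i<n. col V a $ i * (\<Sum>b<r. x b * conjugate (V $$ (i, b))))" by simp
  also have "\<dots> = (\<Sum>i<n. \<Sum>b<r. x b * (V $$ (i, a) * conjugate (V $$ (i, b))))"
    using V a by (intro sum.cong refl) (simp add: sum_distrib_left mult_ac)
  also have "\<dots> = (\<Sum>b<r. x b * (\<Sum>i<n. V $$ (i, a) * conjugate (V $$ (i, b))))"
    by (subst sum.swap) (simp add: sum_distrib_left)
  also have "\<dots> = (\<Sum>b<r. if a = b then x b else 0)"
    using a by (intro sum.cong refl) (simp add: orth_basis_mat_orthonormal[OF ob])
  also have "\<dots> = x a" using a by simp
  finally show ?thesis by simp
qed

locale tensor_compression =
  fixes I1 I2 I3 R1 R2 R3 :: nat and Tp T :: "'a::conjugatable_field tensor3"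
    and V1 V2 V3 :: "'a mat"
  assumes ob1: "orth_basis_mat I1 R1 (fibers1 I1 I2 I3 Tp) V1"
    and ob2: "orth_basis_mat I2 R2 (fibers2 I1 I2 I3 Tp) V2"
    and ob3: "orth_basis_mat I3 R3 (fibers3 I1 I2 I3 Tp) V3"
    and T_eq: "T = compress I1 I2 I3 R1 R2 R3 Tp V1 V2 V3"
begin

abbreviation "cnj1 \<equiv> \<lambda>a i. conjugate (V1 $$ (i, a))"
abbreviation "cnj2 \<equiv> \<lambda>a i. conjugate (V2 $$ (i, a))"
abbreviation "cnj3 \<equiv> \<lambda>a i. conjugate (V3 $$ (i, a))"

lemma fibers_carrier:
  "fibers1 I1 I2 I3 Tp \<subseteq> carrier_vec I1" "fibers2 I1 I2 I3 Tp \<subseteq> carrier_vec I2"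
  "fibers3 I1 I2 I3 Tp \<subseteq> carrier_vec I3"
  by (auto simp: fibers1_def fibers2_def fibers3_def)

lemma T_mode_products:
  assumes "a < R1" "b < R2" "c < R3"
  shows "T a b c = mode_products I1 I2 I3 cnj1 cnj2 cnj3 Tp a b c"
  using assms by (simp add: T_eq compress_def mode_products_def)

lemma projection1:
  assumes "i < I1" "j < I2" "k < I3"
  shows "(\<Sum>p<I1. (\<Sum>a<R1. V1 $$ (i, a) * cnj1 a p) * Tp p j k) = Tp i j k"
proof -
  have "vec I1 (\<lambda>i. Tp i j k) \<in> fibers1 I1 I2 I3 Tp" using assms by (auto simp: fibers1_def)
  from orth_basis_mat_projection[OF ob1 fibers_carrier(1) this assms(1)]
  show ?thesis using assms by simp
qed

lemma projection2:
  assumes "i < I1" "j < I2" "k < I3"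
  shows "(\<Sum>q<I2. (\<Sum>b<R2. V2 $$ (j, b) * cnj2 b q) * Tp i q k) = Tp i j k"
proof -
  have "vec I2 (\<lambda>j. Tp i j k) \<in> fibers2 I1 I2 I3 Tp" using assms by (auto simp: fibers2_def)
  from orth_basis_mat_projection[OF ob2 fibers_carrier(2) this assms(2)]
  show ?thesis using assms by simp
qed

lemma projection3:
  assumes "i < I1" "j < I2" "k < I3"
  shows "(\<Sum>r<I3. (\<Sum>c<R3. V3 $$ (k, c) * cnj3 c r) * Tp i j r) = Tp i j k"
proof -
  have "vec I3 (\<lambda>k. Tp i j k) \<in> fibers3 I1 I2 I3 Tp" using assms by (auto simp: fibers3_def)
  from orth_basis_mat_projection[OF ob3 fibers_carrier(3) this assms(3)]
  show ?thesis using assms by simp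
qed

text \<open>Expanding after compressing applies the projector \<open>V_i V_i^H\<close> in each mode,
  and each of the three projectors fixes \<open>Tp\<close>.\<close>

lemma Tp_mode_products:
  assumes ijk: "i < I1" "j < I2" "k < I3"
  shows "Tp i j k = mode_products R1 R2 R3 (\<lambda>i a. V1 $$ (i, a)) (\<lambda>j b. V2 $$ (j, b))
    (\<lambda>k c. V3 $$ (k, c)) T i j k"
proof -
  have "mode_products R1 R2 R3 (\<lambda>i a. V1 $$ (i, a)) (\<lambda>j b. V2 $$ (j, b)) (\<lambda>k c. V3 $$ (k, c)) T i j k
    = mode_products R1 R2 R3 (\<lambda>i a. V1 $$ (i, a)) (\<lambda>j b. V2 $$ (j, b)) (\<lambda>k c. V3 $$ (k, c))
       (mode_products I1 I2 I3 cnj1 cnj2 cnj3 Tp) i j k"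
    by (rule mode_products_cong) (simp add: T_mode_products)
  also have "\<dots> = Tp i j k"
    unfolding mode_products_comp unfolding mode_products_iterated
    by (simp add: projection1 projection2 projection3 ijk)
  finally show ?thesis by simp
qed

text \<open>Each of the two tensors is a mode product of the other, and mode products do not
  lengthen decompositions.\<close>

lemma has_cpd_compression: "has_cpd I1 I2 I3 Tp r \<longleftrightarrow> has_cpd R1 R2 R3 T r"
proof
  assume "has_cpd I1 I2 I3 Tp r"
  from has_cpd_mode_products[OF this] show "has_cpd R1 R2 R3 T r"
    by (subst has_cpd_cong[OF T_mode_products]) auto
next
  assume "has_cpd R1 R2 R3 T r"
  from has_cpd_mode_products[OF this] show "has_cpd I1 I2 I3 Tp r"
    by (subst has_cpd_cong[OF Tp_mode_products]) auto
qed

text \<open>Contracting \<open>T\<close> with \<open>x\<close> in mode 2 amounts to contracting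
  \<open>Tp\<close> with the functional \<open>?w\<close> and compressing modes 1 and 3. These two
  compressions can be undone, so \<open>?w\<close> kills all mode-2 fibers of \<open>Tp\<close>.
  Since the fibers span the columns of \<open>V2\<close>, this forces \<open>x = 0\<close>.\<close>

lemma nondegenerate2:
  assumes x: "\<And>a c. a < R1 \<Longrightarrow> c < R3 \<Longrightarrow> (\<Sum>b<R2. T a b c * x b) = 0" and b: "b < R2"
  shows "x b = 0"
proof (rule orth_basis_mat_annihilated[OF ob2 fibers_carrier(2) _ b])
  let ?w = "\<lambda>j. \<Sum>b<R2. x b * conjugate (V2 $$ (j, b))"
  fix s assume "s \<in> fibers2 I1 I2 I3 Tp"
  then obtain i k where s: "s = vec I2 (\<lambda>j. Tp i j k)" and ik: "i < I1" "k < I3"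
    by (auto simp: fibers2_def)
  have z: "mode_products I1 I2 I3 cnj1 (\<lambda>_. ?w) cnj3 Tp a q c = 0" if "a < R1" "c < R3" for a q c
  proof -
    have "mode_products I1 I2 I3 cnj1 (\<lambda>_. ?w) cnj3 Tp a q c
      = (\<Sum>i<I1. \<Sum>j<I2. \<Sum>k<I3. \<Sum>b<R2. cnj1 a i * cnj2 b j * cnj3 c k * Tp i j k * x b)"
      unfolding mode_products_def
      by (intro sum.cong refl) (simp add: sum_distrib_left sum_distrib_right mult_ac)
    also have "\<dots> = (\<Sum>b<R2. \<Sum>i<I1. \<Sum>j<I2. \<Sum>k<I3. cnj1 a i * cnj2 b j * cnj3 c k * Tp i j k * x b)"
      by (simp only: sum.swap[of _ "{..<R2}" "{..<I1}"] sum.swap[of _ "{..<R2}" "{..<I2}"]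
          sum.swap[of _ "{..<R2}" "{..<I3}"])
    also have "\<dots> = (\<Sum>b<R2. T a b c * x b)"
      using that
      by (intro sum.cong refl) (simp add: T_mode_products mode_products_def sum_distrib_right)
    finally show ?thesis using x that by simp
  qed
  \<comment> \<open>Modes 1 and 3 are expanded back. Mode 2 has been contracted to a single entry,
    hence its size 1 and the trivial matrix.\<close>
  have "0 = mode_products R1 1 R3 (\<lambda>i a. V1 $$ (i, a)) (\<lambda>_ _. 1) (\<lambda>k c. V3 $$ (k, c))
    (mode_products I1 I2 I3 cnj1 (\<lambda>_. ?w) cnj3 Tp) i 0 k"
    by (rule mode_products_zero[symmetric]) (simp add: z)
  also have "\<dots> = (\<Sum>i'<I1. (\<Sum>a<R1. V1 $$ (i, a) * cnj1 a i') * (\<Sum>j<I2. ?w j * Tp i' j k))"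
    unfolding mode_products_comp unfolding mode_products_iterated by (simp add: projection3 ik)
  also have "\<dots> = (\<Sum>j<I2. \<Sum>i'<I1. ?w j * ((\<Sum>a<R1. V1 $$ (i, a) * cnj1 a i') * Tp i' j k))"
    unfolding sum_distrib_left[of _ _ "{..<I2}"] by (subst sum.swap) (simp only: mult_ac)
  also have "\<dots> = (\<Sum>j<I2. ?w j * Tp i j k)"
    unfolding sum_distrib_left[symmetric] by (simp add: projection1 ik)
  also have "\<dots> = (\<Sum>j<I2. s $ j * ?w j)" by (simp add: s mult.commute)
  finally show "(\<Sum>j<I2. s $ j * ?w j) = 0" by simp
qed

lemma nondegenerate1:
  assumes x: "\<And>b c. b < R2 \<Longrightarrow> c < R3 \<Longrightarrow> (\<Sum>a<R1. T a b c * x a) = 0" and a: "a < R1"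
  shows "x a = 0"
proof (rule orth_basis_mat_annihilated[OF ob1 fibers_carrier(1) _ a])
  let ?w = "\<lambda>i. \<Sum>a<R1. x a * conjugate (V1 $$ (i, a))"
  fix s assume "s \<in> fibers1 I1 I2 I3 Tp"
  then obtain j k where s: "s = vec I1 (\<lambda>i. Tp i j k)" and jk: "j < I2" "k < I3"
    by (auto simp: fibers1_def)
  have z: "mode_products I1 I2 I3 (\<lambda>_. ?w) cnj2 cnj3 Tp q b c = 0" if "b < R2" "c < R3" for b q c
  proof -
    have "mode_products I1 I2 I3 (\<lambda>_. ?w) cnj2 cnj3 Tp q b c
      = (\<Sum>i<I1. \<Sum>j<I2. \<Sum>k<I3. \<Sum>a<R1. cnj1 a i * cnj2 b j * cnj3 c k * Tp i j k * x a)"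
      unfolding mode_products_def
      by (intro sum.cong refl) (simp add: sum_distrib_left sum_distrib_right mult_ac)
    also have "\<dots> = (\<Sum>a<R1. \<Sum>i<I1. \<Sum>j<I2. \<Sum>k<I3. cnj1 a i * cnj2 b j * cnj3 c k * Tp i j k * x a)"
      by (simp only: sum.swap[of _ "{..<R1}" "{..<I1}"] sum.swap[of _ "{..<R1}" "{..<I2}"]
          sum.swap[of _ "{..<R1}" "{..<I3}"])
    also have "\<dots> = (\<Sum>a<R1. T a b c * x a)"
      using that
      by (intro sum.cong refl) (simp add: T_mode_products mode_products_def sum_distrib_right)
    finally show ?thesis using x that by simp
  qed
  have "0 = mode_products 1 R2 R3 (\<lambda>_ _. 1) (\<lambda>j b. V2 $$ (j, b)) (\<lambda>k c. V3 $$ (k, c))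
    (mode_products I1 I2 I3 (\<lambda>_. ?w) cnj2 cnj3 Tp) 0 j k"
    by (rule mode_products_zero[symmetric]) (simp add: z)
  also have "\<dots> = (\<Sum>i<I1. ?w i * Tp i j k)"
    unfolding mode_products_comp unfolding mode_products_iterated by (simp add: projection3 projection2 jk)
  also have "\<dots> = (\<Sum>i<I1. s $ i * ?w i)" by (simp add: s mult.commute)
  finally show "(\<Sum>i<I1. s $ i * ?w i) = 0" by simp
qed

end

section \<open>Joint generalized eigenvectors and decompositions\<close>

lemma det_nonzero_imp_invertible_mat:
  fixes A :: "'a::field mat"
  assumes A: "A \<in> carrier_mat n n" and d: "det A \<noteq> 0"
  shows "invertible_mat A"
proof -
  obtain B where "B \<in> carrier_mat n n" "B * A = 1\<^sub>m n" "A * B = 1\<^sub>m n"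
    using det_non_zero_imp_unit[OF A d, of "()"] unfolding Units_def ring_mat_def by auto
  then show ?thesis
    using A unfolding invertible_mat_def inverts_mat_def by (auto intro!: exI[of _ B])
qed

lemma invertible_mat_imp_det_nonzero:
  fixes A :: "'a::field mat"
  assumes A: "A \<in> carrier_mat n n" and inv: "invertible_mat A"
  shows "det A \<noteq> 0"
proof -
  obtain B where AB: "A * B = 1\<^sub>m n" and BA: "B * A = 1\<^sub>m (dim_row B)"
    using inv A by (auto simp: invertible_mat_def inverts_mat_def)
  have "dim_col B = n" using arg_cong[OF AB, of dim_col] by simp
  moreover have "dim_row B = n" using arg_cong[OF BA, of dim_col] A by simp
  ultimately have B: "B \<in> carrier_mat n n" by auto
  show ?thesis using det_mult[OF A B] AB by auto
qed

lemma vspan_smult: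
  fixes v :: "'a::field vec"
  assumes v: "v \<in> carrier_vec n" and c: "c \<noteq> 0"
  shows "vspan n {c \<cdot>\<^sub>v v} = vspan n {v}"
proof -
  have "\<exists>d. a \<cdot>\<^sub>v v = d \<cdot>\<^sub>v (c \<cdot>\<^sub>v v)" for a
    using c by (intro exI[of _ "a / c"]) (simp add: smult_smult_assoc)
  then show ?thesis using v by (auto simp: vspan_singleton smult_smult_assoc)
qed

lemma vec_eq_zero_iff: "v \<in> carrier_vec n \<Longrightarrow> v = 0\<^sub>v n \<longleftrightarrow> (\<forall>i<n. v $ i = 0)"
  by auto

lemma slice_mult_vec_iff:
  fixes T :: "'a::field tensor3"
  assumes "x \<in> carrier_vec R" "y \<in> carrier_vec R"
  shows "slice R T l *\<^sub>v x = c \<cdot>\<^sub>v y \<longleftrightarrow> (\<forall>i<R. (\<Sum>j<R. T i j l * x $ j) = c * y $ i)"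
proof -
  have "(slice R T l *\<^sub>v x) $ i = (\<Sum>j<R. T i j l * x $ j)" if "i < R" for i
    unfolding slice_def using sum_as_mat_mult[OF that assms(1), of "\<lambda>i j. T i j l"] .
  then show ?thesis using assms by (auto simp: vec_eq_iff slice_def)
qed

lemma jge_pairE:
  fixes T :: "'a::field tensor3"
  assumes "jge_pair R K T L x"
  obtains lam y where "x \<in> carrier_vec R" "\<exists>j<R. x $ j \<noteq> 0" "lam \<in> carrier_vec K"
    "\<exists>i<R. y i \<noteq> 0" "L = vspan K {lam}"
    "\<And>l i. l < K \<Longrightarrow> i < R \<Longrightarrow> (\<Sum>j<R. T i j l * x $ j) = lam $ l * y i"
proof -
  obtain lam y where x: "x \<in> carrier_vec R" "x \<noteq> 0\<^sub>v R" and lam: "lam \<in> carrier_vec K"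
    and y: "y \<in> carrier_vec R" "y \<noteq> 0\<^sub>v R"
    and eq: "\<forall>l<K. slice R T l *\<^sub>v x = lam $ l \<cdot>\<^sub>v y" and L: "L = vspan K {lam}"
    using assms unfolding jge_pair_def by blast
  show thesis
    by (rule that[of lam "\<lambda>i. y $ i"])
      (use x y lam eq L in \<open>auto simp: slice_mult_vec_iff vec_eq_zero_iff\<close>)
qed

lemma jge_pairI:
  fixes T :: "'a::field tensor3"
  assumes "\<exists>j<R. x j \<noteq> 0" "\<exists>i<R. y i \<noteq> 0"
    and "\<And>l i. l < K \<Longrightarrow> i < R \<Longrightarrow> (\<Sum>j<R. T i j l * x j) = lam l * y i"
  shows "jge_pair R K T (vspan K {vec K lam}) (vec R x)"
proof -
  have "vec R y \<noteq> 0\<^sub>v R" "vec R x \<noteq> 0\<^sub>v R" using assms(1,2) by (auto simp: vec_eq_zero_iff)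
  moreover have "\<forall>l<K. slice R T l *\<^sub>v vec R x = vec K lam $ l \<cdot>\<^sub>v vec R y"
    using assms(3) by (simp add: slice_mult_vec_iff)
  ultimately have "vec K lam \<in> carrier_vec K \<and> vec R y \<in> carrier_vec R \<and> vec R y \<noteq> 0\<^sub>v R \<and>
      (\<forall>l<K. slice R T l *\<^sub>v vec R x = vec K lam $ l \<cdot>\<^sub>v vec R y) \<and>
      vspan K {vec K lam} = vspan K {vec K lam}" "vec R x \<noteq> 0\<^sub>v R" by simp_all
  then show ?thesis unfolding jge_pair_def using vec_carrier by blast
qed

lemma jge_vectors_carrier: "{x. jge_vector R K T x} \<subseteq> carrier_vec R"
  "{x. jge_pair R K T L x} \<subseteq> carrier_vec R"
  by (auto simp: jge_vector_def jge_pair_def)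

text \<open>Let \<open>Z\<close> have the JGE vectors \<open>z r\<close> as columns and let
  \<open>N\<close> be its inverse. Then \<open>T_k Z = Y diag(lam(k))\<close> for every
  \<open>k\<close>, so \<open>T_k = Y diag(lam(k)) N\<close>: the factors are the vectors
  \<open>y r\<close>, the rows of \<open>N\<close> and the vectors \<open>lam r\<close>.\<close>

lemma jge_span_imp_has_cpd:
  fixes T :: "'a::field tensor3"
  assumes "vspan R {x. jge_vector R K T x} = carrier_vec R"
  shows "has_cpd R R K T R"
proof -
  obtain z where z: "\<And>r. r < R \<Longrightarrow> z r \<in> {x. jge_vector R K T x}"
    and ind: "\<And>a. (\<And>i. i < R \<Longrightarrow> (\<Sum>r<R. z r $ i * a r) = 0) \<Longrightarrow> \<forall>r<R. a r = 0"
    using vspan_full_obtain_independent[OF jge_vectors_carrier(1) assms] by blast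
  have "\<exists>lam y. r < R \<longrightarrow> (\<forall>l<K. \<forall>i<R. (\<Sum>j<R. T i j l * z r $ j) = lam $ l * y i)" for r
  proof (cases "r < R")
    case True
    then obtain L where "jge_pair R K T L (z r)" using z by (auto simp: jge_vector_def)
    then show ?thesis by (rule jge_pairE) blast
  qed simp
  then obtain lam y where
    ly: "\<And>r l i. r < R \<Longrightarrow> l < K \<Longrightarrow> i < R \<Longrightarrow> (\<Sum>j<R. T i j l * z r $ j) = lam r $ l * y r i"
    by metis
  have "det (mat R R (\<lambda>(i, r). z r $ i)) \<noteq> 0" by (rule injective_matrix_det) (rule ind)
  then obtain N where N: "\<forall>i<R. \<forall>j<R. (\<Sum>r<R. z r $ i * N r j) = (if i = j then 1 else 0)"
    using det_nonzero_inverse[of R "\<lambda>i r. z r $ i"] by blast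
  have "T i j k = (\<Sum>r<R. y r i * N r j * lam r $ k)" if "i < R" "j < R" "k < K" for i j k
  proof -
    have "T i j k = (\<Sum>q<R. T i q k * (\<Sum>r<R. z r $ q * N r j))"
      using that by (simp add: N if_distrib cong: if_cong)
    also have "\<dots> = (\<Sum>r<R. (\<Sum>q<R. T i q k * z r $ q) * N r j)"
      unfolding sum_distrib_left sum_distrib_right by (subst sum.swap) (simp add: mult.assoc)
    also have "\<dots> = (\<Sum>r<R. y r i * N r j * lam r $ k)"
      using that by (intro sum.cong refl) (simp add: ly)
    finally show ?thesis .
  qed
  then show ?thesis unfolding has_cpd_def
    by (intro exI[of _ "\<lambda>i r. y r i"] exI[of _ "\<lambda>j r. N r j"] exI[of _ "\<lambda>k r. lam r $ k"]) simp
qed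

lemma slice_comb_mult_jge:
  fixes T :: "'a::field tensor3"
  assumes "\<And>k i. k < K \<Longrightarrow> i < R \<Longrightarrow> (\<Sum>j<R. T i j k * x j) = lam k * y i" and i: "i < R"
  shows "(\<Sum>j<R. (\<Sum>k<K. \<gamma> $ k * T i j k) * x j) = (\<Sum>k<K. lam k * \<gamma> $ k) * y i"
proof -
  have "(\<Sum>j<R. (\<Sum>k<K. \<gamma> $ k * T i j k) * x j) = (\<Sum>j<R. \<Sum>k<K. \<gamma> $ k * (T i j k * x j))"
    by (simp add: sum_distrib_right mult.assoc)
  also have "\<dots> = (\<Sum>k<K. \<gamma> $ k * (\<Sum>j<R. T i j k * x j))"
    by (subst sum.swap) (simp add: sum_distrib_left)
  also have "\<dots> = (\<Sum>k<K. lam k * \<gamma> $ k) * y i"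
    using assms by (simp add: sum_distrib_right sum_distrib_left mult_ac)
  finally show ?thesis .
qed

text \<open>The dual form of saying that the mode-1 and the mode-2 fibers of \<open>T\<close> span
  the whole space.\<close>

locale nondegenerate_tensor =
  fixes R K :: nat and T :: "'a::field tensor3"
  assumes nd1: "\<And>x a. (\<And>b c. b < R \<Longrightarrow> c < K \<Longrightarrow> (\<Sum>a<R. T a b c * x a) = 0) \<Longrightarrow> a < R \<Longrightarrow> x a = 0"
    and nd2: "\<And>x b. (\<And>a c. a < R \<Longrightarrow> c < K \<Longrightarrow> (\<Sum>b<R. T a b c * x b) = 0) \<Longrightarrow> b < R \<Longrightarrow> x b = 0"
begin

text \<open>A vector orthogonal to all columns of \<open>B\<close> contracts \<open>T\<close> to
  zero. The length \<open>r\<close> stays free: for \<open>r < R\<close> such a vector exists, which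
  bounds the rank from below, and for \<open>r = R\<close> the statement makes \<open>B\<close>
  invertible.\<close>

lemma cpd_inj2:
  assumes T: "\<And>i j k. i < R \<Longrightarrow> j < R \<Longrightarrow> k < K \<Longrightarrow> T i j k = (\<Sum>s<r. A i s * B j s * C k s)"
    and x: "\<And>s. s < r \<Longrightarrow> (\<Sum>j<R. B j s * x j) = 0"
  shows "\<forall>j<R. x j = 0"
proof (intro allI impI, rule nd2)
  fix a c assume ac: "a < R" "c < K"
  have "(\<Sum>b<R. T a b c * x b) = (\<Sum>b<R. \<Sum>s<r. A a s * C c s * (B b s * x b))"
    using ac by (intro sum.cong refl) (simp add: T sum_distrib_right sum_distrib_left mult_ac)
  also have "\<dots> = (\<Sum>s<r. A a s * C c s * (\<Sum>b<R. B b s * x b))"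
    by (subst sum.swap) (simp add: sum_distrib_left)
  also have "\<dots> = 0" using x by simp
  finally show "(\<Sum>b<R. T a b c * x b) = 0" .
qed

lemma cpd_inj1:
  assumes T: "\<And>i j k. i < R \<Longrightarrow> j < R \<Longrightarrow> k < K \<Longrightarrow> T i j k = (\<Sum>s<r. A i s * B j s * C k s)"
    and x: "\<And>s. s < r \<Longrightarrow> (\<Sum>i<R. A i s * x i) = 0"
  shows "\<forall>i<R. x i = 0"
proof (intro allI impI, rule nd1)
  fix b c assume bc: "b < R" "c < K"
  have "(\<Sum>a<R. T a b c * x a) = (\<Sum>a<R. \<Sum>s<r. B b s * C c s * (A a s * x a))"
    using bc by (intro sum.cong refl) (simp add: T sum_distrib_right sum_distrib_left mult_ac)
  also have "\<dots> = (\<Sum>s<r. B b s * C c s * (\<Sum>a<R. A a s * x a))"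
    by (subst sum.swap) (simp add: sum_distrib_left)
  also have "\<dots> = 0" using x by simp
  finally show "(\<Sum>a<R. T a b c * x a) = 0" .
qed

lemma has_cpd_ge:
  assumes "has_cpd R R K T r"
  shows "R \<le> r"
proof (rule ccontr)
  assume "\<not> R \<le> r"
  then have rR: "r < R" by simp
  obtain A B C where T: "\<forall>i<R. \<forall>j<R. \<forall>k<K. T i j k = (\<Sum>s<r. A i s * B j s * C k s)"
    using assms unfolding has_cpd_def by blast
  obtain v where v: "\<exists>j<R. v j \<noteq> 0" "\<And>s. s < r \<Longrightarrow> (\<Sum>j<R. B j s * v j) = 0"
    using wide_matrix_kernel[OF rR, of "\<lambda>s j. B j s"] by blast
  show False using cpd_inj2[where r = r and A = A and B = B and C = C and x = v] T v by blast
qed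

lemma cpd_inverse1:
  assumes T: "\<And>i j k. i < R \<Longrightarrow> j < R \<Longrightarrow> k < K \<Longrightarrow> T i j k = (\<Sum>s<R. A i s * B j s * C k s)"
  obtains N where "\<forall>s<R. \<forall>t<R. (\<Sum>i<R. A i s * N i t) = (if s = t then 1 else 0)"
proof -
  have "det (mat R R (\<lambda>(s, i). A i s)) \<noteq> 0"
    by (rule injective_matrix_det) (rule cpd_inj1[OF T])
  then show thesis using det_nonzero_inverse[of R "\<lambda>s i. A i s"] that by blast
qed

text \<open>Here \<open>x\<close> is column \<open>r\<close> of \<open>B^-T\<close>, so the
  contraction keeps only term \<open>r\<close>, and the vector \<open>y\<close> of the JGE condition
  is column \<open>r\<close> of \<open>A\<close>.\<close>

lemma cpd_jge_pair:
  assumes T: "\<And>i j k. i < R \<Longrightarrow> j < R \<Longrightarrow> k < K \<Longrightarrow> T i j k = (\<Sum>s<R. A i s * B j s * C k s)"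
    and X: "\<And>s. s < R \<Longrightarrow> (\<Sum>j<R. B j s * x j) = (if s = r then 1 else 0)" and r: "r < R"
  shows "jge_pair R K T (vspan K {vec K (\<lambda>k. C k r)}) (vec R x)"
proof (rule jge_pairI[where y = "\<lambda>i. A i r"])
  show "\<exists>j<R. x j \<noteq> 0"
  proof (rule ccontr)
    assume "\<not> ?thesis"
    then have "(\<Sum>j<R. B j r * x j) = 0" by simp
    then show False using X[OF r] by simp
  qed
  obtain N where N: "\<forall>s<R. \<forall>t<R. (\<Sum>i<R. A i s * N i t) = (if s = t then 1 else 0)"
    using cpd_inverse1[OF T] by blast
  show "\<exists>i<R. A i r \<noteq> 0"
  proof (rule ccontr)
    assume "\<not> ?thesis"
    then have "(\<Sum>i<R. A i r * N i r) = 0" by simp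
    then show False using N r by simp
  qed
  fix l i assume li: "l < K" "i < R"
  have "(\<Sum>j<R. T i j l * x j) = (\<Sum>j<R. \<Sum>s<R. A i s * C l s * (B j s * x j))"
    using li by (intro sum.cong refl) (simp add: T sum_distrib_right sum_distrib_left mult_ac)
  also have "\<dots> = (\<Sum>s<R. A i s * C l s * (\<Sum>j<R. B j s * x j))"
    by (subst sum.swap) (simp add: sum_distrib_left)
  also have "\<dots> = (\<Sum>s<R. if s = r then A i s * C l s else 0)"
    by (intro sum.cong refl) (simp add: X)
  also have "\<dots> = C l r * A i r" using r by simp
  finally show "(\<Sum>j<R. T i j l * x j) = C l r * A i r" .
qed

lemma cpd_det2:
  assumes T: "\<And>i j k. i < R \<Longrightarrow> j < R \<Longrightarrow> k < K \<Longrightarrow> T i j k = (\<Sum>s<R. A i s * B j s * C k s)"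
  shows "det (mat R R (\<lambda>(s, j). B j s)) \<noteq> 0"
  by (rule injective_matrix_det) (rule cpd_inj2[OF T])

lemma has_cpd_imp_jge_span:
  assumes "has_cpd R R K T R"
  shows "vspan R {x. jge_vector R K T x} = carrier_vec R"
proof -
  obtain A B C where "\<forall>i<R. \<forall>j<R. \<forall>k<K. T i j k = (\<Sum>s<R. A i s * B j s * C k s)"
    using assms unfolding has_cpd_def by blast
  then have T: "\<And>i j k. i < R \<Longrightarrow> j < R \<Longrightarrow> k < K \<Longrightarrow> T i j k = (\<Sum>s<R. A i s * B j s * C k s)" by blast
  obtain N where N: "\<forall>s<R. \<forall>r<R. (\<Sum>j<R. B j s * N j r) = (if s = r then 1 else 0)"
    using det_nonzero_inverse[OF cpd_det2[OF T]] by blast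
  show ?thesis
  proof (rule vspan_full_if_independent[OF jge_vectors_carrier(1)])
    fix r assume r: "r < R"
    show "vec R (\<lambda>j. N j r) \<in> {x. jge_vector R K T x}"
      unfolding jge_vector_def using cpd_jge_pair[OF T, of "\<lambda>j. N j r" r] N r by auto
  next
    fix a assume "\<And>i. i < R \<Longrightarrow> (\<Sum>r<R. vec R (\<lambda>j. N j r) $ i * a r) = 0"
    then have z: "(\<Sum>r<R. N i r * a r) = 0" if "i < R" for i using that by simp
    \<comment> \<open>Pairing a linear relation among the columns of \<open>B^-T\<close> with column
      \<open>s\<close> of \<open>B\<close> isolates the coefficient \<open>a s\<close>.\<close>
    show "\<forall>s<R. a s = 0"
    proof (intro allI impI)
      fix s assume s: "s < R"
      have "a s = (\<Sum>r<R. if s = r then a r else 0)" using s by simp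
      also have "\<dots> = (\<Sum>r<R. (\<Sum>j<R. B j s * N j r) * a r)"
        using N s by (intro sum.cong refl) auto
      also have "\<dots> = (\<Sum>j<R. B j s * (\<Sum>r<R. N j r * a r))"
        unfolding sum_distrib_left sum_distrib_right by (subst sum.swap) (simp add: mult.assoc)
      also have "\<dots> = 0" using z by simp
      finally show "a s = 0" .
    qed
  qed
qed

lemma decomp_jge:
  assumes dec: "is_decomp R R K T R A B C"
  shows "{L. jge_value R K T L} = {vspan K {col C r} | r. r < R}" (is ?values)
    and "invertible_mat B"
    and "X \<in> carrier_mat R R \<Longrightarrow> transpose_mat B * X = 1\<^sub>m R \<Longrightarrow> r < R \<Longrightarrow> jge_vector R K T (col X r)"
proof -
  have A: "A \<in> carrier_mat R R" and B: "B \<in> carrier_mat R R" and C: "C \<in> carrier_mat K R"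
    and nzC: "\<And>r. r < R \<Longrightarrow> col C r \<noteq> 0\<^sub>v K"
    using dec by (auto simp: is_decomp_def)
  have T: "T i j k = (\<Sum>s<R. A $$ (i, s) * B $$ (j, s) * C $$ (k, s))"
    if "i < R" "j < R" "k < K" for i j k
    using dec that by (simp add: is_decomp_def cpd_def)
  have colC: "vec K (\<lambda>k. C $$ (k, r)) = col C r" if "r < R" for r
    using C that by (intro eq_vecI) auto
  have BT: "mat R R (\<lambda>(s, j). B $$ (j, s)) = transpose_mat B" using B by (intro eq_matI) auto
  have "det (transpose_mat B) \<noteq> 0" using cpd_det2[OF T] unfolding BT .
  then have "det B \<noteq> 0" using det_transpose[OF B] by simp
  then show "invertible_mat B" by (rule det_nonzero_imp_invertible_mat[OF B])
  obtain N where N: "\<forall>s<R. \<forall>r<R. (\<Sum>j<R. B $$ (j, s) * N j r) = (if s = r then 1 else 0)"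
    using det_nonzero_inverse[OF cpd_det2[OF T]] by blast
  have dual: "jge_pair R K T (vspan K {col C r}) (vec R x)"
    if "r < R" "\<And>s. s < R \<Longrightarrow> (\<Sum>j<R. B $$ (j, s) * x j) = (if s = r then 1 else 0)" for r x
    using cpd_jge_pair[OF T that(2,1)] colC[OF that(1)] by simp
  show "jge_vector R K T (col X r)"
    if X: "X \<in> carrier_mat R R" and BX: "transpose_mat B * X = 1\<^sub>m R" and r: "r < R"
  proof -
    have "(\<Sum>j<R. B $$ (j, s) * X $$ (j, r)) = (if s = r then 1 else 0)" if s: "s < R" for s
    proof -
      have "(transpose_mat B * X) $$ (s, r) = (\<Sum>j<R. B $$ (j, s) * X $$ (j, r))"
        using B X r s by (auto simp: scalar_prod_def lessThan_atLeast0 intro!: sum.cong)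
      then show ?thesis using BX r s by simp
    qed
    from dual[OF r this] have "jge_vector R K T (vec R (\<lambda>j. X $$ (j, r)))"
      by (auto simp: jge_vector_def)
    moreover have "vec R (\<lambda>j. X $$ (j, r)) = col X r" using X r by (intro eq_vecI) auto
    ultimately show ?thesis by simp
  qed
  have "\<exists>r<R. L = vspan K {col C r}" if "jge_pair R K T L x" for L x
  proof -
    from that obtain lam y where x: "\<exists>j<R. x $ j \<noteq> 0" and lam: "lam \<in> carrier_vec K"
      and L: "L = vspan K {lam}"
      and eq: "\<And>l i. l < K \<Longrightarrow> i < R \<Longrightarrow> (\<Sum>j<R. T i j l * x $ j) = lam $ l * y i"
      by (auto elim!: jge_pairE)
    \<comment> \<open>In the coordinates \<open>z = B^T x\<close> the JGE equations read
      \<open>A diag(C(l, :)) z = lam(l) y\<close>. Some \<open>z t\<close> is nonzero, and applying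
      the functional dual to column \<open>t\<close> of \<open>A\<close> gives
      \<open>C(l, t) z(t) = lam(l) w\<close> for all \<open>l\<close>.\<close>
    define z where "z s = (\<Sum>j<R. B $$ (j, s) * x $ j)" for s
    obtain M where M: "\<forall>s<R. \<forall>t<R. (\<Sum>i<R. A $$ (i, s) * M i t) = (if s = t then 1 else 0)"
      using cpd_inverse1[OF T] by blast
    obtain t where t: "t < R" "z t \<noteq> 0"
      using cpd_inj2[OF T, where x = "\<lambda>j. x $ j"] x unfolding z_def by blast
    define w where "w = (\<Sum>i<R. y i * M i t)"
    have Cz: "C $$ (l, t) * z t = lam $ l * w" if l: "l < K" for l
    proof -
      have "lam $ l * w = (\<Sum>i<R. (\<Sum>j<R. T i j l * x $ j) * M i t)"
        using eq l by (simp add: w_def sum_distrib_left mult.assoc)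
      also have "\<dots> = (\<Sum>i<R. \<Sum>s<R. C $$ (l, s) * z s * (A $$ (i, s) * M i t))"
      proof (intro sum.cong refl)
        fix i assume "i \<in> {..<R}"
        then have i: "i < R" by simp
        have "(\<Sum>j<R. T i j l * x $ j) = (\<Sum>j<R. \<Sum>s<R. A $$ (i, s) * C $$ (l, s) * (B $$ (j, s) * x $ j))"
          using i l by (intro sum.cong refl) (simp add: T sum_distrib_right sum_distrib_left mult_ac)
        also have "\<dots> = (\<Sum>s<R. A $$ (i, s) * C $$ (l, s) * z s)"
          unfolding z_def by (subst sum.swap) (simp add: sum_distrib_left)
        finally show "(\<Sum>j<R. T i j l * x $ j) * M i t = (\<Sum>s<R. C $$ (l, s) * z s * (A $$ (i, s) * M i t))"
          by (simp add: sum_distrib_right sum_distrib_left mult_ac)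
      qed
      also have "\<dots> = (\<Sum>s<R. C $$ (l, s) * z s * (\<Sum>i<R. A $$ (i, s) * M i t))"
        by (subst sum.swap) (simp add: sum_distrib_left)
      also have "\<dots> = (\<Sum>s<R. if s = t then C $$ (l, s) * z s else 0)"
        using M t(1) by (intro sum.cong refl) simp
      also have "\<dots> = C $$ (l, t) * z t" using t(1) by simp
      finally show ?thesis by simp
    qed
    have col: "col C t = (w / z t) \<cdot>\<^sub>v lam"
      using Cz t C lam by (intro eq_vecI) (auto simp: field_simps)
    \<comment> \<open>The third factor of a rank one term is nonzero, so the proportionality
      constant does not vanish and both spans agree.\<close>
    have "w / z t \<noteq> 0"
    proof
      assume "w / z t = 0"
      then have "col C t = 0\<^sub>v K" using col lam by auto
      then show False using nzC t by simp
    qed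
    then have "vspan K {col C t} = vspan K {lam}" unfolding col by (rule vspan_smult[OF lam])
    then show ?thesis using L t by blast
  qed
  moreover have "jge_value R K T (vspan K {col C r})" if "r < R" for r
    unfolding jge_value_def using dual[OF that, of "\<lambda>j. N j r"] N that by auto
  ultimately show ?values unfolding jge_value_def by blast
qed

end

section \<open>Limits of tensors of rank R\<close>

lemma det_diagonal:
  fixes d :: "nat \<Rightarrow> 'a::comm_ring_1"
  shows "det (mat n n (\<lambda>(i, j). if i = j then d i else 0)) = (\<Prod>i<n. d i)"
proof -
  let ?D = "mat n n (\<lambda>(i, j). if i = j then d i else 0)"
  have "det ?D = prod_list (diag_mat ?D)"
    by (rule det_upper_triangular[of _ n]) auto
  also have "diag_mat ?D = map d [0..<n]" by (auto simp: diag_mat_def)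
  also have "prod_list (map d [0..<n]) = (\<Prod>i<n. d i)"
    by (simp add: prod.distinct_set_conv_list[symmetric] lessThan_atLeast0)
  finally show ?thesis .
qed

text \<open>The slice mix at \<open>\<gamma>\<close> factors as
  \<open>A diag(C^T \<gamma>) B^T\<close>, and the determinant is multiplicative.\<close>

lemma char_poly_fun_cpd:
  fixes S :: "'a::field tensor3"
  assumes S: "\<And>i j k. i < R \<Longrightarrow> j < R \<Longrightarrow> k < K \<Longrightarrow> S i j k = (\<Sum>s<R. A i s * B j s * C k s)"
  shows "char_poly_fun R K S \<gamma> = det (mat R R (\<lambda>(i, s). A i s)) *
    (\<Prod>s<R. \<Sum>k<K. C k s * \<gamma> $ k) * det (mat R R (\<lambda>(s, j). B j s))"
proof -
  let ?A = "mat R R (\<lambda>(i, s). A i s)"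
  let ?D = "mat R R (\<lambda>(i, j). if i = j then (\<Sum>k<K. C k i * \<gamma> $ k) else 0)"
  let ?B = "mat R R (\<lambda>(s, j). B j s)"
  have AD: "?A * ?D = mat R R (\<lambda>(i, s). A i s * (\<Sum>k<K. C k s * \<gamma> $ k))" (is "_ = ?AD")
  proof (rule eq_matI)
    fix i j assume "i < dim_row ?AD" "j < dim_col ?AD"
    then have ij: "i < R" "j < R" by auto
    have "(?A * ?D) $$ (i, j) = (\<Sum>s<R. A i s * (if s = j then (\<Sum>k<K. C k s * \<gamma> $ k) else 0))"
      using ij by (simp add: scalar_prod_def lessThan_atLeast0)
    also have "\<dots> = (\<Sum>s<R. if s = j then A i s * (\<Sum>k<K. C k s * \<gamma> $ k) else 0)"
      by (intro sum.cong) auto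
    finally show "(?A * ?D) $$ (i, j) = ?AD $$ (i, j)" using ij by simp
  qed auto
  have "slice_comb R K S \<gamma> = ?AD * ?B"
  proof (rule eq_matI)
    fix i j assume "i < dim_row (?AD * ?B)" "j < dim_col (?AD * ?B)"
    then have ij: "i < R" "j < R" by auto
    have "slice_comb R K S \<gamma> $$ (i, j) = (\<Sum>k<K. \<Sum>s<R. A i s * B j s * (C k s * \<gamma> $ k))"
      using ij unfolding slice_comb_def
      by (simp, intro sum.cong refl) (simp add: S sum_distrib_left mult_ac)
    also have "\<dots> = (\<Sum>s<R. A i s * (\<Sum>k<K. C k s * \<gamma> $ k) * B j s)"
      by (subst sum.swap) (simp add: sum_distrib_left sum_distrib_right mult_ac)
    also have "\<dots> = (?AD * ?B) $$ (i, j)"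
      using ij by (auto simp: scalar_prod_def lessThan_atLeast0 intro!: sum.cong)
    finally show "slice_comb R K S \<gamma> $$ (i, j) = (?AD * ?B) $$ (i, j)" .
  qed (auto simp: slice_comb_def)
  then have "char_poly_fun R K S \<gamma> = det (?A * ?D * ?B)" unfolding char_poly_fun_def AD by simp
  also have "\<dots> = det ?A * det ?D * det ?B"
    using det_mult[of "?A * ?D" R ?B] det_mult[of ?A R ?D] mult_carrier_mat[of ?A R R ?D R] by simp
  finally show ?thesis by (simp add: det_diagonal)
qed

text \<open>By the Leibniz formula the value at a fixed \<open>\<gamma>\<close> is a polynomial in
  the tensor entries.\<close>

lemma tendsto_char_poly_fun:
  fixes T :: "'a::real_normed_field tensor3"
  assumes "\<And>i j k. i < R \<Longrightarrow> j < R \<Longrightarrow> k < K \<Longrightarrow> (\<lambda>n. S n i j k) \<longlonglongrightarrow> T i j k"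
  shows "(\<lambda>n. char_poly_fun R K (S n) \<gamma>) \<longlonglongrightarrow> char_poly_fun R K T \<gamma>"
proof -
  have pi: "p i < R" if "p permutes {0..<R}" "i < R" for p i
    using permutes_in_image[OF that(1), of i] that(2) by simp
  have d: "char_poly_fun R K U \<gamma> = (\<Sum>p\<in>{p. p permutes {0..<R}}.
      signof p * (\<Prod>i = 0..<R. \<Sum>k<K. \<gamma> $ k * U i (p i) k))" for U :: "'a tensor3"
  proof -
    have c: "slice_comb R K U \<gamma> \<in> carrier_mat R R" by (simp add: slice_comb_def)
    show ?thesis unfolding char_poly_fun_def det_def'[OF c]
    proof (intro sum.cong refl arg_cong2[of _ _ _ _ times] prod.cong)
      fix p i assume "p \<in> {p. p permutes {0..<R}}" "i \<in> {0..<R}"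
      then have "i < R" "p i < R" using pi by auto
      then show "slice_comb R K U \<gamma> $$ (i, p i) = (\<Sum>k<K. \<gamma> $ k * U i (p i) k)"
        by (simp add: slice_comb_def)
    qed
  qed
  show ?thesis unfolding d
    using assms by (intro tendsto_sum tendsto_mult tendsto_prod tendsto_const)
      (auto simp: pi)
qed

text \<open>The JGE equations allow \<open>lam\<close> and \<open>x\<close> to be rescaled
  independently if \<open>y\<close> compensates; so only \<open>lam\<close> and \<open>x\<close> get
  l1 norm one.\<close>

definition normalized_jge :: "nat \<Rightarrow> nat \<Rightarrow> 'a::{field, real_normed_vector} tensor3 \<Rightarrow>
    (nat \<Rightarrow> 'a) \<Rightarrow> (nat \<Rightarrow> 'a) \<Rightarrow> (nat \<Rightarrow> 'a) \<Rightarrow> bool" where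
  "normalized_jge R K S lam x y \<longleftrightarrow> (\<Sum>k<K. norm (lam k)) = 1 \<and> (\<Sum>j<R. norm (x j)) = 1 \<and>
     (\<forall>k<K. \<forall>i<R. (\<Sum>j<R. S i j k * x j) = lam k * y i)"

lemma sum_norm_scaled:
  fixes f :: "nat \<Rightarrow> 'a::real_normed_field"
  assumes "\<exists>i<n. f i \<noteq> 0"
  shows "(\<Sum>i<n. norm (f i / of_real (\<Sum>i<n. norm (f i)))) = 1" "(\<Sum>i<n. norm (f i)) \<noteq> 0"
proof -
  have pos: "(\<Sum>i<n. norm (f i)) > 0"
    using assms by (auto intro!: sum_pos2)
  then show "(\<Sum>i<n. norm (f i)) \<noteq> 0" by simp
  have "(\<Sum>i<n. norm (f i / of_real c)) = (\<Sum>i<n. norm (f i)) / c" if "c > 0" for c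
    using that by (simp add: norm_divide sum_divide_distrib[symmetric])
  from this[OF pos] show "(\<Sum>i<n. norm (f i / of_real (\<Sum>i<n. norm (f i)))) = 1" using pos by simp
qed

text \<open>Nonvanishing at \<open>\<gamma>0\<close> replaces nondegeneracy: it makes
  \<open>B\<close> invertible and keeps every linear form given by a column of \<open>C\<close>
  nonzero at \<open>\<gamma>0\<close>. Hence \<open>B^-T\<close> exists and each column of
  \<open>C\<close> can be normalised.\<close>

lemma cpd_normalized_jge:
  fixes S :: "'a::real_normed_field tensor3"
  assumes cpd: "has_cpd R R K S R" and nz: "char_poly_fun R K S \<gamma>0 \<noteq> 0"
  shows "\<exists>lam x y. (\<forall>r<R. normalized_jge R K S (lam r) (x r) (y r)) \<and>
    (\<forall>\<gamma>. char_poly_fun R K S \<gamma> * (\<Prod>r<R. \<Sum>k<K. lam r k * \<gamma>0 $ k)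
       = char_poly_fun R K S \<gamma>0 * (\<Prod>r<R. \<Sum>k<K. lam r k * \<gamma> $ k))"
proof -
  obtain A B C where "\<forall>i<R. \<forall>j<R. \<forall>k<K. S i j k = (\<Sum>s<R. A i s * B j s * C k s)"
    using cpd unfolding has_cpd_def by blast
  then have S: "\<And>i j k. i < R \<Longrightarrow> j < R \<Longrightarrow> k < K \<Longrightarrow> S i j k = (\<Sum>s<R. A i s * B j s * C k s)" by blast
  note p = char_poly_fun_cpd[OF S]
  have dB: "det (mat R R (\<lambda>(s, j). B j s)) \<noteq> 0" using nz p[where \<gamma> = \<gamma>0] by auto
  have C0: "(\<Sum>k<K. C k s * \<gamma>0 $ k) \<noteq> 0" if "s < R" for s
  proof
    assume "(\<Sum>k<K. C k s * \<gamma>0 $ k) = 0"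
    then have "(\<Prod>s<R. \<Sum>k<K. C k s * \<gamma>0 $ k) = 0" using that by (intro prod_zero) auto
    then show False using nz p[where \<gamma> = \<gamma>0] by simp
  qed
  obtain N where N: "\<forall>s<R. \<forall>r<R. (\<Sum>j<R. B j s * N j r) = (if s = r then 1 else 0)"
    using det_nonzero_inverse[OF dB] by blast
  define \<eta> where "\<eta> r = (of_real (\<Sum>k<K. norm (C k r)) :: 'a)" for r
  define \<xi> where "\<xi> r = (of_real (\<Sum>j<R. norm (N j r)) :: 'a)" for r
  have Cnz: "\<exists>k<K. C k r \<noteq> 0" if "r < R" for r
  proof (rule ccontr)
    assume "\<not> ?thesis"
    then have "(\<Sum>k<K. C k r * \<gamma>0 $ k) = 0" by simp
    then show False using C0[OF that] by simp
  qed
  have Nnz: "\<exists>j<R. N j r \<noteq> 0" if "r < R" for r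
  proof (rule ccontr)
    assume "\<not> ?thesis"
    then have "(\<Sum>j<R. B j r * N j r) = 0" by simp
    then show False using N that by simp
  qed
  have \<eta>0: "\<eta> r \<noteq> 0" and \<xi>0: "\<xi> r \<noteq> 0" if "r < R" for r
    using sum_norm_scaled(2)[OF Cnz[OF that]] sum_norm_scaled(2)[OF Nnz[OF that]]
    unfolding \<eta>_def \<xi>_def by (simp_all only: of_real_eq_0_iff not_False_eq_True)
  have jge: "normalized_jge R K S (\<lambda>k. C k r / \<eta> r) (\<lambda>j. N j r / \<xi> r) (\<lambda>i. A i r * \<eta> r / \<xi> r)"
    if r: "r < R" for r
    unfolding normalized_jge_def
  proof (intro conjI allI impI)
    show "(\<Sum>k<K. norm (C k r / \<eta> r)) = 1" "(\<Sum>j<R. norm (N j r / \<xi> r)) = 1"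
      unfolding \<eta>_def \<xi>_def using sum_norm_scaled(1)[OF Cnz[OF r]] sum_norm_scaled(1)[OF Nnz[OF r]]
      by simp_all
    fix k i assume ki: "k < K" "i < R"
    have "(\<Sum>j<R. S i j k * (N j r / \<xi> r)) = (\<Sum>j<R. \<Sum>s<R. A i s * C k s * (B j s * N j r)) / \<xi> r"
      unfolding sum_divide_distrib
      using ki by (intro sum.cong refl) (simp add: S sum_distrib_right sum_distrib_left sum_divide_distrib mult_ac)
    also have "(\<Sum>j<R. \<Sum>s<R. A i s * C k s * (B j s * N j r)) = (\<Sum>s<R. A i s * C k s * (\<Sum>j<R. B j s * N j r))"
      by (subst sum.swap) (simp add: sum_distrib_left)
    also have "\<dots> = (\<Sum>s<R. if s = r then A i s * C k s else 0)"
      using N r by (intro sum.cong refl) simp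
    also have "\<dots> = A i r * C k r" using r by simp
    finally show "(\<Sum>j<R. S i j k * (N j r / \<xi> r)) = C k r / \<eta> r * (A i r * \<eta> r / \<xi> r)"
      using \<eta>0[OF r] by simp
  qed
  have lf: "(\<Prod>r<R. \<Sum>k<K. C k r / \<eta> r * \<gamma> $ k) = (\<Prod>s<R. \<Sum>k<K. C k s * \<gamma> $ k) / (\<Prod>r<R. \<eta> r)" for \<gamma>
    by (simp add: prod_dividef[symmetric] sum_divide_distrib)
  \<comment> \<open>Both sides equal the product of the two determinants with the unnormalised
    linear forms at \<open>\<gamma>\<close> and at \<open>\<gamma>0\<close>, divided by the product
    of all \<open>\<eta> r\<close>.\<close>
  have "char_poly_fun R K S \<gamma> * (\<Prod>r<R. \<Sum>k<K. C k r / \<eta> r * \<gamma>0 $ k)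
       = char_poly_fun R K S \<gamma>0 * (\<Prod>r<R. \<Sum>k<K. C k r / \<eta> r * \<gamma> $ k)" for \<gamma>
    unfolding lf by (simp add: p mult_ac)
  note fac = this
  show ?thesis
    by (rule exI[of _ "\<lambda>r k. C k r / \<eta> r"], rule exI[of _ "\<lambda>r j. N j r / \<xi> r"],
        rule exI[of _ "\<lambda>r i. A i r * \<eta> r / \<xi> r"], intro conjI allI impI; rule jge fac; assumption)
qed

text \<open>Since \<open>lam\<close> has l1 norm one, \<open>norm (y i)\<close> is the sum of all
  \<open>norm (lam k * y i)\<close>. The JGE equations bound this by entries of \<open>S\<close>, so
  \<open>y\<close> stays bounded along a convergent sequence of tensors.\<close>

lemma normalized_jge_bounds:
  fixes S :: "'a::real_normed_field tensor3"
  assumes "normalized_jge R K S lam x y"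
  shows "k < K \<Longrightarrow> norm (lam k) \<le> 1" "j < R \<Longrightarrow> norm (x j) \<le> 1"
    "i < R \<Longrightarrow> norm (y i) \<le> (\<Sum>k<K. \<Sum>j<R. norm (S i j k))"
proof -
  have l: "(\<Sum>k<K. norm (lam k)) = 1" and x: "(\<Sum>j<R. norm (x j)) = 1"
    and eq: "\<forall>k<K. \<forall>i<R. (\<Sum>j<R. S i j k * x j) = lam k * y i"
    using assms by (auto simp: normalized_jge_def)
  show "norm (lam k) \<le> 1" if "k < K" for k
    using member_le_sum[of k "{..<K}" "\<lambda>k. norm (lam k)"] that l by simp
  show x1: "norm (x j) \<le> 1" if "j < R" for j
    using member_le_sum[of j "{..<R}" "\<lambda>j. norm (x j)"] that x by simp
  show "norm (y i) \<le> (\<Sum>k<K. \<Sum>j<R. norm (S i j k))" if i: "i < R"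
  proof -
    have "norm (y i) = (\<Sum>k<K. norm (lam k * y i))"
      using l by (simp add: norm_mult sum_distrib_right[symmetric])
    also have "\<dots> = (\<Sum>k<K. norm (\<Sum>j<R. S i j k * x j))" using eq i by simp
    also have "\<dots> \<le> (\<Sum>k<K. \<Sum>j<R. norm (S i j k * x j))" by (intro sum_mono norm_sum)
    also have "\<dots> \<le> (\<Sum>k<K. \<Sum>j<R. norm (S i j k))"
      by (intro sum_mono) (auto simp: norm_mult x1 mult_left_le)
    finally show ?thesis .
  qed
qed

text \<open>The identity for the characteristic polynomial is cross-multiplied with its value at \<open>\<gamma>0\<close> so that no constant factor has to converge.\<close>

lemma limit_of_cpds_jge:
  fixes T :: "'a::{conjugatable_field, real_normed_field} tensor3"
  assumes conj_std: "\<And>x::'a. conjugate x * x = of_real ((norm x)\<^sup>2)"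
    and cpd: "\<And>n. has_cpd R R K (S n) R"
    and lim: "\<And>i j k. i < R \<Longrightarrow> j < R \<Longrightarrow> k < K \<Longrightarrow> (\<lambda>n. S n i j k) \<longlonglongrightarrow> T i j k"
    and nz: "char_poly_fun R K T \<gamma>0 \<noteq> 0"
  shows "\<exists>lam x y :: nat \<Rightarrow> nat \<Rightarrow> 'a. (\<forall>r<R. (\<exists>j<R. x r j \<noteq> 0) \<and> (\<exists>i<R. y r i \<noteq> 0) \<and>
      (\<Sum>k<K. lam r k * \<gamma>0 $ k) \<noteq> 0 \<and> (\<forall>k<K. \<forall>i<R. (\<Sum>j<R. T i j k * x r j) = lam r k * y r i)) \<and>
    (\<forall>\<gamma>. char_poly_fun R K T \<gamma> * (\<Prod>r<R. \<Sum>k<K. lam r k * \<gamma>0 $ k)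
       = char_poly_fun R K T \<gamma>0 * (\<Prod>r<R. \<Sum>k<K. lam r k * \<gamma> $ k))"
proof -
  have "eventually (\<lambda>n. char_poly_fun R K (S n) \<gamma>0 \<noteq> 0) sequentially"
    using tendsto_imp_eventually_ne[OF tendsto_char_poly_fun[of R K S T \<gamma>0] nz] lim by blast
  then obtain N0 where N0: "\<And>n. n \<ge> N0 \<Longrightarrow> char_poly_fun R K (S n) \<gamma>0 \<noteq> 0"
    by (auto simp: eventually_sequentially)
  \<comment> \<open>Dropping an initial segment makes the characteristic polynomial nonzero at
    \<open>\<gamma>0\<close> for every index.\<close>
  define U where "U n = S (n + N0)" for n
  have Ulim: "(\<lambda>n. U n i j k) \<longlonglongrightarrow> T i j k" if "i < R" "j < R" "k < K" for i j k
    unfolding U_def using LIMSEQ_ignore_initial_segment[OF lim[OF that]] .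
  define Q where "Q n q \<longleftrightarrow> (\<forall>r<R. normalized_jge R K (U n) (fst q r) (fst (snd q) r) (snd (snd q) r)) \<and>
    (\<forall>\<gamma>. char_poly_fun R K (U n) \<gamma> * (\<Prod>r<R. \<Sum>k<K. fst q r k * \<gamma>0 $ k)
       = char_poly_fun R K (U n) \<gamma>0 * (\<Prod>r<R. \<Sum>k<K. fst q r k * \<gamma> $ k))" for n q
  have "\<forall>n. \<exists>q. Q n q"
  proof
    fix n
    show "\<exists>q. Q n q"
      using cpd_normalized_jge[OF cpd N0, of "n + N0"] unfolding Q_def U_def by auto
  qed
  from choice[OF this] obtain q where q: "\<And>n. Q n (q n)" by blast
  define lam x y where "lam n = fst (q n)" and "x n = fst (snd (q n))" and "y n = snd (snd (q n))" for n
  have jge: "normalized_jge R K (U n) (lam n r) (x n r) (y n r)" if "r < R" for n r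
    using q[of n] that unfolding Q_def lam_def x_def y_def by blast
  have fac: "char_poly_fun R K (U n) \<gamma> * (\<Prod>r<R. \<Sum>k<K. lam n r k * \<gamma>0 $ k)
       = char_poly_fun R K (U n) \<gamma>0 * (\<Prod>r<R. \<Sum>k<K. lam n r k * \<gamma> $ k)" for n \<gamma>
    using q[of n] unfolding Q_def lam_def by blast
  have "\<exists>M\<ge>0. \<forall>n. i < R \<longrightarrow> j < R \<longrightarrow> k < K \<longrightarrow> norm (U n i j k) \<le> M" for i j k
  proof (cases "i < R \<and> j < R \<and> k < K")
    case True
    then have "Bseq (\<lambda>n. U n i j k)" using Ulim convergent_imp_Bseq convergent_def by blast
    then show ?thesis by (auto elim!: BseqE intro: less_imp_le)
  qed auto
  note ex_bound = this
  define M where "M i j k = (SOME M. M \<ge> 0 \<and> (\<forall>n. i < R \<longrightarrow> j < R \<longrightarrow> k < K \<longrightarrow> norm (U n i j k) \<le> M))" for i j k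
  have M0: "M i j k \<ge> 0" and M: "i < R \<Longrightarrow> j < R \<Longrightarrow> k < K \<Longrightarrow> norm (U n i j k) \<le> M i j k" for i j k n
    using someI_ex[OF ex_bound[of i j k]] unfolding M_def by blast+
  define M1 where "M1 = (\<Sum>i<R. \<Sum>k<K. \<Sum>j<R. M i j k)"
  have M1: "M1 \<ge> 0" unfolding M1_def by (intro sum_nonneg M0)
  have yb: "norm (y n r i) \<le> M1" if "r < R" "i < R" for n r i
  proof -
    have "norm (y n r i) \<le> (\<Sum>k<K. \<Sum>j<R. norm (U n i j k))"
      using normalized_jge_bounds(3)[OF jge[OF that(1)] that(2)] .
    also have "\<dots> \<le> (\<Sum>k<K. \<Sum>j<R. M i j k)" using M that by (intro sum_mono) auto
    also have "\<dots> \<le> M1" unfolding M1_def using that M0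
      by (intro member_le_sum[of i "{..<R}" "\<lambda>i. \<Sum>k<K. \<Sum>j<R. M i j k"]) (auto intro!: sum_nonneg)
    finally show ?thesis .
  qed
  \<comment> \<open>The tag \<open>q\<close> packs \<open>x\<close>, \<open>lam\<close> and
    \<open>y\<close> into one family, so that one subsequence serves all three. The range
    \<open>R + K\<close> for \<open>s\<close> covers both vector lengths; surplus entries are
    zero.\<close>
  define f where "f = (\<lambda>(q, r, s) n. if q = (0::nat) \<and> s < R then x n r s
     else if q = 1 \<and> s < K then lam n r s else if q = 2 \<and> s < R then y n r s else 0)"
  let ?I = "{..<3} \<times> {..<R} \<times> {..<R + K}"
  have "norm (f i n) \<le> M1 + 1" if "i \<in> ?I" for i n
  proof -
    obtain q r s where i: "i = (q, r, s)" by (cases i)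
    have r: "r < R" using that i by auto
    show ?thesis unfolding f_def i
      using normalized_jge_bounds(1,2)[OF jge[OF r, of n]] yb[OF r, of _ n] M1
      by (auto intro: order_trans[of _ 1] order_trans[of _ M1])
  qed
  from finite_family_convergent_subseq[OF conj_std, of ?I f, OF _ this]
  obtain \<sigma> :: "nat \<Rightarrow> nat" where \<sigma>: "strict_mono \<sigma>" and conv: "\<forall>i\<in>?I. convergent (\<lambda>n. f i (\<sigma> n))"
    by auto
  define X where "X r j = Topological_Spaces.lim (\<lambda>n. f (0, r, j) (\<sigma> n))" for r j
  define \<Lambda> where "\<Lambda> r k = Topological_Spaces.lim (\<lambda>n. f (1, r, k) (\<sigma> n))" for r k
  define Y where "Y r i = Topological_Spaces.lim (\<lambda>n. f (2, r, i) (\<sigma> n))" for r i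
  have Xl: "(\<lambda>n. x (\<sigma> n) r j) \<longlonglongrightarrow> X r j" if "r < R" "j < R" for r j
    using convergent_LIMSEQ_iff[THEN iffD1, OF conv[rule_format, of "(0, r, j)"]] that
    by (simp add: f_def X_def)
  have Ll: "(\<lambda>n. lam (\<sigma> n) r k) \<longlonglongrightarrow> \<Lambda> r k" if "r < R" "k < K" for r k
    using convergent_LIMSEQ_iff[THEN iffD1, OF conv[rule_format, of "(1, r, k)"]] that
    by (simp add: f_def \<Lambda>_def)
  have Yl: "(\<lambda>n. y (\<sigma> n) r i) \<longlonglongrightarrow> Y r i" if "r < R" "i < R" for r i
    using convergent_LIMSEQ_iff[THEN iffD1, OF conv[rule_format, of "(2, r, i)"]] that
    by (simp add: f_def Y_def)
  have Ul: "(\<lambda>n. U (\<sigma> n) i j k) \<longlonglongrightarrow> T i j k" if "i < R" "j < R" "k < K" for i j k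
    using LIMSEQ_subseq_LIMSEQ[OF Ulim[OF that] \<sigma>] by (simp add: o_def)
  have eq: "(\<Sum>j<R. T i j k * X r j) = \<Lambda> r k * Y r i" if "r < R" "k < K" "i < R" for r k i
  proof (rule LIMSEQ_unique)
    show "(\<lambda>n. \<Sum>j<R. U (\<sigma> n) i j k * x (\<sigma> n) r j) \<longlonglongrightarrow> (\<Sum>j<R. T i j k * X r j)"
      using that by (intro tendsto_sum tendsto_mult Ul Xl) auto
    have "(\<Sum>j<R. U (\<sigma> n) i j k * x (\<sigma> n) r j) = lam (\<sigma> n) r k * y (\<sigma> n) r i" for n
      using jge[OF that(1), of "\<sigma> n"] that by (auto simp: normalized_jge_def)
    then show "(\<lambda>n. \<Sum>j<R. U (\<sigma> n) i j k * x (\<sigma> n) r j) \<longlonglongrightarrow> \<Lambda> r k * Y r i"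
      using that by (auto intro!: tendsto_mult Ll Yl)
  qed
  have Xnz: "\<exists>j<R. X r j \<noteq> 0" if "r < R" for r
  proof (rule ccontr)
    assume "\<not> ?thesis"
    then have z: "(\<Sum>j<R. norm (X r j)) = 0" by simp
    have "(\<lambda>n. \<Sum>j<R. norm (x (\<sigma> n) r j)) \<longlonglongrightarrow> (\<Sum>j<R. norm (X r j))"
      using that by (intro tendsto_sum tendsto_norm Xl) auto
    moreover have "(\<Sum>j<R. norm (x (\<sigma> n) r j)) = 1" for n
      using jge[OF that, of "\<sigma> n"] by (auto simp: normalized_jge_def)
    ultimately have "(\<lambda>n. 1 :: real) \<longlonglongrightarrow> 0" using z by simp
    then show False using LIMSEQ_unique tendsto_const zero_neq_one by metis
  qed
  have pl: "(\<lambda>n. char_poly_fun R K (U (\<sigma> n)) \<gamma>) \<longlonglongrightarrow> char_poly_fun R K T \<gamma>" for \<gamma>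
    by (rule tendsto_char_poly_fun) (rule Ul)
  have ll: "(\<lambda>n. \<Prod>r<R. \<Sum>k<K. lam (\<sigma> n) r k * \<gamma> $ k) \<longlonglongrightarrow> (\<Prod>r<R. \<Sum>k<K. \<Lambda> r k * \<gamma> $ k)" for \<gamma>
    by (intro tendsto_prod tendsto_sum tendsto_mult Ll tendsto_const) auto
  have fac': "char_poly_fun R K T \<gamma> * (\<Prod>r<R. \<Sum>k<K. \<Lambda> r k * \<gamma>0 $ k)
       = char_poly_fun R K T \<gamma>0 * (\<Prod>r<R. \<Sum>k<K. \<Lambda> r k * \<gamma> $ k)" for \<gamma>
  proof (rule LIMSEQ_unique)
    show "(\<lambda>n. char_poly_fun R K (U (\<sigma> n)) \<gamma> * (\<Prod>r<R. \<Sum>k<K. lam (\<sigma> n) r k * \<gamma>0 $ k))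
      \<longlonglongrightarrow> char_poly_fun R K T \<gamma> * (\<Prod>r<R. \<Sum>k<K. \<Lambda> r k * \<gamma>0 $ k)"
      by (intro tendsto_mult pl ll)
    show "(\<lambda>n. char_poly_fun R K (U (\<sigma> n)) \<gamma> * (\<Prod>r<R. \<Sum>k<K. lam (\<sigma> n) r k * \<gamma>0 $ k))
      \<longlonglongrightarrow> char_poly_fun R K T \<gamma>0 * (\<Prod>r<R. \<Sum>k<K. \<Lambda> r k * \<gamma> $ k)"
      unfolding fac by (intro tendsto_mult pl ll)
  qed
  have d: "det (mat R R (\<lambda>(i, j). \<Sum>k<K. \<gamma>0 $ k * T i j k)) \<noteq> 0"
    using nz by (simp add: char_poly_fun_def slice_comb_def)
  \<comment> \<open>The slice mix at \<open>\<gamma>0\<close> sends \<open>X r\<close> to the linear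
    form at \<open>\<gamma>0\<close> times \<open>Y r\<close>. If either of these vanished, the
    nonzero \<open>X r\<close> would lie in the kernel of an invertible matrix.\<close>
  have YL: "(\<exists>i<R. Y r i \<noteq> 0) \<and> (\<Sum>k<K. \<Lambda> r k * \<gamma>0 $ k) \<noteq> 0" if r: "r < R" for r
  proof (rule ccontr)
    assume "\<not> ?thesis"
    then have z: "(\<Sum>k<K. \<Lambda> r k * \<gamma>0 $ k) * Y r i = 0" if "i < R" for i using that by auto
    have "(\<Sum>j<R. (\<Sum>k<K. \<gamma>0 $ k * T i j k) * X r j) = 0" if "i < R" for i
      using slice_comb_mult_jge[where T = T and x = "X r" and y = "Y r" and lam = "\<Lambda> r", OF eq[OF r] that]
        z[OF that] by simp
    then have "X r j = 0" if "j < R" for j using det_nonzero_injective[OF d _ that] by blast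
    then show False using Xnz[OF r] by blast
  qed
  show ?thesis
    by (rule exI[of _ \<Lambda>], rule exI[of _ X], rule exI[of _ Y]) (simp add: Xnz YL eq fac')
qed

section \<open>Independence of joint generalized eigenvectors\<close>

text \<open>The classical induction for eigenvectors of distinct eigenvalues, with an injective
  \<open>N\<close> in place of the identity and tuples of eigenvalues. The \<open>u l\<close> may be
  zero or sums within one eigenspace, so the conclusion says that the sum of the eigenspaces is
  direct.\<close>

lemma joint_eigenvectors_independent:
  fixes T :: "'a::field tensor3" and u :: "'i \<Rightarrow> nat \<Rightarrow> 'a"
  assumes inj: "\<And>v j. (\<And>i. i < R \<Longrightarrow> (\<Sum>j<R. N i j * v j) = 0) \<Longrightarrow> j < R \<Longrightarrow> v j = 0"
    and "finite I"
    and "\<And>l m. l \<in> I \<Longrightarrow> m \<in> I \<Longrightarrow> l \<noteq> m \<Longrightarrow> \<exists>k<K. \<mu> l k \<noteq> \<mu> m k"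
    and "\<And>l k i. l \<in> I \<Longrightarrow> k < K \<Longrightarrow> i < R \<Longrightarrow> (\<Sum>j<R. T i j k * u l j) = \<mu> l k * (\<Sum>j<R. N i j * u l j)"
    and "\<And>j. j < R \<Longrightarrow> (\<Sum>l\<in>I. u l j) = 0"
  shows "\<forall>l\<in>I. \<forall>j<R. u l j = 0"
  using assms(2-)
proof (induction I arbitrary: u)
  case (insert l0 I)
  note distinct = insert.prems(1) and eig = insert.prems(2) and zero = insert.prems(3)
  have kill: "(\<mu> l k - \<mu> l0 k) * u l j = 0" if k: "k < K" and l: "l \<in> I" and j: "j < R" for k l j
  proof -
    \<comment> \<open>Applying \<open>T_k - \<mu> l0 k N\<close> to the relation removes the summand
      \<open>l0\<close> and turns each \<open>u l\<close> into \<open>N\<close> applied to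
      \<open>v l\<close>. Injectivity of \<open>N\<close> gives a shorter relation among the
      \<open>v l\<close>.\<close>
    define v where "v l j = (\<mu> l k - \<mu> l0 k) * u l j" for l j
    have "\<forall>l\<in>I. \<forall>j<R. v l j = 0"
    proof (rule insert.IH)
      show "\<exists>k<K. \<mu> l k \<noteq> \<mu> m k" if "l \<in> I" "m \<in> I" "l \<noteq> m" for l m
        using distinct that by blast
      show "(\<Sum>j<R. T i j k' * v l j) = \<mu> l k' * (\<Sum>j<R. N i j * v l j)"
        if "l \<in> I" "k' < K" "i < R" for l k' i
      proof -
        have "(\<Sum>j<R. T i j k' * v l j) = (\<mu> l k - \<mu> l0 k) * (\<Sum>j<R. T i j k' * u l j)"
          by (simp add: v_def sum_distrib_left mult_ac)
        also have "\<dots> = \<mu> l k' * ((\<mu> l k - \<mu> l0 k) * (\<Sum>j<R. N i j * u l j))"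
          using eig[of l k' i] that by simp
        also have "(\<mu> l k - \<mu> l0 k) * (\<Sum>j<R. N i j * u l j) = (\<Sum>j<R. N i j * v l j)"
          by (simp add: v_def sum_distrib_left mult_ac)
        finally show ?thesis .
      qed
      show "(\<Sum>l\<in>I. v l j) = 0" if "j < R" for j
      proof (rule inj[OF _ that])
        fix i assume i: "i < R"
        have swap: "(\<Sum>l\<in>insert l0 I. \<Sum>j<R. F j * u l j) = 0" for F :: "nat \<Rightarrow> 'a"
        proof -
          have "(\<Sum>l\<in>insert l0 I. \<Sum>j<R. F j * u l j) = (\<Sum>j<R. F j * (\<Sum>l\<in>insert l0 I. u l j))"
            by (subst sum.swap) (simp add: sum_distrib_left)
          also have "\<dots> = 0" using zero by (intro sum.neutral) simp
          finally show ?thesis .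
        qed
        have "(\<Sum>j<R. N i j * (\<Sum>l\<in>I. v l j)) = (\<Sum>l\<in>I. \<Sum>j<R. N i j * v l j)"
          by (subst sum.swap) (simp add: sum_distrib_left)
        also have "\<dots> = (\<Sum>l\<in>insert l0 I. \<Sum>j<R. N i j * v l j)"
          using insert.hyps by (simp add: v_def)
        also have "\<dots> = (\<Sum>l\<in>insert l0 I. (\<Sum>j<R. T i j k * u l j) - \<mu> l0 k * (\<Sum>j<R. N i j * u l j))"
        proof (intro sum.cong refl)
          fix l assume "l \<in> insert l0 I"
          then have "(\<Sum>j<R. T i j k * u l j) = \<mu> l k * (\<Sum>j<R. N i j * u l j)" using eig k i by blast
          moreover have "(\<Sum>j<R. N i j * v l j) = (\<mu> l k - \<mu> l0 k) * (\<Sum>j<R. N i j * u l j)"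
            by (simp add: v_def sum_distrib_left mult_ac)
          ultimately show "(\<Sum>j<R. N i j * v l j)
              = (\<Sum>j<R. T i j k * u l j) - \<mu> l0 k * (\<Sum>j<R. N i j * u l j)"
            by (simp add: algebra_simps)
        qed
        also have "\<dots> = 0"
          unfolding sum_subtractf sum_distrib_left[symmetric] by (simp only: swap) simp
        finally show "(\<Sum>j<R. N i j * (\<Sum>l\<in>I. v l j)) = 0" .
      qed
    qed
    then show ?thesis using l j by (simp add: v_def)
  qed
  have I0: "u l j = 0" if l: "l \<in> I" and j: "j < R" for l j
  proof -
    have "l \<noteq> l0" using l insert.hyps by auto
    then obtain k where "k < K" "\<mu> l k \<noteq> \<mu> l0 k" using distinct[of l l0] l by blast
    then show ?thesis using kill[OF _ l j, of k] by simp
  qed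
  have "u l0 j = 0" if "j < R" for j using zero[OF that] insert.hyps I0 that by simp
  then show ?case using I0 by blast
qed simp

text \<open>The slice mix maps \<open>x\<close> to the value of the linear form at
  \<open>\<gamma>0\<close> times \<open>y\<close>; solving for \<open>y\<close> leaves an eigenvalue
  equation. The quotient is invariant under scaling of \<open>lam\<close>, so it depends only on the
  JGE value.\<close>

lemma jge_pair_eigen:
  fixes T :: "'a::field tensor3"
  assumes jge: "jge_pair R K T (vspan K {lam}) x" and lam: "lam \<in> carrier_vec K"
    and nz: "lin_form K lam \<gamma>0 \<noteq> 0" and k: "k < K" and i: "i < R"
  shows "(\<Sum>j<R. T i j k * x $ j) =
    lam $ k / lin_form K lam \<gamma>0 * (\<Sum>j<R. (\<Sum>k<K. \<gamma>0 $ k * T i j k) * x $ j)"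
proof -
  from jge obtain lam' y where lam': "lam' \<in> carrier_vec K" and sp: "vspan K {lam} = vspan K {lam'}"
    and eq: "\<And>l i. l < K \<Longrightarrow> i < R \<Longrightarrow> (\<Sum>j<R. T i j l * x $ j) = lam' $ l * y i"
    by (rule jge_pairE) blast
  have "lam' \<in> vspan K {lam}" using vspan_superset[of "{lam'}" K] lam' sp by auto
  then obtain c where c: "lam' = c \<cdot>\<^sub>v lam" using vspan_singleton[OF lam] by auto
  have eq': "(\<Sum>j<R. T i j l * x $ j) = lam $ l * (c * y i)" if "l < K" "i < R" for l i
    using eq[OF that] that lam by (simp add: c)
  have "(\<Sum>j<R. (\<Sum>k<K. \<gamma>0 $ k * T i j k) * x $ j) = lin_form K lam \<gamma>0 * (c * y i)"
    unfolding lin_form_def by (rule slice_comb_mult_jge[OF eq' i])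
  then show ?thesis using eq'[OF k i] nz by simp
qed

lemma vspan_eq_iff_proportional:
  fixes v w :: "'a::field vec"
  assumes v: "v \<in> carrier_vec n" and w: "w \<in> carrier_vec n" and w0: "w \<noteq> 0\<^sub>v n"
  shows "vspan n {w} = vspan n {v} \<longleftrightarrow> (\<exists>c. c \<noteq> 0 \<and> w = c \<cdot>\<^sub>v v)"
proof
  assume "vspan n {w} = vspan n {v}"
  then have "w \<in> vspan n {v}" using vspan_superset[of "{w}" n] w by auto
  then obtain c where c: "w = c \<cdot>\<^sub>v v" using vspan_singleton[OF v] by auto
  moreover have "c \<noteq> 0" using c w0 v by auto
  ultimately show "\<exists>c. c \<noteq> 0 \<and> w = c \<cdot>\<^sub>v v" by blast
qed (use v vspan_smult in auto)

lemma lin_form_smult: "v \<in> carrier_vec K \<Longrightarrow> lin_form K (c \<cdot>\<^sub>v v) \<gamma> = c * lin_form K v \<gamma>"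
  by (simp add: lin_form_def sum_distrib_left mult.assoc)

lemma jge_deficient_value:
  fixes T :: "'a::field tensor3"
  assumes nz: "char_poly_fun R K T \<gamma>0 \<noteq> 0"
    and l: "\<And>r. r < R \<Longrightarrow> l r \<in> carrier_vec K"
    and l0: "\<And>r. r < R \<Longrightarrow> lin_form K (l r) \<gamma>0 \<noteq> 0"
    and notspan: "vspan R {x. jge_vector R K T x} \<noteq> carrier_vec R"
  shows "\<exists>r<R. jge_gm R K T (vspan K {l r}) < card {s. s < R \<and> vspan K {l s} = vspan K {l r}}"
proof (rule ccontr)
  define L where "L r = vspan K {l r}" for r
  define cls where "cls v = {s. s < R \<and> L s = v}" for v
  assume "\<not> ?thesis"
  then have gm: "card (cls (L r)) \<le> vdim R {x. jge_pair R K T (L r) x}" if "r < R" for r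
    using that unfolding L_def cls_def jge_gm_def by force
  \<comment> \<open>If no value is deficient, each value \<open>v\<close> has enough independent JGE
    vectors to give one to every index in its class. Over all classes this makes \<open>R\<close>
    vectors.\<close>
  define P where "P v h \<longleftrightarrow> (\<forall>r\<in>cls v. h r \<in> {x. jge_pair R K T v x}) \<and>
    (\<forall>a. (\<forall>i<R. (\<Sum>r\<in>cls v. h r $ i * a r) = 0) \<longrightarrow> (\<forall>r\<in>cls v. a r = 0))" for v h
  have "\<exists>h. P v h" if "v \<in> L ` {..<R}" for v
    using vdim_independent_family[OF jge_vectors_carrier(2), of "cls v" R K T v] gm that
    unfolding P_def by (auto simp: cls_def)
  then have "\<exists>H. \<forall>v\<in>L ` {..<R}. P v (H v)" by (intro bchoice) blast
  then obtain H where H: "\<And>v. v \<in> L ` {..<R} \<Longrightarrow> P v (H v)" by blast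
  define z where "z r = H (L r) r" for r
  have zj: "jge_pair R K T (L r) (z r)" if "r < R" for r
    using H[of "L r"] that unfolding P_def z_def cls_def by auto
  let ?N = "\<lambda>i j. \<Sum>k<K. \<gamma>0 $ k * T i j k"
  have d: "det (mat R R (\<lambda>(i, j). ?N i j)) \<noteq> 0"
    using nz by (simp add: char_poly_fun_def slice_comb_def)
  \<comment> \<open>One linear form is fixed per value, so that \<open>\<mu>\<close> is a function
    of the value and not of the index.\<close>
  define rep where "rep v = inv_into {..<R} L v" for v
  have rep: "rep v < R" "L (rep v) = v" if "v \<in> L ` {..<R}" for v
    using inv_into_into[OF that] f_inv_into_f[OF that] unfolding rep_def by auto
  define \<mu> where "\<mu> v k = l (rep v) $ k / lin_form K (l (rep v)) \<gamma>0" for v k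
  have "vspan R {x. jge_vector R K T x} = carrier_vec R"
  proof (rule vspan_full_if_independent[OF jge_vectors_carrier(1), where z = z])
    show "z r \<in> {x. jge_vector R K T x}" if "r < R" for r
      using zj[OF that] by (auto simp: jge_vector_def)
    fix a assume zero: "\<And>i. i < R \<Longrightarrow> (\<Sum>r<R. z r $ i * a r) = 0"
    \<comment> \<open>The relation is grouped by JGE value. Independence across values kills each
      group, and independence inside a class then kills the coefficients.\<close>
    define u where "u v j = (\<Sum>r\<in>cls v. z r $ j * a r)" for v j
    have u0: "\<forall>v\<in>L ` {..<R}. \<forall>j<R. u v j = 0"
    proof (rule joint_eigenvectors_independent[where N = ?N and \<mu> = \<mu> and K = K and T = T])
      show "v j = 0" if "\<And>i. i < R \<Longrightarrow> (\<Sum>j<R. ?N i j * v j) = 0" "j < R" for v j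
        using det_nonzero_injective[OF d that] by simp
      show "\<exists>k<K. \<mu> v k \<noteq> \<mu> w k" if v: "v \<in> L ` {..<R}" and w: "w \<in> L ` {..<R}" and vw: "v \<noteq> w" for v w
      proof (rule ccontr)
        assume "\<not> ?thesis"
        then have eq: "\<mu> v k = \<mu> w k" if "k < K" for k using that by blast
        let ?c = "lin_form K (l (rep v)) \<gamma>0 / lin_form K (l (rep w)) \<gamma>0"
        have "l (rep v) $ k = ?c * l (rep w) $ k" if "k < K" for k
          using eq[OF that] l0[OF rep(1)[OF v]] l0[OF rep(1)[OF w]]
          unfolding \<mu>_def by (simp add: field_simps)
        then have "l (rep v) = ?c \<cdot>\<^sub>v l (rep w)"
          using l[OF rep(1)[OF v]] l[OF rep(1)[OF w]] by (intro eq_vecI) auto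
        then have "L (rep v) = L (rep w)"
          unfolding L_def
          using vspan_smult[OF l[OF rep(1)[OF w]], of ?c] l0[OF rep(1)[OF v]] l0[OF rep(1)[OF w]] by auto
        then show False using rep v w vw by simp
      qed
      show "(\<Sum>j<R. T i j k * u v j) = \<mu> v k * (\<Sum>j<R. ?N i j * u v j)"
        if v: "v \<in> L ` {..<R}" and k: "k < K" and i: "i < R" for v k i
      proof -
        have lin: "(\<Sum>j<R. F j * u v j) = (\<Sum>r\<in>cls v. (\<Sum>j<R. F j * z r $ j) * a r)" for F :: "nat \<Rightarrow> 'a"
          unfolding u_def sum_distrib_left sum_distrib_right by (subst sum.swap) (simp add: mult.assoc)
        have e: "(\<Sum>j<R. T i j k * z r $ j) = \<mu> v k * (\<Sum>j<R. ?N i j * z r $ j)" if "r \<in> cls v" for r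
        proof -
          have "jge_pair R K T (vspan K {l (rep v)}) (z r)"
            using zj[of r] that rep(2)[OF v] unfolding L_def cls_def by auto
          from jge_pair_eigen[OF this l[OF rep(1)[OF v]] l0[OF rep(1)[OF v]] k i]
          show ?thesis unfolding \<mu>_def .
        qed
        have "(\<Sum>r\<in>cls v. (\<Sum>j<R. T i j k * z r $ j) * a r)
            = (\<Sum>r\<in>cls v. \<mu> v k * ((\<Sum>j<R. ?N i j * z r $ j) * a r))"
          by (intro sum.cong refl) (simp only: e mult.assoc)
        then show ?thesis unfolding lin by (simp only: sum_distrib_left)
      qed
      show "(\<Sum>v\<in>L ` {..<R}. u v j) = 0" if "j < R" for j
      proof -
        have "(\<Sum>v\<in>L ` {..<R}. u v j) = (\<Sum>r<R. z r $ j * a r)"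
          unfolding u_def cls_def using sum.image_gen[of "{..<R}" "\<lambda>r. z r $ j * a r" L] by simp
        then show ?thesis using zero[OF that] by simp
      qed
    qed simp
    show "\<forall>r<R. a r = 0"
    proof (intro allI impI)
      fix r assume r: "r < R"
      have v: "L r \<in> L ` {..<R}" using r by simp
      have "(\<Sum>s\<in>cls (L r). H (L r) s $ i * a s) = 0" if "i < R" for i
      proof -
        have "(\<Sum>s\<in>cls (L r). H (L r) s $ i * a s) = u (L r) i"
          unfolding u_def by (intro sum.cong refl) (simp add: z_def cls_def)
        then show ?thesis using u0 v that by simp
      qed
      then have "\<forall>s\<in>cls (L r). a s = 0" using H[OF v] unfolding P_def by blast
      then show "a r = 0" using r by (simp add: cls_def)
    qed
  qed
  then show False using notspan by simp
qed

section \<open>The characteristic polynomial and its multiplicities\<close>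

text \<open>Different indices may carry the same exponents, while \<open>mpoly_fun\<close> sums over
  a set of exponents; so the coefficients of equal exponents are collected.\<close>

lemma mpoly_fun_indexed:
  fixes f :: "'a::comm_ring_1 vec \<Rightarrow> 'a"
  assumes X: "finite X"
    and f: "\<And>\<gamma>. \<gamma> \<in> carrier_vec K \<Longrightarrow> f \<gamma> = (\<Sum>x\<in>X. c x * (\<Prod>k<K. (\<gamma> $ k) ^ (e x k)))"
  shows "mpoly_fun K f"
  unfolding mpoly_fun_def
proof (intro exI conjI ballI)
  show "finite (e ` X)" using X by simp
  fix \<gamma> :: "'a vec" assume g: "\<gamma> \<in> carrier_vec K"
  have "f \<gamma> = (\<Sum>\<alpha>\<in>e ` X. \<Sum>x\<in>{x\<in>X. e x = \<alpha>}. c x * (\<Prod>k<K. (\<gamma> $ k) ^ (e x k)))"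
    unfolding f[OF g] by (rule sum.image_gen[OF X])
  also have "\<dots> = (\<Sum>\<alpha>\<in>e ` X. (\<Sum>x\<in>{x\<in>X. e x = \<alpha>}. c x) * (\<Prod>k<K. (\<gamma> $ k) ^ \<alpha> k))"
    by (intro sum.cong refl) (simp add: sum_distrib_right)
  finally show "f \<gamma> = (\<Sum>\<alpha>\<in>e ` X. (\<Sum>x\<in>{x\<in>X. e x = \<alpha>}. c x) * (\<Prod>k<K. (\<gamma> $ k) ^ \<alpha> k))" .
qed

lemma mpoly_fun_const: "mpoly_fun K (\<lambda>_. c)"
  by (rule mpoly_fun_indexed[of "{()}" _ _ "\<lambda>_. c" "\<lambda>_ _. 0"]) simp_all

lemma mpoly_fun_lin_form:
  fixes lam :: "'a::comm_ring_1 vec"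
  shows "mpoly_fun K (lin_form K lam)"
proof (rule mpoly_fun_indexed[of "{..<K}" _ _ "\<lambda>k. lam $ k" "\<lambda>x k. if k = x then 1 else 0"])
  fix \<gamma> :: "'a vec"
  have "(\<Prod>k<K. (\<gamma> $ k) ^ (if k = x then 1 else 0)) = \<gamma> $ x" if "x < K" for x
  proof -
    have "(\<Prod>k<K. (\<gamma> $ k) ^ (if k = x then 1 else 0)) = (\<Prod>k<K. if k = x then \<gamma> $ k else 1)"
      by (intro prod.cong) auto
    then show ?thesis using that by simp
  qed
  then show "lin_form K lam \<gamma> = (\<Sum>x<K. lam $ x * (\<Prod>k<K. (\<gamma> $ k) ^ (if k = x then 1 else 0)))"
    by (simp add: lin_form_def)
qed simp

lemma mpoly_fun_mult:
  fixes f g :: "'a::comm_ring_1 vec \<Rightarrow> 'a"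
  assumes "mpoly_fun K f" "mpoly_fun K g"
  shows "mpoly_fun K (\<lambda>\<gamma>. f \<gamma> * g \<gamma>)"
proof -
  obtain S c where S: "finite S"
    and f: "\<forall>\<gamma>\<in>carrier_vec K. f \<gamma> = (\<Sum>\<alpha>\<in>S. c \<alpha> * (\<Prod>k<K. (\<gamma> $ k) ^ \<alpha> k))"
    using assms(1) unfolding mpoly_fun_def by blast
  obtain S' c' where S': "finite S'"
    and g: "\<forall>\<gamma>\<in>carrier_vec K. g \<gamma> = (\<Sum>\<alpha>\<in>S'. c' \<alpha> * (\<Prod>k<K. (\<gamma> $ k) ^ \<alpha> k))"
    using assms(2) unfolding mpoly_fun_def by blast
  show ?thesis
  proof (rule mpoly_fun_indexed[of "S \<times> S'" _ _ "\<lambda>(\<alpha>, \<beta>). c \<alpha> * c' \<beta>" "\<lambda>(\<alpha>, \<beta>) k. \<alpha> k + \<beta> k"])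
    fix \<gamma> :: "'a vec" assume "\<gamma> \<in> carrier_vec K"
    then have "f \<gamma> * g \<gamma> = (\<Sum>\<alpha>\<in>S. \<Sum>\<beta>\<in>S'. (c \<alpha> * (\<Prod>k<K. (\<gamma> $ k) ^ \<alpha> k)) * (c' \<beta> * (\<Prod>k<K. (\<gamma> $ k) ^ \<beta> k)))"
      using f g by (simp add: sum_product)
    also have "\<dots> = (\<Sum>\<alpha>\<in>S. \<Sum>\<beta>\<in>S'. c \<alpha> * c' \<beta> * (\<Prod>k<K. (\<gamma> $ k) ^ (\<alpha> k + \<beta> k)))"
      by (intro sum.cong refl) (simp add: power_add prod.distrib mult_ac)
    finally show "f \<gamma> * g \<gamma> = (\<Sum>x\<in>S \<times> S'. (case x of (\<alpha>, \<beta>) \<Rightarrow> c \<alpha> * c' \<beta>) *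
        (\<Prod>k<K. (\<gamma> $ k) ^ (case x of (\<alpha>, \<beta>) \<Rightarrow> \<lambda>k. \<alpha> k + \<beta> k) k))"
      by (simp add: sum.cartesian_product split_def)
  qed (use S S' in simp)
qed

lemma mpoly_fun_prod:
  fixes f :: "'b \<Rightarrow> 'a::comm_ring_1 vec \<Rightarrow> 'a"
  assumes "finite A" "\<And>a. a \<in> A \<Longrightarrow> mpoly_fun K (f a)"
  shows "mpoly_fun K (\<lambda>\<gamma>. \<Prod>a\<in>A. f a \<gamma>)"
  using assms by (induction A) (auto intro: mpoly_fun_const mpoly_fun_mult)

section \<open>Restriction to lines\<close>

lemma mpoly_fun_on_line:
  fixes f :: "'a::comm_ring_1 vec \<Rightarrow> 'a"
  assumes "mpoly_fun K f" and v: "\<gamma>0 \<in> carrier_vec K" "m \<in> carrier_vec K"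
  shows "\<exists>Q. \<forall>t. f (\<gamma>0 + t \<cdot>\<^sub>v m) = poly Q t"
proof -
  obtain S c where S: "finite S"
    and f: "\<forall>\<gamma>\<in>carrier_vec K. f \<gamma> = (\<Sum>\<alpha>\<in>S. c \<alpha> * (\<Prod>k<K. (\<gamma> $ k) ^ \<alpha> k))"
    using assms(1) unfolding mpoly_fun_def by blast
  have "f (\<gamma>0 + t \<cdot>\<^sub>v m) = poly (\<Sum>\<alpha>\<in>S. [:c \<alpha>:] * (\<Prod>k<K. [:\<gamma>0 $ k, m $ k:] ^ \<alpha> k)) t" for t
  proof -
    have "f (\<gamma>0 + t \<cdot>\<^sub>v m) = (\<Sum>\<alpha>\<in>S. c \<alpha> * (\<Prod>k<K. ((\<gamma>0 + t \<cdot>\<^sub>v m) $ k) ^ \<alpha> k))"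
      using f v by auto
    also have "\<dots> = (\<Sum>\<alpha>\<in>S. c \<alpha> * (\<Prod>k<K. (\<gamma>0 $ k + t * m $ k) ^ \<alpha> k))"
      using v by (intro sum.cong refl arg_cong2[of _ _ _ _ times] prod.cong) simp
    finally show ?thesis by (simp add: poly_sum poly_prod)
  qed
  then show ?thesis by blast
qed

lemma lin_form_on_line:
  assumes "\<gamma>0 \<in> carrier_vec K" "m \<in> carrier_vec K"
  shows "lin_form K v (\<gamma>0 + t \<cdot>\<^sub>v m) = poly [:lin_form K v \<gamma>0, lin_form K v m:] t"
proof -
  have "lin_form K v (\<gamma>0 + t \<cdot>\<^sub>v m) = (\<Sum>k<K. v $ k * \<gamma>0 $ k + t * (v $ k * m $ k))"
    unfolding lin_form_def using assms by (intro sum.cong refl) (simp add: algebra_simps)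
  then show ?thesis by (simp add: lin_form_def sum.distrib sum_distrib_left)
qed

text \<open>On a line, divisibility becomes that of univariate polynomials, where degrees and roots
  are available. In characteristic zero the identity of functions is an identity of
  polynomials.\<close>

lemma lin_pow_dvd_char_on_line:
  fixes T :: "'a::field_char_0 tensor3"
  assumes dvd: "lin_pow_dvd_char R K T lam n" and v: "\<gamma>0 \<in> carrier_vec K" "m \<in> carrier_vec K"
    and P: "\<And>t. char_poly_fun R K T (\<gamma>0 + t \<cdot>\<^sub>v m) = poly P t"
  shows "[:lin_form K lam \<gamma>0, lin_form K lam m:] ^ n dvd P"
proof -
  obtain q where q: "mpoly_fun K q"
    and eq: "\<forall>\<gamma>\<in>carrier_vec K. char_poly_fun R K T \<gamma> = lin_form K lam \<gamma> ^ n * q \<gamma>"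
    using dvd unfolding lin_pow_dvd_char_def by blast
  obtain Q where Q: "\<forall>t. q (\<gamma>0 + t \<cdot>\<^sub>v m) = poly Q t" using mpoly_fun_on_line[OF q v] by blast
  have "poly P t = poly ([:lin_form K lam \<gamma>0, lin_form K lam m:] ^ n * Q) t" for t
  proof -
    have "\<gamma>0 + t \<cdot>\<^sub>v m \<in> carrier_vec K" using v by simp
    then have "poly P t = lin_form K lam (\<gamma>0 + t \<cdot>\<^sub>v m) ^ n * q (\<gamma>0 + t \<cdot>\<^sub>v m)" using eq P by metis
    then show ?thesis unfolding lin_form_on_line[OF v] using Q by simp
  qed
  then have "P = [:lin_form K lam \<gamma>0, lin_form K lam m:] ^ n * Q"
    by (intro poly_eq_poly_eq_iff[THEN iffD1] ext)
  then show ?thesis by simp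
qed

lemma char_factors_on_line:
  fixes T :: "'a::field tensor3"
  assumes fac: "\<And>\<gamma>. \<gamma> \<in> carrier_vec K \<Longrightarrow> char_poly_fun R K T \<gamma> = d * (\<Prod>r<R. lin_form K (l r) \<gamma>)"
    and v: "\<gamma>0 \<in> carrier_vec K" "m \<in> carrier_vec K"
  shows "char_poly_fun R K T (\<gamma>0 + t \<cdot>\<^sub>v m)
    = poly ([:d:] * (\<Prod>r<R. [:lin_form K (l r) \<gamma>0, lin_form K (l r) m:])) t"
proof -
  have "\<gamma>0 + t \<cdot>\<^sub>v m \<in> carrier_vec K" using v by simp
  then show ?thesis by (simp add: fac lin_form_on_line[OF v] poly_prod)
qed

lemma lin_form_unit_vec: "k < K \<Longrightarrow> lin_form K v (unit_vec K k) = v $ k"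
proof -
  assume k: "k < K"
  have "lin_form K v (unit_vec K k) = (\<Sum>i<K. if i = k then v $ i else 0)"
    unfolding lin_form_def using k by (intro sum.cong) auto
  then show ?thesis using k by simp
qed

text \<open>This bound makes the \<open>GREATEST\<close> in \<open>jge_am\<close> meaningful. On the
  line through \<open>\<gamma>0\<close> in a coordinate direction with
  \<open>lam $ k \<noteq> 0\<close> the form has degree exactly one, whereas the characteristic
  polynomial becomes a nonzero polynomial of degree at most \<open>R\<close>.\<close>

lemma lin_pow_dvd_char_le:
  fixes T :: "'a::field_char_0 tensor3"
  assumes fac: "\<And>\<gamma>. \<gamma> \<in> carrier_vec K \<Longrightarrow> char_poly_fun R K T \<gamma> = d * (\<Prod>r<R. lin_form K (l r) \<gamma>)"
    and g: "\<gamma>0 \<in> carrier_vec K" "char_poly_fun R K T \<gamma>0 \<noteq> 0"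
    and lam: "lam \<in> carrier_vec K" "lam \<noteq> 0\<^sub>v K" and dvd: "lin_pow_dvd_char R K T lam n"
  shows "n \<le> R"
proof -
  obtain k where k: "k < K" "lam $ k \<noteq> 0" using lam vec_eq_zero_iff by blast
  have m: "unit_vec K k \<in> carrier_vec K" by simp
  let ?P = "[:d:] * (\<Prod>r<R. [:lin_form K (l r) \<gamma>0, lin_form K (l r) (unit_vec K k):])"
  note P = char_factors_on_line[OF fac g(1) m]
  have "\<gamma>0 + 0 \<cdot>\<^sub>v unit_vec K k = \<gamma>0" using g(1) by auto
  then have "poly ?P 0 \<noteq> 0" using P[of 0] g(2) by simp
  then have P0: "?P \<noteq> 0" by (metis poly_0)
  have "[:lin_form K lam \<gamma>0, lin_form K lam (unit_vec K k):] ^ n dvd ?P"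
    by (rule lin_pow_dvd_char_on_line[OF dvd g(1) m P])
  then have "degree ([:lin_form K lam \<gamma>0, lin_form K lam (unit_vec K k):] ^ n) \<le> degree ?P"
    using P0 by (rule dvd_imp_degree_le)
  also have "degree ([:lin_form K lam \<gamma>0, lin_form K lam (unit_vec K k):] ^ n) = n"
    using k by (simp add: degree_power_eq lin_form_unit_vec)
  also have "degree ?P \<le> degree [:d:] + degree (\<Prod>r<R. [:lin_form K (l r) \<gamma>0, lin_form K (l r) (unit_vec K k):])"
    by (rule degree_mult_le)
  also have "\<dots> \<le> (\<Sum>r<R. degree [:lin_form K (l r) \<gamma>0, lin_form K (l r) (unit_vec K k):])"
    using degree_prod_sum_le[of "{..<R}" "\<lambda>r. [:lin_form K (l r) \<gamma>0, lin_form K (l r) (unit_vec K k):]"]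
    by (simp add: o_def)
  also have "\<dots> \<le> (\<Sum>r<R. 1)" by (intro sum_mono) simp
  also have "\<dots> = R" by simp
  finally show ?thesis .
qed

lemma lin_pow_dvd_char_factors:
  fixes T :: "'a::field tensor3"
  assumes fac: "\<And>\<gamma>. \<gamma> \<in> carrier_vec K \<Longrightarrow> char_poly_fun R K T \<gamma> = d * (\<Prod>r<R. lin_form K (l r) \<gamma>)"
    and l: "\<And>r. r < R \<Longrightarrow> l r \<in> carrier_vec K" "\<And>r. r < R \<Longrightarrow> l r \<noteq> 0\<^sub>v K" and r: "r < R"
  shows "lin_pow_dvd_char R K T (l r) (card {s. s < R \<and> vspan K {l s} = vspan K {l r}})"
proof -
  let ?C = "{s. s < R \<and> vspan K {l s} = vspan K {l r}}"
  have "\<forall>s\<in>?C. \<exists>c. l s = c \<cdot>\<^sub>v l r"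
    using vspan_eq_iff_proportional[OF l(1)[OF r] l(1) l(2)] by blast
  then obtain c where c: "\<And>s. s \<in> ?C \<Longrightarrow> l s = c s \<cdot>\<^sub>v l r" by metis
  let ?q = "\<lambda>\<gamma>. d * (\<Prod>s\<in>?C. c s) * (\<Prod>s\<in>{..<R} - ?C. lin_form K (l s) \<gamma>)"
  have "mpoly_fun K ?q"
    by (intro mpoly_fun_mult mpoly_fun_const mpoly_fun_prod mpoly_fun_lin_form) simp
  moreover have "char_poly_fun R K T \<gamma> = lin_form K (l r) \<gamma> ^ card ?C * ?q \<gamma>" if "\<gamma> \<in> carrier_vec K" for \<gamma>
  proof -
    have "(\<Prod>s<R. lin_form K (l s) \<gamma>) = (\<Prod>s\<in>{..<R} - ?C. lin_form K (l s) \<gamma>) * (\<Prod>s\<in>?C. lin_form K (l s) \<gamma>)"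
      by (rule prod.subset_diff) auto
    also have "(\<Prod>s\<in>?C. lin_form K (l s) \<gamma>) = (\<Prod>s\<in>?C. c s * lin_form K (l r) \<gamma>)"
      by (intro prod.cong refl) (subst c, simp, rule lin_form_smult[OF l(1)[OF r]])
    also have "\<dots> = (\<Prod>s\<in>?C. c s) * lin_form K (l r) \<gamma> ^ card ?C"
      by (simp add: prod.distrib)
    finally show ?thesis using fac[OF that] by (simp add: mult_ac)
  qed
  ultimately show ?thesis unfolding lin_pow_dvd_char_def by blast
qed

text \<open>The witness lies on the moment curve \<open>(1, t, t^2, ...)\<close>: each
  \<open>w\<close> restricts to a nonzero polynomial in \<open>t\<close>, and finitely many such
  polynomials have finitely many roots.\<close>

lemma avoid_hyperplanes:
  fixes W :: "(nat \<Rightarrow> 'a::field_char_0) set"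
  assumes "finite W" and "\<And>w. w \<in> W \<Longrightarrow> \<exists>k<K. w k \<noteq> 0"
  shows "\<exists>m. \<forall>w\<in>W. (\<Sum>k<K. w k * m k) \<noteq> 0"
proof -
  define p where "p w = (\<Sum>k<K. monom (w k) k)" for w :: "nat \<Rightarrow> 'a"
  have "p w \<noteq> 0" if w: "w \<in> W" for w
  proof
    assume "p w = 0"
    obtain k where k: "k < K" "w k \<noteq> 0" using assms(2)[OF w] by blast
    have "coeff (p w) k = w k" using k(1) by (simp add: p_def coeff_sum)
    then show False using \<open>p w = 0\<close> k by simp
  qed
  then have "(\<Prod>w\<in>W. p w) \<noteq> 0" using assms(1) by simp
  then have "finite {t. poly (\<Prod>w\<in>W. p w) t = 0}" by (rule poly_roots_finite)
  then have "\<exists>t. poly (\<Prod>w\<in>W. p w) t \<noteq> 0"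
    using infinite_UNIV_char_0[where 'a = 'a] by (metis (mono_tags, lifting) Collect_cong UNIV_def)
  then obtain t where "poly (\<Prod>w\<in>W. p w) t \<noteq> 0" by blast
  then have "\<forall>w\<in>W. poly (p w) t \<noteq> 0" using assms(1) by (auto simp: poly_prod)
  moreover have "poly (p w) t = (\<Sum>k<K. w k * t ^ k)" for w
    by (simp add: p_def poly_sum poly_monom)
  ultimately show ?thesis by (intro exI[of _ "\<lambda>k. t ^ k"]) simp
qed

text \<open>On a generic line through a point where the characteristic polynomial does not vanish, its
  pairwise non-proportional linear factors have pairwise distinct roots.\<close>

lemma simple_tensor_no_square_factor:
  fixes T :: "'a::field_char_0 tensor3"
  assumes simple: "simple_tensor R K T" and lam: "lam \<in> carrier_vec K" "lam \<noteq> 0\<^sub>v K"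
    and dvd: "lin_pow_dvd_char R K T lam n"
  shows "n < 2"
proof (rule ccontr)
  assume "\<not> n < 2"
  then have n2: "2 \<le> n" by simp
  obtain l where lR: "\<forall>r<R. l r \<in> carrier_vec K"
    and npR: "\<forall>r<R. \<forall>s<R. r \<noteq> s \<longrightarrow> \<not> (\<exists>c. l r = c \<cdot>\<^sub>v l s)"
    and facR: "\<forall>\<gamma>\<in>carrier_vec K. char_poly_fun R K T \<gamma> = (\<Prod>r<R. lin_form K (l r) \<gamma>)"
    and smi: "slice_mix_invertible R K T"
    using simple unfolding simple_tensor_def by blast
  have l: "l r \<in> carrier_vec K" if "r < R" for r using lR that by blast
  have np: "\<not> (\<exists>c. l r = c \<cdot>\<^sub>v l s)" if "r < R" "s < R" "r \<noteq> s" for r s using npR that by blast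
  have fac: "char_poly_fun R K T \<gamma> = 1 * (\<Prod>r<R. lin_form K (l r) \<gamma>)" if "\<gamma> \<in> carrier_vec K" for \<gamma>
    using facR that by simp
  obtain \<gamma>0 where g: "\<gamma>0 \<in> carrier_vec K" and inv: "invertible_mat (slice_comb R K T \<gamma>0)"
    using smi unfolding slice_mix_invertible_def by blast
  have nz: "char_poly_fun R K T \<gamma>0 \<noteq> 0"
    unfolding char_poly_fun_def
    by (rule invertible_mat_imp_det_nonzero[OF _ inv, of R]) (simp add: slice_comb_def)
  define \<alpha> where "\<alpha> r = lin_form K (l r) \<gamma>0" for r
  have \<alpha>0: "\<alpha> r \<noteq> 0" if "r < R" for r
    using nz fac[OF g] that by (auto simp: \<alpha>_def)
  \<comment> \<open>Paired with a direction \<open>m\<close>, this is the determinant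
    \<open>\<alpha> i * \<beta> j - \<alpha> j * \<beta> i\<close>; when it is nonzero, the forms
    \<open>i\<close> and \<open>j\<close> have no common root on the line. Including
    \<open>lam\<close> in \<open>W\<close> keeps its form nonconstant there.\<close>
  define w where "w i j k = \<alpha> i * l j $ k - \<alpha> j * l i $ k" for i j k
  define W where "W = insert (\<lambda>k. lam $ k) ((\<lambda>(i, j). w i j) ` {(i, j). i < R \<and> j < R \<and> i \<noteq> j})"
  have "finite W"
  proof -
    have "finite {(i, j). i < R \<and> j < R \<and> i \<noteq> j}"
      by (rule finite_subset[of _ "{..<R} \<times> {..<R}"]) auto
    then show ?thesis by (simp add: W_def)
  qed
  moreover have "\<exists>k<K. v k \<noteq> 0" if vW: "v \<in> W" for v
  proof (cases "v = (\<lambda>k. lam $ k)")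
    case True
    then show ?thesis using lam vec_eq_zero_iff by blast
  next
    case False
    then obtain i j where ij: "i < R" "j < R" "i \<noteq> j" and v: "v = w i j"
      using vW by (auto simp: W_def)
    show ?thesis
    proof (rule ccontr)
      assume "\<not> ?thesis"
      then have "l j $ k = \<alpha> j / \<alpha> i * l i $ k" if "k < K" for k
        using that \<alpha>0[OF ij(1)] unfolding v w_def by (simp add: field_simps)
      then have "l j = (\<alpha> j / \<alpha> i) \<cdot>\<^sub>v l i"
        using l[OF ij(1)] l[OF ij(2)] by (intro eq_vecI) auto
      then show False using np ij by blast
    qed
  qed
  ultimately obtain m' where m': "\<forall>v\<in>W. (\<Sum>k<K. v k * m' k) \<noteq> 0"
    using avoid_hyperplanes[of W K] by blast
  define m where "m = vec K m'"
  have m: "m \<in> carrier_vec K" by (simp add: m_def)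
  define \<beta> where "\<beta> r = lin_form K (l r) m" for r
  define a b where "a = lin_form K lam \<gamma>0" and "b = lin_form K lam m"
  have b0: "b \<noteq> 0" using m' by (simp add: b_def lin_form_def m_def W_def)
  have w0: "\<alpha> i * \<beta> j - \<alpha> j * \<beta> i \<noteq> 0" if "i < R" "j < R" "i \<noteq> j" for i j
  proof -
    have "(\<Sum>k<K. w i j k * m' k) \<noteq> 0" using m' that by (auto simp: W_def)
    moreover have "(\<Sum>k<K. w i j k * m' k) = \<alpha> i * \<beta> j - \<alpha> j * \<beta> i"
      by (simp add: w_def \<beta>_def lin_form_def m_def sum_distrib_left sum_subtractf algebra_simps)
    ultimately show ?thesis by simp
  qed
  let ?P = "\<Prod>r<R. [:\<alpha> r, \<beta> r:]"
  have P: "char_poly_fun R K T (\<gamma>0 + t \<cdot>\<^sub>v m) = poly ?P t" for t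
    using char_factors_on_line[OF fac g m, of t] by (simp add: \<alpha>_def \<beta>_def)
  have "[:a, b:] ^ n dvd ?P"
    using lin_pow_dvd_char_on_line[OF dvd g m P] by (simp add: a_def b_def)
  then have "[:a, b:] ^ 2 dvd ?P" using n2 le_imp_power_dvd dvd_trans by blast
  then obtain Q where Q: "?P = [:a, b:] ^ 2 * Q" by (auto simp: dvd_def)
  \<comment> \<open>At the root \<open>t\<close> of the squared factor some form \<open>i\<close>
    vanishes and absorbs one copy of that factor. The remaining copy makes a second form
    \<open>j\<close> vanish at the same \<open>t\<close>.\<close>
  define t where "t = - a / b"
  have t: "poly [:a, b:] t = 0" using b0 by (simp add: t_def)
  then have "poly ?P t = 0" unfolding Q by simp
  then obtain i where i: "i < R" "\<alpha> i + t * \<beta> i = 0" by (auto simp: poly_prod)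
  have bi: "\<beta> i \<noteq> 0" using i \<alpha>0 by auto
  have lin: "[:\<alpha> i, \<beta> i:] = [:\<beta> i / b:] * [:a, b:]"
    using i b0 by (simp add: t_def field_simps add_eq_0_iff2)
  have "?P = [:\<alpha> i, \<beta> i:] * (\<Prod>r\<in>{..<R} - {i}. [:\<alpha> r, \<beta> r:])"
    using i by (subst prod.remove[of _ i]) auto
  then have cancel: "[:a, b:] * ([:\<beta> i / b:] * (\<Prod>r\<in>{..<R} - {i}. [:\<alpha> r, \<beta> r:])) = [:a, b:] * ([:a, b:] * Q)"
    unfolding Q lin by (simp only: power2_eq_square mult_ac)
  have ab0: "[:a, b:] \<noteq> 0" using b0 by simp
  have "[:\<beta> i / b:] * (\<Prod>r\<in>{..<R} - {i}. [:\<alpha> r, \<beta> r:]) = [:a, b:] * Q"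
    using cancel unfolding mult_left_cancel[OF ab0] .
  then have "poly ([:\<beta> i / b:] * (\<Prod>r\<in>{..<R} - {i}. [:\<alpha> r, \<beta> r:])) t = poly [:a, b:] t * poly Q t"
    by (simp only: poly_mult)
  then have "poly ([:\<beta> i / b:] * (\<Prod>r\<in>{..<R} - {i}. [:\<alpha> r, \<beta> r:])) t = 0"
    unfolding t by simp
  then obtain j where j: "j < R" "j \<noteq> i" "\<alpha> j + t * \<beta> j = 0"
    using bi b0 by (auto simp: poly_prod)
  have ai: "\<alpha> i = - (t * \<beta> i)" and aj: "\<alpha> j = - (t * \<beta> j)"
    using i(2) j(3) by (simp_all add: eq_neg_iff_add_eq_0)
  have "\<alpha> i * \<beta> j - \<alpha> j * \<beta> i = 0" unfolding ai aj by simp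
  then show False using w0[of i j] i j by simp
qed

section \<open>Border rank\<close>

lemma border_rank_sequence:
  fixes Tp :: "'a::{comm_ring_1, real_normed_vector} tensor3"
  assumes "tensor3_in I1 I2 I3 Tp"
  shows "\<exists>S. (\<forall>n. has_cpd I1 I2 I3 (S n) (border_rank I1 I2 I3 Tp)) \<and>
    (\<forall>i j k. (\<lambda>n. S n i j k) \<longlonglongrightarrow> Tp i j k)"
proof -
  let ?Q = "\<lambda>R. \<exists>S :: nat \<Rightarrow> 'a tensor3.
      (\<forall>n. tensor3_in I1 I2 I3 (S n) \<and> tensor_rank I1 I2 I3 (S n) \<le> R) \<and>
      (\<forall>i j k. (\<lambda>n. S n i j k) \<longlonglongrightarrow> Tp i j k)"
  \<comment> \<open>The constant sequence shows that the \<open>LEAST\<close> is taken over a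
    nonempty set.\<close>
  have "?Q (tensor_rank I1 I2 I3 Tp)" using assms by (intro exI[of _ "\<lambda>_. Tp"]) auto
  then have "?Q (border_rank I1 I2 I3 Tp)" unfolding border_rank_def by (rule LeastI)
  then show ?thesis using tensor_rank_le_iff by blast
qed

text \<open>All approximants are compressed with the matrices of the limit \<open>Tp\<close>. This
  is one fixed linear map, hence continuous, and it does not lengthen decompositions.\<close>

lemma border_rank_compression_limit:
  fixes Tp T :: "'a::{conjugatable_field, real_normed_field} tensor3"
  assumes comp: "tensor_compression I1 I2 I3 R1 R2 R3 Tp T V1 V2 V3"
    and Tp: "tensor3_in I1 I2 I3 Tp"
  shows "\<exists>S. (\<forall>n. has_cpd R1 R2 R3 (S n) (border_rank I1 I2 I3 Tp)) \<and>
    (\<forall>a<R1. \<forall>b<R2. \<forall>c<R3. (\<lambda>n. S n a b c) \<longlonglongrightarrow> T a b c)"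
proof -
  interpret tensor_compression I1 I2 I3 R1 R2 R3 Tp T V1 V2 V3 by (rule comp)
  obtain S where S: "\<forall>n. has_cpd I1 I2 I3 (S n) (border_rank I1 I2 I3 Tp)"
    and lim: "\<forall>i j k. (\<lambda>n. S n i j k) \<longlonglongrightarrow> Tp i j k"
    using border_rank_sequence[OF Tp] by blast
  let ?S = "\<lambda>n. mode_products I1 I2 I3 cnj1 cnj2 cnj3 (S n)"
  have "(\<lambda>n. ?S n a b c) \<longlonglongrightarrow> T a b c" if "a < R1" "b < R2" "c < R3" for a b c
    unfolding T_mode_products[OF that] mode_products_def
    using lim by (intro tendsto_sum tendsto_mult tendsto_const) blast
  then show ?thesis using has_cpd_mode_products S by (intro exI[of _ ?S]) blast
qed

text \<open>Common source of (2) and (3). The last conjunct records that the algebraic multiplicity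
  is attained by an actual divisor, which is what simplicity contradicts.\<close>

lemma border_rank_jge:
  fixes Tp T :: "'a::{conjugatable_field, real_normed_field} tensor3"
  assumes conj_std: "\<And>x::'a. conjugate x * x = of_real ((norm x)\<^sup>2)"
    and comp: "tensor_compression I1 I2 I3 R R K Tp T V1 V2 V3"
    and Tp: "tensor3_in I1 I2 I3 Tp" and border: "border_rank I1 I2 I3 Tp = R"
    and smi: "slice_mix_invertible R K T" and not_cpd: "\<not> has_cpd R R K T R"
  shows "\<exists>L. jge_value R K T L \<and> jge_gm R K T L \<ge> 1 \<and> jge_am R K T L > jge_gm R K T L \<and>
    (\<exists>lam. lam \<in> carrier_vec K \<and> lam \<noteq> 0\<^sub>v K \<and> lin_pow_dvd_char R K T lam (jge_am R K T L))"
proof -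
  obtain \<gamma>0 where g: "\<gamma>0 \<in> carrier_vec K" and inv: "invertible_mat (slice_comb R K T \<gamma>0)"
    using smi unfolding slice_mix_invertible_def by blast
  have nz: "char_poly_fun R K T \<gamma>0 \<noteq> 0"
    unfolding char_poly_fun_def
    by (rule invertible_mat_imp_det_nonzero[OF _ inv, of R]) (simp add: slice_comb_def)
  obtain S where S: "\<forall>n. has_cpd R R K (S n) R"
    and lim: "\<forall>a<R. \<forall>b<R. \<forall>c<K. (\<lambda>n. S n a b c) \<longlonglongrightarrow> T a b c"
    using border_rank_compression_limit[OF comp Tp] unfolding border by blast
  obtain lam x y where
    pairs: "\<forall>r<R. (\<exists>j<R. x r j \<noteq> 0) \<and> (\<exists>i<R. y r i \<noteq> 0) \<and> (\<Sum>k<K. lam r k * \<gamma>0 $ k) \<noteq> 0 \<and>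
      (\<forall>k<K. \<forall>i<R. (\<Sum>j<R. T i j k * x r j) = lam r k * y r i)" and
    factors: "\<forall>\<gamma>. char_poly_fun R K T \<gamma> * (\<Prod>r<R. \<Sum>k<K. lam r k * \<gamma>0 $ k)
       = char_poly_fun R K T \<gamma>0 * (\<Prod>r<R. \<Sum>k<K. lam r k * \<gamma> $ k)"
    using limit_of_cpds_jge[OF conj_std, of R K S T \<gamma>0] S lim nz by blast
  define l where "l r = vec K (lam r)" for r
  have lf: "lin_form K (l r) \<gamma> = (\<Sum>k<K. lam r k * \<gamma> $ k)" for r \<gamma>
    by (simp add: lin_form_def l_def)
  have l: "l r \<in> carrier_vec K" for r by (simp add: l_def)
  have l0: "lin_form K (l r) \<gamma>0 \<noteq> 0" if "r < R" for r using pairs that by (simp add: lf)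
  have lnz: "l r \<noteq> 0\<^sub>v K" if "r < R" for r using l0[OF that] by (auto simp: lin_form_def)
  \<comment> \<open>The cross-multiplied identity can be divided here, since no limiting form
    vanishes at \<open>\<gamma>0\<close>.\<close>
  define d where "d = char_poly_fun R K T \<gamma>0 / (\<Prod>r<R. lin_form K (l r) \<gamma>0)"
  have fac: "char_poly_fun R K T \<gamma> = d * (\<Prod>r<R. lin_form K (l r) \<gamma>)" for \<gamma>
  proof -
    have "(\<Prod>r<R. lin_form K (l r) \<gamma>0) \<noteq> 0" using l0 by simp
    then show ?thesis using factors by (simp add: d_def lf field_simps)
  qed
  have notspan: "vspan R {x. jge_vector R K T x} \<noteq> carrier_vec R"
    using not_cpd jge_span_imp_has_cpd by blast
  have "\<exists>r<R. jge_gm R K T (vspan K {l r}) < card {s. s < R \<and> vspan K {l s} = vspan K {l r}}"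
    by (rule jge_deficient_value[OF nz]) (use l l0 notspan in auto)
  then obtain r where r: "r < R" and
    def: "jge_gm R K T (vspan K {l r}) < card {s. s < R \<and> vspan K {l s} = vspan K {l r}}"
    by blast
  let ?L = "vspan K {l r}"
  let ?m = "card {s. s < R \<and> vspan K {l s} = ?L}"
  let ?D = "\<lambda>m. \<exists>lam. lam \<in> carrier_vec K \<and> lam \<noteq> 0\<^sub>v K \<and> ?L = vspan K {lam} \<and> lin_pow_dvd_char R K T lam m"
  have pair: "jge_pair R K T ?L (vec R (x r))"
    unfolding l_def using pairs r by (intro jge_pairI[where y = "y r"]) auto
  have gm: "jge_gm R K T ?L \<ge> 1"
    unfolding jge_gm_def
    by (rule vdim_pos[OF jge_vectors_carrier(2), of "vec R (x r)"])
      (use pair in \<open>auto simp: jge_pair_def\<close>)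
  have "lin_pow_dvd_char R K T (l r) ?m"
    by (rule lin_pow_dvd_char_factors[where d = d and l = l]) (rule fac, rule l, erule lnz, rule r)
  then have D: "?D ?m" using l lnz[OF r] by blast
  have bound: "m \<le> R" if Dm: "?D m" for m
  proof -
    obtain v where v: "v \<in> carrier_vec K" "v \<noteq> 0\<^sub>v K" "lin_pow_dvd_char R K T v m"
      using Dm by blast
    show ?thesis by (rule lin_pow_dvd_char_le[OF _ g nz v, where d = d and l = l]) (rule fac)
  qed
  have am_ge: "?m \<le> jge_am R K T ?L"
    unfolding jge_am_def by (rule Greatest_le_nat[of ?D, OF D bound])
  have am_D: "?D (jge_am R K T ?L)"
    unfolding jge_am_def by (rule GreatestI_nat[of ?D, OF D bound])
  have "jge_value R K T ?L" using pair by (auto simp: jge_value_def)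
  moreover have "jge_gm R K T ?L < jge_am R K T ?L" using def am_ge by simp
  ultimately show ?thesis using gm am_D by blast
qed

theorem theorem2p3:
  fixes I1 I2 I3 R K :: nat
    and Tp T :: "'a::{conjugatable_field, real_normed_field} tensor3"
  assumes conj_std: "\<And>x::'a. conjugate x * x = of_real ((norm x)\<^sup>2)"
    and Tp_in: "tensor3_in I1 I2 I3 Tp"
    and mlr: "mlrank I1 I2 I3 Tp = (R, R, K)"
    and comp: "orth_compression I1 I2 I3 R R K Tp T"
  shows
    "(tensor_rank I1 I2 I3 Tp = R \<longleftrightarrow> vspan R {x. jge_vector R K T x} = carrier_vec R)
     \<and> (\<forall>A B C. is_decomp R R K T R A B C \<and> tensor_rank R R K T = R \<longrightarrow>
           {L. jge_value R K T L} = {vspan K {col C r} | r. r < R} \<and>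
           invertible_mat B \<and>
           (\<forall>X \<in> carrier_mat R R. transpose_mat B * X = 1\<^sub>m R \<longrightarrow>
              (\<forall>r<R. jge_vector R K T (col X r))))
     \<and> (border_rank I1 I2 I3 Tp = R \<and> simple_tensor R K T \<longrightarrow> tensor_rank I1 I2 I3 Tp = R)
     \<and> (border_rank I1 I2 I3 Tp = R \<and> tensor_rank I1 I2 I3 Tp > R \<and> slice_mix_invertible R K T
          \<longrightarrow> (\<exists>L. jge_value R K T L \<and> jge_gm R K T L \<ge> 1 \<and> jge_am R K T L > jge_gm R K T L))"
proof -
  obtain V1 V2 V3 where "orth_basis_mat I1 R (fibers1 I1 I2 I3 Tp) V1"
      "orth_basis_mat I2 R (fibers2 I1 I2 I3 Tp) V2" "orth_basis_mat I3 K (fibers3 I1 I2 I3 Tp) V3"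
      "T = compress I1 I2 I3 R R K Tp V1 V2 V3"
    using comp unfolding orth_compression_def by blast
  then have tc: "tensor_compression I1 I2 I3 R R K Tp T V1 V2 V3" by unfold_locales
  interpret tensor_compression I1 I2 I3 R R K Tp T V1 V2 V3 by (rule tc)
  interpret nondegenerate_tensor R K T
  proof
    show "x a = 0" if "\<And>b c. b < R \<Longrightarrow> c < K \<Longrightarrow> (\<Sum>a<R. T a b c * x a) = 0" "a < R" for x a
      using that by (rule nondegenerate1)
    show "x b = 0" if "\<And>a c. a < R \<Longrightarrow> c < K \<Longrightarrow> (\<Sum>b<R. T a b c * x b) = 0" "b < R" for x b
      using that by (rule nondegenerate2)
  qed
  have rank_le: "tensor_rank I1 I2 I3 Tp \<le> r \<longleftrightarrow> has_cpd R R K T r" for r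
    using tensor_rank_le_iff[OF Tp_in] has_cpd_compression by simp
  have rank_ge: "R \<le> tensor_rank I1 I2 I3 Tp" using rank_le has_cpd_ge by blast
  \<comment> \<open>Nondegeneracy excludes shorter decompositions, so rank \<open>R\<close> means
    that one of length \<open>R\<close> exists.\<close>
  have rank_eq: "tensor_rank I1 I2 I3 Tp = R \<longleftrightarrow> has_cpd R R K T R"
    using rank_le[of R] rank_ge by auto
  have part1: "tensor_rank I1 I2 I3 Tp = R \<longleftrightarrow> vspan R {x. jge_vector R K T x} = carrier_vec R"
    unfolding rank_eq using has_cpd_imp_jge_span jge_span_imp_has_cpd by blast
  have part3: "\<exists>L. jge_value R K T L \<and> jge_gm R K T L \<ge> 1 \<and> jge_am R K T L > jge_gm R K T L \<and>
      (\<exists>lam. lam \<in> carrier_vec K \<and> lam \<noteq> 0\<^sub>v K \<and> lin_pow_dvd_char R K T lam (jge_am R K T L))"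
    if "border_rank I1 I2 I3 Tp = R" "slice_mix_invertible R K T" "tensor_rank I1 I2 I3 Tp \<noteq> R"
    by (rule border_rank_jge[OF conj_std tc Tp_in that(1,2)]) (use that(3) rank_eq in blast)
  have part2: "tensor_rank I1 I2 I3 Tp = R"
    if border: "border_rank I1 I2 I3 Tp = R" and simple: "simple_tensor R K T"
  proof (rule ccontr)
    assume "tensor_rank I1 I2 I3 Tp \<noteq> R"
    then obtain L lam where "jge_gm R K T L \<ge> 1" "jge_am R K T L > jge_gm R K T L"
      "lam \<in> carrier_vec K" "lam \<noteq> 0\<^sub>v K" "lin_pow_dvd_char R K T lam (jge_am R K T L)"
      using part3 border simple unfolding simple_tensor_def by blast
    \<comment> \<open>From \<open>am > gm\<close> and \<open>gm \<ge> 1\<close> the multiplicity is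
      at least two.\<close>
    then show False using simple_tensor_no_square_factor[OF simple, of lam "jge_am R K T L"] by simp
  qed
  have decomp: "{L. jge_value R K T L} = {vspan K {col C r} | r. r < R} \<and> invertible_mat B \<and>
      (\<forall>X \<in> carrier_mat R R. transpose_mat B * X = 1\<^sub>m R \<longrightarrow> (\<forall>r<R. jge_vector R K T (col X r)))"
    if "is_decomp R R K T R A B C" for A B C
    using decomp_jge[OF that] by simp
  show ?thesis
  proof (intro conjI)
    show "tensor_rank I1 I2 I3 Tp = R \<longleftrightarrow> vspan R {x. jge_vector R K T x} = carrier_vec R"
      by (rule part1)
    show "\<forall>A B C. is_decomp R R K T R A B C \<and> tensor_rank R R K T = R \<longrightarrow>
           {L. jge_value R K T L} = {vspan K {col C r} | r. r < R} \<and>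
           invertible_mat B \<and>
           (\<forall>X \<in> carrier_mat R R. transpose_mat B * X = 1\<^sub>m R \<longrightarrow>
              (\<forall>r<R. jge_vector R K T (col X r)))"
      by (intro allI impI, elim conjE) (rule decomp)
    show "border_rank I1 I2 I3 Tp = R \<and> simple_tensor R K T \<longrightarrow> tensor_rank I1 I2 I3 Tp = R"
      using part2 by simp
    show "border_rank I1 I2 I3 Tp = R \<and> tensor_rank I1 I2 I3 Tp > R \<and> slice_mix_invertible R K T
          \<longrightarrow> (\<exists>L. jge_value R K T L \<and> jge_gm R K T L \<ge> 1 \<and> jge_am R K T L > jge_gm R K T L)"
      using part3 by (metis less_irrefl)
  qed
qed

end
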